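(* Let $k=\mathbb C$ and let $M$ be a right-left SAYD module over $H$. (1) Let $\mathcal D_H,\mathcal D'_H$ be left $H$-categories. An $H$-linear semifunctor $\alpha:\mathcal D_H\to\mathcal D'_H$ induces, for all $n\ge0$, a morphism $C^n_H(\alpha,M):C^n_H(\mathcal{D}_H',M)\longrightarrow C^n_H(\mathcal{D}_H,M)$ determined by $$C^{n}_H(\alpha,M)(\phi)(m \otimes f^0 \otimes \ldots \otimes f^n)=\phi\left(m \otimes \alpha(f^0) \otimes \ldots \otimes \alpha(f^n)\right)$$ for $\phi \in C^n_H(\mathcal{D}_H',M)$, $m \in M$ and $f^0 \otimes \ldots \otimes f^n \in CN_n(\mathcal{D}_H)$. This leads to a morphism $C^{\bullet\bullet}_H(\alpha,M)^{cy}:C^{\bullet\bullet}_H(\mathcal{D}_H',M)^{cy} \longrightarrow C^{\bullet\bullet}_H(\mathcal{D}_H,M)^{cy}$ of double complexes and induces a functor $HC^\bullet_H(-,M):\overline{Cat}_H^{op} \longrightarrow Vect_k$. (2) Let $\mathcal D_H$ be a left $H$-category and $\eta\in \mathbb U_H(\mathcal D_H)$. Then the automorphism $\Phi_\eta$ of $\mathcal D_H$, which fixes objects and sends $f\in Hom_{\mathcal D_H}(X,Y)$ to $\eta(Y)\circ f\circ\eta(X)^{-1}$, induces the identity map on $HC^\bullet_H(\mathcal{D}_H,M)$.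
   Context: $k=\mathbb C$; $H$ is a Hopf algebra over $k$ with coproduct $\Delta(h)=h_1\otimes h_2$, counit $\varepsilon$, bijective antipode $S$. A left $H$-category is a small $k$-linear category $\mathcal D_H$ with each $Hom_{\mathcal D_H}(X,Y)$ a left $H$-module, $h(id_X)=\varepsilon(h)id_X$, $h(gf)=(h_1g)(h_2f)$. A semifunctor preserves composition but not necessarily identities. $\overline{Cat}_H$ is the category of left $H$-categories with $H$-linear semifunctors as morphisms; $Vect_k$ is the category of $k$-vector spaces. A right-left SAYD module is a right $H$-module and left $H$-comodule $M$, $m\mapsto m_{(-1)}\otimes m_{(0)}$, with $(mh)_{(-1)}\otimes(mh)_{(0)}=S(h_3)m_{(-1)}h_1\otimes m_{(0)}h_2$ and $m_{(0)}m_{(-1)}=m$. $CN_n(\mathcal D_H)=\bigoplus_{(X_0,\ldots,X_n)}Hom_{\mathcal D_H}(X_1,X_0)\otimes\ldots\otimes Hom_{\mathcal D_H}(X_0,X_n)$ with diagonal $H$-action. $C^n_H(\mathcal D_H,M)$ is the space of $k$-linear $\phi:M\otimes CN_n(\mathcal D_H)\to k$ with $\phi(mh_1\otimes S(h_2)(f^0\otimes\ldots\otimes f^n))=\varepsilon(h)\phi(m\otimes f^0\otimes\ldots\otimes f^n)$. It is a cocyclic module with $(\delta_i\phi)(m\otimes f^0\otimes\ldots\otimes f^n)=\phi(m\otimes\ldots\otimes f^if^{i+1}\otimes\ldots\otimes f^n)$ ($0\le i\le n-1$), $(\delta_n\phi)(m\otimes f^0\otimes\ldots\otimes f^n)=\phi(m_{(0)}\otimes(S^{-1}(m_{(-1)})f^n)f^0\otimes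 f^1\otimes\ldots\otimes f^{n-1})$, codegeneracies given by inserting identities, $(\tau_n\phi)(m\otimes f^0\otimes\ldots\otimes f^n)=\phi(m_{(0)}\otimes S^{-1}(m_{(-1)})f^n\otimes f^0\otimes\ldots\otimes f^{n-1})$. $C^{\bullet\bullet}_H(\mathcal D_H,M)^{cy}$ is the standard cyclic bicomplex with columns alternately $(C^\bullet_H,b)$ and $(C^\bullet_H,-b')$, where $b=\sum_{i=0}^{n+1}(-1)^i\delta_i$, $b'=\sum_{i=0}^n(-1)^i\delta_i$, and horizontal maps alternately $1-\lambda$ and $N=\sum_{j=0}^n\lambda^j$, $\lambda=(-1)^n\tau_n$; its total cohomology is $HC^\bullet_H(\mathcal D_H,M)$. $\mathbb U_H(\mathcal D_H)$ is the set of families $\eta=\{\eta(X)\in Aut_{\mathcal D_H}(X)\}_{X\in Ob(\mathcal D_H)}$ with $h(\eta(X))=\varepsilon(h)\eta(X)$ for all $h\in H$, $X\in Ob(\mathcal D_H)$. *)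

theory Defs
  imports
    Complex_Main
    "HOL-Library.Poly_Mapping"
    "HOL-Library.Function_Algebras"
    "HOL-Library.Set_Algebras"
    "HOL-Library.FuncSet"
    "HOL-Algebra.Module"
begin

section \<open>Complex vector spaces\<close>

class complex_vector = ab_group_add +
  fixes scaleC :: "complex \<Rightarrow> 'a \<Rightarrow> 'a"  (infixr \<open>*\<^sub>C\<close> 75)
  assumes scaleC_add_right: "a *\<^sub>C (x + y) = a *\<^sub>C x + a *\<^sub>C y"
    and scaleC_add_left: "(a + b) *\<^sub>C x = a *\<^sub>C x + b *\<^sub>C x"
    and scaleC_scaleC: "a *\<^sub>C (b *\<^sub>C x) = (a * b) *\<^sub>C x"
    and scaleC_one: "1 *\<^sub>C x = x"

class complex_algebra = complex_vector + ring_1 +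
  assumes mult_scaleC_left: "(a *\<^sub>C x) * y = a *\<^sub>C (x * y)"
    and mult_scaleC_right: "x * (a *\<^sub>C y) = a *\<^sub>C (x * y)"

global_interpretation cvec: vector_space "scaleC :: complex \<Rightarrow> 'a \<Rightarrow> 'a::complex_vector"
  by unfold_locales (simp_all add: scaleC_add_right scaleC_add_left scaleC_scaleC scaleC_one)

abbreviation clinear :: "('a::complex_vector \<Rightarrow> 'b::complex_vector) \<Rightarrow> bool"
  where "clinear \<equiv> Vector_Spaces.linear scaleC scaleC"

instantiation complex :: complex_vector
begin
definition scaleC_complex :: "complex \<Rightarrow> complex \<Rightarrow> complex" where "scaleC_complex = (*)"
instance by standard (simp_all add: scaleC_complex_def algebra_simps)
end

instantiation "fun" :: (type, complex_vector) complex_vector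
begin
definition scaleC_fun :: "complex \<Rightarrow> ('a \<Rightarrow> 'b) \<Rightarrow> ('a \<Rightarrow> 'b)"
  where "scaleC_fun a f = (\<lambda>x. a *\<^sub>C f x)"
instance
  by standard (simp_all add: scaleC_fun_def plus_fun_def scaleC_add_right scaleC_add_left
      scaleC_scaleC scaleC_one)
end

instantiation poly_mapping :: (type, complex_vector) complex_vector
begin
definition scaleC_poly_mapping :: "complex \<Rightarrow> ('a \<Rightarrow>\<^sub>0 'b) \<Rightarrow> ('a \<Rightarrow>\<^sub>0 'b)"
  where "scaleC_poly_mapping a p = Poly_Mapping.map (scaleC a) p"
instance
proof
  have L: "Poly_Mapping.lookup (a *\<^sub>C p) k = a *\<^sub>C Poly_Mapping.lookup p k" for a and p :: "'a \<Rightarrow>\<^sub>0 'b" and k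
    by (cases "Poly_Mapping.lookup p k = 0") (simp_all add: scaleC_poly_mapping_def Poly_Mapping.map.rep_eq)
  fix a b :: complex and x y :: "'a \<Rightarrow>\<^sub>0 'b"
  show "a *\<^sub>C (x + y) = a *\<^sub>C x + a *\<^sub>C y"
    by (rule poly_mapping_eqI) (simp add: L lookup_add scaleC_add_right)
  show "(a + b) *\<^sub>C x = a *\<^sub>C x + b *\<^sub>C x"
    by (rule poly_mapping_eqI) (simp add: L lookup_add scaleC_add_left)
  show "a *\<^sub>C (b *\<^sub>C x) = (a * b) *\<^sub>C x"
    by (rule poly_mapping_eqI) (simp add: L scaleC_scaleC)
  show "1 *\<^sub>C x = x"
    by (rule poly_mapping_eqI) (simp add: L scaleC_one)
qed
end

lemma lookup_scaleC [simp]: "Poly_Mapping.lookup (a *\<^sub>C p) k = a *\<^sub>C Poly_Mapping.lookup p k"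
  by (cases "Poly_Mapping.lookup p k = 0") (simp_all add: scaleC_poly_mapping_def Poly_Mapping.map.rep_eq)

text \<open>
  The type \<^typ>\<open>'g \<Rightarrow>\<^sub>0 complex\<close> is the vector space with basis \<^typ>\<open>'g\<close>;
  \<open>free_on G\<close> is its subspace with basis \<open>G\<close>.
\<close>

definition gen :: "'g \<Rightarrow> ('g \<Rightarrow>\<^sub>0 complex)"
  where "gen g = Poly_Mapping.single g 1"

definition free_on :: "'g set \<Rightarrow> ('g \<Rightarrow>\<^sub>0 complex) set"
  where "free_on G = {p. Poly_Mapping.keys p \<subseteq> G}"

definition free_lift :: "('g \<Rightarrow> 'v::complex_vector) \<Rightarrow> ('g \<Rightarrow>\<^sub>0 complex) \<Rightarrow> 'v"
  where "free_lift F p = (\<Sum>g\<in>Poly_Mapping.keys p. Poly_Mapping.lookup p g *\<^sub>C F g)"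

subsection \<open>Vector spaces given by a carrier\<close>

text \<open>
  The objects of \<open>Vect\<close> are the modules of \<^theory>\<open>HOL-Algebra.Module\<close> over the field of
  complex numbers. The ring multiplication and unit which the record type also carries play
  no role and are left undefined.
\<close>

definition complex_field :: "complex ring"
  where "complex_field = \<lparr>carrier = UNIV, mult = (*), one = 1, zero = 0, add = (+)\<rparr>"

definition vect_hom :: "(complex, 'a) module \<Rightarrow> (complex, 'b) module \<Rightarrow> ('a \<Rightarrow> 'b) set"
  where "vect_hom V W = {f \<in> carrier V \<rightarrow> carrier W.
    (\<forall>x\<in>carrier V. \<forall>y\<in>carrier V. f (x \<oplus>\<^bsub>V\<^esub> y) = f x \<oplus>\<^bsub>W\<^esub> f y) \<and>
    (\<forall>a. \<forall>x\<in>carrier V. f (a \<odot>\<^bsub>V\<^esub> x) = a \<odot>\<^bsub>W\<^esub> f x)}"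

definition subsp :: "'a::complex_vector set \<Rightarrow> (complex, 'a) module"
  where "subsp V = \<lparr>carrier = V, mult = undefined, one = undefined, zero = 0, add = (+),
    smult = scaleC\<rparr>"

text \<open>
  The quotient of \<open>V\<close> by \<open>W\<close>, with cosets as elements. In the scalar multiplication \<open>W\<close> is
  added so that \<open>0\<close> times a coset is the coset \<open>W\<close>, not the set \<open>{0}\<close>.
\<close>

definition quotient_space :: "'a::complex_vector set \<Rightarrow> 'a set \<Rightarrow> (complex, 'a set) module"
  where "quotient_space V W = \<lparr>carrier = (\<lambda>x. x +o W) ` V, mult = undefined, one = undefined,
    zero = W, add = (+), smult = (\<lambda>a A. scaleC a ` A + W)\<rparr>"

subsection \<open>Tensor product of two vector spaces\<close>

definition tensor_relations :: "(('a::complex_vector \<times> 'b::complex_vector) \<Rightarrow>\<^sub>0 complex) set"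
  where "tensor_relations =
    {gen (a *\<^sub>C x + x', y) - a *\<^sub>C gen (x, y) - gen (x', y) | a x x' y. True} \<union>
    {gen (x, a *\<^sub>C y + y') - a *\<^sub>C gen (x, y) - gen (x, y') | a x y y'. True}"

quotient_type (overloaded) ('a, 'b) tensor = "('a::complex_vector \<times> 'b::complex_vector) \<Rightarrow>\<^sub>0 complex" /
    "\<lambda>p q. p - q \<in> cvec.span tensor_relations"
proof (rule equivpI)
  let ?W = "cvec.span (tensor_relations :: (('a \<times> 'b) \<Rightarrow>\<^sub>0 complex) set)"
  show "reflp (\<lambda>p q. p - q \<in> ?W)"
    by (auto intro!: reflpI cvec.span_zero)
  show "symp (\<lambda>p q. p - q \<in> ?W)"
    by (rule sympI) (metis cvec.span_neg minus_diff_eq)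
  show "transp (\<lambda>p q. p - q \<in> ?W)"
  proof (rule transpI)
    fix p q r assume "p - q \<in> ?W" "q - r \<in> ?W"
    from cvec.span_add[OF this] show "p - r \<in> ?W" by simp
  qed
qed

instantiation tensor :: (complex_vector, complex_vector) complex_vector
begin

lift_definition zero_tensor :: "('a, 'b) tensor" is 0 .

lift_definition plus_tensor :: "('a, 'b) tensor \<Rightarrow> ('a, 'b) tensor \<Rightarrow> ('a, 'b) tensor" is "(+)"
proof -
  fix p p' q q' :: "('a \<times> 'b) \<Rightarrow>\<^sub>0 complex"
  assume "p - p' \<in> cvec.span tensor_relations" "q - q' \<in> cvec.span tensor_relations"
  from cvec.span_add[OF this]
  show "p + q - (p' + q') \<in> cvec.span tensor_relations" by (simp add: algebra_simps)
qed

lift_definition uminus_tensor :: "('a, 'b) tensor \<Rightarrow> ('a, 'b) tensor" is uminus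
proof -
  fix p p' :: "('a \<times> 'b) \<Rightarrow>\<^sub>0 complex"
  assume "p - p' \<in> cvec.span tensor_relations"
  from cvec.span_neg[OF this]
  show "- p - - p' \<in> cvec.span tensor_relations" by (simp add: algebra_simps)
qed

lift_definition minus_tensor :: "('a, 'b) tensor \<Rightarrow> ('a, 'b) tensor \<Rightarrow> ('a, 'b) tensor" is "(-)"
proof -
  fix p p' q q' :: "('a \<times> 'b) \<Rightarrow>\<^sub>0 complex"
  assume "p - p' \<in> cvec.span tensor_relations" "q - q' \<in> cvec.span tensor_relations"
  from cvec.span_diff[OF this]
  show "p - q - (p' - q') \<in> cvec.span tensor_relations" by (simp add: algebra_simps)
qed

lift_definition scaleC_tensor :: "complex \<Rightarrow> ('a, 'b) tensor \<Rightarrow> ('a, 'b) tensor" is scaleC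
proof -
  fix a and p p' :: "('a \<times> 'b) \<Rightarrow>\<^sub>0 complex"
  assume "p - p' \<in> cvec.span tensor_relations"
  from cvec.span_scale[OF this]
  show "a *\<^sub>C p - a *\<^sub>C p' \<in> cvec.span tensor_relations" by (simp add: cvec.scale_right_diff_distrib)
qed

instance
  by standard
    (transfer, simp add: algebra_simps scaleC_add_right scaleC_add_left scaleC_scaleC scaleC_one
      cvec.span_zero)+

end

lift_definition pure_tensor :: "'a::complex_vector \<Rightarrow> 'b::complex_vector \<Rightarrow> ('a, 'b) tensor"
    (infixr \<open>\<boxtimes>\<close> 72)
  is "\<lambda>x y. gen (x, y)" .

text \<open>
  \<open>tensor_lift B\<close> is the linear map sending \<open>x \<boxtimes> y\<close> to \<open>B x y\<close>. It is used for
  bilinear \<open>B\<close> only; then it does not depend on the representative, see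
  \<open>tensor_lift_pure\<close> and \<open>clinear_tensor_lift\<close> below. In Sweedler notation
  \<open>tensor_lift (\<lambda>a b. F a b) (\<Delta> h)\<close> is \<open>F h\<^sub>1 h\<^sub>2\<close>.
\<close>

definition tensor_lift ::
    "('a::complex_vector \<Rightarrow> 'b::complex_vector \<Rightarrow> 'c::complex_vector) \<Rightarrow> ('a, 'b) tensor \<Rightarrow> 'c"
  where "tensor_lift B t = free_lift (\<lambda>(x, y). B x y) (rep_tensor t)"

lemma free_lift_superset:
  assumes "finite S" "Poly_Mapping.keys p \<subseteq> S"
  shows "free_lift F p = (\<Sum>g\<in>S. Poly_Mapping.lookup p g *\<^sub>C F g)"
  unfolding free_lift_def using assms
  by (intro sum.mono_neutral_left) (auto simp: in_keys_iff)

lemma free_lift_add: "free_lift F (p + q) = free_lift F p + free_lift F q"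
proof -
  let ?S = "Poly_Mapping.keys p \<union> Poly_Mapping.keys q"
  have "free_lift F r = (\<Sum>g\<in>?S. Poly_Mapping.lookup r g *\<^sub>C F g)" if "r \<in> {p, q, p + q}" for r
    using that Poly_Mapping.keys_add[of p q] by (intro free_lift_superset) auto
  then show ?thesis
    by (simp add: lookup_add scaleC_add_left sum.distrib)
qed

lemma free_lift_scale: "free_lift F (a *\<^sub>C p) = a *\<^sub>C free_lift F p"
proof -
  have "free_lift F (a *\<^sub>C p) = (\<Sum>g\<in>Poly_Mapping.keys p. Poly_Mapping.lookup (a *\<^sub>C p) g *\<^sub>C F g)"
    by (intro free_lift_superset) (auto simp: in_keys_iff)
  then show ?thesis
    by (simp add: free_lift_def cvec.scale_sum_right scaleC_complex_def scaleC_scaleC)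
qed

lemma clinear_free_lift: "clinear (free_lift F)"
  by unfold_locales (simp_all add: free_lift_add free_lift_scale)

lemma free_lift_gen [simp]: "free_lift F (gen g) = F g"
  by (simp add: free_lift_def gen_def scaleC_one)

lemma free_lift_tensor_cong:
  fixes B :: "'a::complex_vector \<Rightarrow> 'b::complex_vector \<Rightarrow> 'c::complex_vector"
  assumes left: "\<And>y. clinear (\<lambda>x. B x y)" and right: "\<And>x. clinear (B x)"
    and cong: "p - q \<in> cvec.span tensor_relations"
  shows "free_lift (\<lambda>(x, y). B x y) p = free_lift (\<lambda>(x, y). B x y) q"
proof -
  let ?L = "free_lift (\<lambda>(x, y). B x y)"
  interpret L: Vector_Spaces.linear scaleC scaleC ?L by (rule clinear_free_lift)
  have "B (a *\<^sub>C x + x') y = a *\<^sub>C B x y + B x' y" for a x x' y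
  proof -
    interpret l: Vector_Spaces.linear scaleC scaleC "\<lambda>x. B x y" by (rule left)
    show ?thesis by (simp add: l.add l.scale)
  qed
  moreover have "B x (a *\<^sub>C y + y') = a *\<^sub>C B x y + B x y'" for a x y y'
  proof -
    interpret r: Vector_Spaces.linear scaleC scaleC "B x" by (rule right)
    show ?thesis by (simp add: r.add r.scale)
  qed
  ultimately have "?L r = 0" if "r \<in> tensor_relations" for r
    using that by (auto simp: tensor_relations_def L.diff L.scale)
  then have "?L (p - q) = 0"
    using cong by (rule L.eq_0_on_span)
  then show ?thesis by (simp add: L.diff)
qed

lemma rep_tensor_abs: "p - rep_tensor (abs_tensor p) \<in> cvec.span tensor_relations"
proof -
  have "rep_tensor (abs_tensor p) - p \<in> cvec.span tensor_relations"
    using Quotient3_rep_abs[OF Quotient3_tensor, of p] by (simp add: cvec.span_zero)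
  from cvec.span_neg[OF this] show ?thesis by simp
qed

lemma tensor_lift_abs:
  fixes B :: "'a::complex_vector \<Rightarrow> 'b::complex_vector \<Rightarrow> 'c::complex_vector"
  assumes "\<And>y. clinear (\<lambda>x. B x y)" "\<And>x. clinear (B x)"
  shows "tensor_lift B (abs_tensor p) = free_lift (\<lambda>(x, y). B x y) p"
  unfolding tensor_lift_def
  by (rule sym, rule free_lift_tensor_cong[OF assms rep_tensor_abs])

lemma tensor_lift_pure:
  fixes B :: "'a::complex_vector \<Rightarrow> 'b::complex_vector \<Rightarrow> 'c::complex_vector"
  assumes "\<And>y. clinear (\<lambda>x. B x y)" "\<And>x. clinear (B x)"
  shows "tensor_lift B (x \<boxtimes> y) = B x y"
  by (simp add: pure_tensor.abs_eq tensor_lift_abs[OF assms])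

lemma clinear_tensor_lift:
  fixes B :: "'a::complex_vector \<Rightarrow> 'b::complex_vector \<Rightarrow> 'c::complex_vector"
  assumes "\<And>y. clinear (\<lambda>x. B x y)" "\<And>x. clinear (B x)"
  shows "clinear (tensor_lift B)"
proof unfold_locales
  fix s t :: "('a, 'b) tensor" and a :: complex
  obtain p q where "s = abs_tensor p" "t = abs_tensor q"
    by (metis Quotient3_abs_rep[OF Quotient3_tensor])
  then show "tensor_lift B (s + t) = tensor_lift B s + tensor_lift B t"
    and "tensor_lift B (a *\<^sub>C s) = a *\<^sub>C tensor_lift B s"
    by (simp_all add: plus_tensor.abs_eq scaleC_tensor.abs_eq tensor_lift_abs[OF assms]
        free_lift_add free_lift_scale)
qed

section \<open>Hopf algebras and their modules\<close>

record (overloaded) ('h::complex_vector) hopf =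
  comult :: "'h \<Rightarrow> ('h, 'h) tensor"
  counit :: "'h \<Rightarrow> complex"
  antipode :: "'h \<Rightarrow> 'h"

text \<open>
  \<open>sweedler H n h K\<close> is \<open>K [h\<^sub>1, \<dots>, h\<^sub>n]\<close> in Sweedler notation, for multilinear \<open>K\<close>.
\<close>

fun sweedler ::
    "('h::complex_vector) hopf \<Rightarrow> nat \<Rightarrow> 'h \<Rightarrow> ('h list \<Rightarrow> 'v::complex_vector) \<Rightarrow> 'v"
where
  "sweedler H 0 h K = counit H h *\<^sub>C K []"
| "sweedler H (Suc 0) h K = K [h]"
| "sweedler H (Suc (Suc n)) h K =
    tensor_lift (\<lambda>a b. sweedler H (Suc n) b (\<lambda>hs. K (a # hs))) (comult H h)"

locale hopf_algebra =
  fixes H :: "('h::complex_algebra) hopf"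
  assumes comult_linear: "clinear (comult H)"
    and counit_linear: "clinear (counit H)"
    and antipode_linear: "clinear (antipode H)"
    and coassoc: "tensor_lift (\<lambda>a b. tensor_lift (\<lambda>a1 a2. a1 \<boxtimes> a2 \<boxtimes> b) (comult H a)) (comult H h) =
      tensor_lift (\<lambda>a b. a \<boxtimes> comult H b) (comult H h)"
    and counit_left: "tensor_lift (\<lambda>a b. counit H a *\<^sub>C b) (comult H h) = h"
    and counit_right: "tensor_lift (\<lambda>a b. counit H b *\<^sub>C a) (comult H h) = h"
    and comult_mult: "comult H (g * h) =
      tensor_lift (\<lambda>a b. tensor_lift (\<lambda>c d. (a * c) \<boxtimes> (b * d)) (comult H h)) (comult H g)"
    and comult_one: "comult H 1 = 1 \<boxtimes> 1"
    and counit_mult: "counit H (g * h) = counit H g * counit H h"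
    and counit_one: "counit H 1 = 1"
    and antipode_left: "tensor_lift (\<lambda>a b. antipode H a * b) (comult H h) = counit H h *\<^sub>C 1"
    and antipode_right: "tensor_lift (\<lambda>a b. a * antipode H b) (comult H h) = counit H h *\<^sub>C 1"
    and antipode_bij: "bij (antipode H)"

record (overloaded) ('h::complex_vector, 'm::complex_vector) hopf_module =
  ract :: "'m \<Rightarrow> 'h \<Rightarrow> 'm"
  coact :: "'m \<Rightarrow> ('h, 'm) tensor"

text \<open>Right-left stable anti-Yetter-Drinfeld modules.\<close>

locale sayd_module = hopf_algebra H
  for H :: "('h::complex_algebra) hopf" +
  fixes M :: "('h, 'm::complex_vector) hopf_module"
  assumes ract_linear_left: "clinear (\<lambda>m. ract M m h)"
    and ract_linear_right: "clinear (ract M m)"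
    and ract_one: "ract M m 1 = m"
    and ract_mult: "ract M m (g * h) = ract M (ract M m g) h"
    and coact_linear: "clinear (coact M)"
    and coact_coassoc:
      "tensor_lift (\<lambda>a x. tensor_lift (\<lambda>a1 a2. a1 \<boxtimes> a2 \<boxtimes> x) (comult H a)) (coact M m) =
       tensor_lift (\<lambda>a x. a \<boxtimes> coact M x) (coact M m)"
    and coact_counit: "tensor_lift (\<lambda>a x. counit H a *\<^sub>C x) (coact M m) = m"
    and anti_yetter_drinfeld: "coact M (ract M m h) =
      sweedler H 3 h (\<lambda>hs. tensor_lift (\<lambda>a x. (antipode H (hs ! 2) * a * hs ! 0) \<boxtimes> ract M x (hs ! 1))
        (coact M m))"
    and stable: "tensor_lift (\<lambda>a x. ract M x a) (coact M m) = m"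

section \<open>Left H-categories\<close>

text \<open>
  The morphism spaces are subspaces of one ambient vector space \<^typ>\<open>'f\<close>. This is no
  restriction, since every family of vector spaces embeds into its direct sum; morphism spaces
  for different pairs of objects may overlap, which is why composition and action carry the
  objects as arguments. \<open>Comp D X Y Z g f\<close> is \<open>g \<circ> f\<close> for \<open>f : X \<rightarrow> Y\<close> and \<open>g : Y \<rightarrow> Z\<close>.
\<close>

record ('o, 'f, 'h) hcat =
  Ob :: "'o set"
  Hom :: "'o \<Rightarrow> 'o \<Rightarrow> 'f set"
  Comp :: "'o \<Rightarrow> 'o \<Rightarrow> 'o \<Rightarrow> 'f \<Rightarrow> 'f \<Rightarrow> 'f"
  Id :: "'o \<Rightarrow> 'f"
  Act :: "'o \<Rightarrow> 'o \<Rightarrow> 'h \<Rightarrow> 'f \<Rightarrow> 'f"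

locale left_H_category = hopf_algebra H
  for H :: "('h::complex_algebra) hopf" +
  fixes D :: "('o, 'f::complex_vector, 'h) hcat"
  assumes Hom_subspace: "\<lbrakk>X \<in> Ob D; Y \<in> Ob D\<rbrakk> \<Longrightarrow> cvec.subspace (Hom D X Y)"
    and Id_closed: "X \<in> Ob D \<Longrightarrow> Id D X \<in> Hom D X X"
    and Comp_linear_left: "\<lbrakk>X \<in> Ob D; Y \<in> Ob D; Z \<in> Ob D; f \<in> Hom D X Y\<rbrakk> \<Longrightarrow>
      (\<lambda>g. Comp D X Y Z g f) \<in> vect_hom (subsp (Hom D Y Z)) (subsp (Hom D X Z))"
    and Comp_linear_right: "\<lbrakk>X \<in> Ob D; Y \<in> Ob D; Z \<in> Ob D; g \<in> Hom D Y Z\<rbrakk> \<Longrightarrow>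
      Comp D X Y Z g \<in> vect_hom (subsp (Hom D X Y)) (subsp (Hom D X Z))"
    and Comp_assoc: "\<lbrakk>W \<in> Ob D; X \<in> Ob D; Y \<in> Ob D; Z \<in> Ob D;
      f \<in> Hom D W X; g \<in> Hom D X Y; k \<in> Hom D Y Z\<rbrakk> \<Longrightarrow>
      Comp D W X Z (Comp D X Y Z k g) f = Comp D W Y Z k (Comp D W X Y g f)"
    and Id_left: "\<lbrakk>X \<in> Ob D; Y \<in> Ob D; f \<in> Hom D X Y\<rbrakk> \<Longrightarrow> Comp D X Y Y (Id D Y) f = f"
    and Id_right: "\<lbrakk>X \<in> Ob D; Y \<in> Ob D; f \<in> Hom D X Y\<rbrakk> \<Longrightarrow> Comp D X X Y f (Id D X) = f"
    and Act_linear_left: "\<lbrakk>X \<in> Ob D; Y \<in> Ob D; f \<in> Hom D X Y\<rbrakk> \<Longrightarrow>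
      (\<lambda>h. Act D X Y h f) \<in> vect_hom (subsp UNIV) (subsp (Hom D X Y))"
    and Act_linear_right: "\<lbrakk>X \<in> Ob D; Y \<in> Ob D\<rbrakk> \<Longrightarrow>
      Act D X Y h \<in> vect_hom (subsp (Hom D X Y)) (subsp (Hom D X Y))"
    and Act_one: "\<lbrakk>X \<in> Ob D; Y \<in> Ob D; f \<in> Hom D X Y\<rbrakk> \<Longrightarrow> Act D X Y 1 f = f"
    and Act_mult: "\<lbrakk>X \<in> Ob D; Y \<in> Ob D; f \<in> Hom D X Y\<rbrakk> \<Longrightarrow>
      Act D X Y (h' * h) f = Act D X Y h' (Act D X Y h f)"
    and Act_Id: "X \<in> Ob D \<Longrightarrow> Act D X X h (Id D X) = counit H h *\<^sub>C Id D X"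
    and Act_Comp: "\<lbrakk>X \<in> Ob D; Y \<in> Ob D; Z \<in> Ob D; f \<in> Hom D X Y; g \<in> Hom D Y Z\<rbrakk> \<Longrightarrow>
      Act D X Z h (Comp D X Y Z g f) =
        tensor_lift (\<lambda>a b. Comp D X Y Z (Act D Y Z a g) (Act D X Y b f)) (comult H h)"

subsection \<open>H-linear semifunctors\<close>

record ('o, 'f, 'p, 'g) semifunctor =
  obj_map :: "'o \<Rightarrow> 'p"
  arr_map :: "'o \<Rightarrow> 'o \<Rightarrow> 'f \<Rightarrow> 'g"

text \<open>
  Semifunctors are required to be undefined outside their domain, so that two of them are equal
  as soon as they agree on objects and morphisms.
\<close>

definition semifunctor_on ::
    "('o, 'f, 'h) hcat \<Rightarrow> ('o \<Rightarrow> 'p) \<Rightarrow> ('o \<Rightarrow> 'o \<Rightarrow> 'f \<Rightarrow> 'g) \<Rightarrow> ('o, 'f, 'p, 'g) semifunctor"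
  where "semifunctor_on D F G =
    \<lparr>obj_map = (\<lambda>X. if X \<in> Ob D then F X else undefined),
     arr_map = (\<lambda>X Y f. if X \<in> Ob D \<and> Y \<in> Ob D \<and> f \<in> Hom D X Y then G X Y f else undefined)\<rparr>"

definition H_semifunctor :: "('o, 'f::complex_vector, 'h) hcat \<Rightarrow>
    ('p, 'g::complex_vector, 'h) hcat \<Rightarrow> ('o, 'f, 'p, 'g) semifunctor \<Rightarrow> bool"
  where "H_semifunctor D D' \<alpha> \<longleftrightarrow>
    \<alpha> = semifunctor_on D (obj_map \<alpha>) (arr_map \<alpha>) \<and>
    (\<forall>X\<in>Ob D. obj_map \<alpha> X \<in> Ob D') \<and>
    (\<forall>X\<in>Ob D. \<forall>Y\<in>Ob D. arr_map \<alpha> X Y \<in>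
      vect_hom (subsp (Hom D X Y)) (subsp (Hom D' (obj_map \<alpha> X) (obj_map \<alpha> Y)))) \<and>
    (\<forall>X\<in>Ob D. \<forall>Y\<in>Ob D. \<forall>h. \<forall>f\<in>Hom D X Y.
      arr_map \<alpha> X Y (Act D X Y h f) = Act D' (obj_map \<alpha> X) (obj_map \<alpha> Y) h (arr_map \<alpha> X Y f)) \<and>
    (\<forall>X\<in>Ob D. \<forall>Y\<in>Ob D. \<forall>Z\<in>Ob D. \<forall>f\<in>Hom D X Y. \<forall>g\<in>Hom D Y Z.
      arr_map \<alpha> X Z (Comp D X Y Z g f) =
        Comp D' (obj_map \<alpha> X) (obj_map \<alpha> Y) (obj_map \<alpha> Z) (arr_map \<alpha> Y Z g) (arr_map \<alpha> X Y f))"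

definition id_semifunctor :: "('o, 'f, 'h) hcat \<Rightarrow> ('o, 'f, 'o, 'f) semifunctor"
  where "id_semifunctor D = semifunctor_on D (\<lambda>X. X) (\<lambda>X Y f. f)"

text \<open>The composite of \<open>\<alpha> : D \<rightarrow> D'\<close> followed by \<open>\<beta> : D' \<rightarrow> D''\<close>.\<close>

definition comp_semifunctor :: "('o, 'f, 'h) hcat \<Rightarrow> ('p, 'g, 'q, 'k) semifunctor \<Rightarrow>
    ('o, 'f, 'p, 'g) semifunctor \<Rightarrow> ('o, 'f, 'q, 'k) semifunctor"
  where "comp_semifunctor D \<beta> \<alpha> = semifunctor_on D (\<lambda>X. obj_map \<beta> (obj_map \<alpha> X))
    (\<lambda>X Y f. arr_map \<beta> (obj_map \<alpha> X) (obj_map \<alpha> Y) (arr_map \<alpha> X Y f))"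

definition H_automorphism :: "('o, 'f::complex_vector, 'h) hcat \<Rightarrow> ('o, 'f, 'o, 'f) semifunctor \<Rightarrow> bool"
  where "H_automorphism D \<alpha> \<longleftrightarrow> H_semifunctor D D \<alpha> \<and>
    (\<forall>X\<in>Ob D. arr_map \<alpha> X X (Id D X) = Id D (obj_map \<alpha> X)) \<and>
    bij_betw (obj_map \<alpha>) (Ob D) (Ob D) \<and>
    (\<forall>X\<in>Ob D. \<forall>Y\<in>Ob D.
      bij_betw (arr_map \<alpha> X Y) (Hom D X Y) (Hom D (obj_map \<alpha> X) (obj_map \<alpha> Y)))"

subsection \<open>H-invariant automorphisms\<close>

definition inverse_in :: "('o, 'f, 'h) hcat \<Rightarrow> 'o \<Rightarrow> 'f \<Rightarrow> 'f \<Rightarrow> bool"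
  where "inverse_in D X f g \<longleftrightarrow>
    g \<in> Hom D X X \<and> Comp D X X X f g = Id D X \<and> Comp D X X X g f = Id D X"

definition Aut :: "('o, 'f, 'h) hcat \<Rightarrow> 'o \<Rightarrow> 'f set"
  where "Aut D X = {f \<in> Hom D X X. \<exists>g. inverse_in D X f g}"

definition inv_arr :: "('o, 'f, 'h) hcat \<Rightarrow> 'o \<Rightarrow> 'f \<Rightarrow> 'f"
  where "inv_arr D X f = (THE g. inverse_in D X f g)"

definition invariant_units ::
    "('h::complex_vector) hopf \<Rightarrow> ('o, 'f::complex_vector, 'h) hcat \<Rightarrow> ('o \<Rightarrow> 'f) set"
  where "invariant_units H D = {\<eta>. \<forall>X\<in>Ob D. \<eta> X \<in> Aut D X \<and>
    (\<forall>h. Act D X X h (\<eta> X) = counit H h *\<^sub>C \<eta> X)}"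

definition inner_automorphism ::
    "('o, 'f, 'h) hcat \<Rightarrow> ('o \<Rightarrow> 'f) \<Rightarrow> ('o, 'f, 'o, 'f) semifunctor"
  where "inner_automorphism D \<eta> = semifunctor_on D (\<lambda>X. X)
    (\<lambda>X Y f. Comp D X X Y (Comp D X Y Y (\<eta> Y) f) (inv_arr D X (\<eta> X)))"

section \<open>The cocyclic module\<close>

text \<open>
  The tuple \<open>f\<^sup>0 \<otimes> \<dots> \<otimes> f\<^sup>n\<close> with \<open>f\<^sup>i : X\<^sub>i\<^sub>+\<^sub>1 \<rightarrow> X\<^sub>i\<close> (indices modulo \<open>n + 1\<close>) is
  represented by the list \<open>[(X\<^sub>0, f\<^sup>0), \<dots>, (X\<^sub>n, f\<^sup>n)]\<close>. The function \<open>obj c\<close> reads the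
  objects off cyclically.
\<close>

type_synonym ('o, 'f) chain = "('o \<times> 'f) list"

definition obj :: "('o, 'f) chain \<Rightarrow> nat \<Rightarrow> 'o"
  where "obj c i = fst (c ! (i mod length c))"

definition arr :: "('o, 'f) chain \<Rightarrow> nat \<Rightarrow> 'f"
  where "arr c i = snd (c ! i)"

definition hom_chains :: "('o, 'f, 'h) hcat \<Rightarrow> nat \<Rightarrow> ('o, 'f) chain set"
  where "hom_chains D n = {c. length c = Suc n \<and>
    (\<forall>i\<le>n. obj c i \<in> Ob D \<and> arr c i \<in> Hom D (obj c (Suc i)) (obj c i))}"

text \<open>
  \<open>nerve_tensor D n\<close> is
  \<open>M \<otimes> CN\<^sub>n(D) = \<Oplus> M \<otimes> Hom(X\<^sub>1, X\<^sub>0) \<otimes> \<dots> \<otimes> Hom(X\<^sub>0, X\<^sub>n)\<close>, the sum running over all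
  \<open>(X\<^sub>0, \<dots>, X\<^sub>n)\<close>: the vector space generated by all tuples, modulo linearity in each of the
  \<open>n + 2\<close> arguments with the objects held fixed.
\<close>

definition nerve_relations ::
    "('o, 'f::complex_vector, 'h) hcat \<Rightarrow> nat \<Rightarrow> (('m::complex_vector \<times> ('o, 'f) chain) \<Rightarrow>\<^sub>0 complex) set"
  where "nerve_relations D n =
    {gen (a *\<^sub>C m + m', c) - a *\<^sub>C gen (m, c) - gen (m', c) | a m m' c. c \<in> hom_chains D n} \<union>
    {gen (m, c[i := (obj c i, a *\<^sub>C f + f')]) - a *\<^sub>C gen (m, c[i := (obj c i, f)])
        - gen (m, c[i := (obj c i, f')]) | a m c i f f'.
      c \<in> hom_chains D n \<and> i \<le> n \<and>
      f \<in> Hom D (obj c (Suc i)) (obj c i) \<and> f' \<in> Hom D (obj c (Suc i)) (obj c i)}"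

definition nerve_tensor :: "('o, 'f::complex_vector, 'h) hcat \<Rightarrow> nat \<Rightarrow>
    (complex, (('m::complex_vector \<times> ('o, 'f) chain) \<Rightarrow>\<^sub>0 complex) set) module"
  where "nerve_tensor D n =
    quotient_space (free_on (UNIV \<times> hom_chains D n)) (cvec.span (nerve_relations D n))"

text \<open>The element \<open>m \<otimes> f\<^sup>0 \<otimes> \<dots> \<otimes> f\<^sup>n\<close>.\<close>

definition elementary :: "('o, 'f::complex_vector, 'h) hcat \<Rightarrow> nat \<Rightarrow> 'm::complex_vector \<Rightarrow>
    ('o, 'f) chain \<Rightarrow> (('m \<times> ('o, 'f) chain) \<Rightarrow>\<^sub>0 complex) set"
  where "elementary D n m c = gen (m, c) +o cvec.span (nerve_relations D n)"

text \<open>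
  Linear functionals on \<open>nerve_tensor D n\<close> are normalised to vanish outside the carrier.
  \<open>extend_linearly D n F\<close> is the functional with value \<open>F m c\<close> on \<open>elementary D n m c\<close>; it
  is used for multilinear \<open>F\<close> only, so that the choice of the representative does not matter.
\<close>

type_synonym ('m, 'o, 'f) cochain = "(('m \<times> ('o, 'f) chain) \<Rightarrow>\<^sub>0 complex) set \<Rightarrow> complex"

definition extend_linearly :: "('o, 'f::complex_vector, 'h) hcat \<Rightarrow> nat \<Rightarrow>
    ('m::complex_vector \<Rightarrow> ('o, 'f) chain \<Rightarrow> complex) \<Rightarrow> ('m, 'o, 'f) cochain"
  where "extend_linearly D n F = (\<lambda>A. if A \<in> carrier (nerve_tensor D n)
    then free_lift (\<lambda>(m, c). F m c) (SOME p. p \<in> A) else 0)"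

definition act_chain :: "('o, 'f, 'h) hcat \<Rightarrow> 'h list \<Rightarrow> ('o, 'f) chain \<Rightarrow> ('o, 'f) chain"
  where "act_chain D hs c =
    map (\<lambda>i. (obj c i, Act D (obj c (Suc i)) (obj c i) (hs ! i) (arr c i))) [0..<length c]"

definition cochains :: "('h::complex_algebra) hopf \<Rightarrow> ('h, 'm::complex_vector) hopf_module \<Rightarrow>
    ('o, 'f::complex_vector, 'h) hcat \<Rightarrow> nat \<Rightarrow> ('m, 'o, 'f) cochain set"
  where "cochains H M D n = {\<phi> \<in> vect_hom (nerve_tensor D n) (subsp UNIV).
    (\<forall>A. A \<notin> carrier (nerve_tensor D n) \<longrightarrow> \<phi> A = 0) \<and>
    (\<forall>h m. \<forall>c\<in>hom_chains D n.
      tensor_lift (\<lambda>a b. sweedler H (Suc n) (antipode H b)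
        (\<lambda>hs. \<phi> (elementary D n (ract M m a) (act_chain D hs c)))) (comult H h)
      = counit H h * \<phi> (elementary D n m c))}"

text \<open>
  \<open>merge D i c\<close> composes \<open>f\<^sup>i\<close> with \<open>f\<^sup>i\<^sup>+\<^sup>1\<close>; \<open>merge_last D h c\<close> is
  \<open>(h f\<^sup>n) f\<^sup>0 \<otimes> f\<^sup>1 \<otimes> \<dots> \<otimes> f\<^sup>n\<^sup>-\<^sup>1\<close> and \<open>rotate_chain D h c\<close> is
  \<open>h f\<^sup>n \<otimes> f\<^sup>0 \<otimes> \<dots> \<otimes> f\<^sup>n\<^sup>-\<^sup>1\<close>, where \<open>c\<close> has length \<open>n + 1\<close>.
\<close>

definition merge :: "('o, 'f, 'h) hcat \<Rightarrow> nat \<Rightarrow> ('o, 'f) chain \<Rightarrow> ('o, 'f) chain"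
  where "merge D i c = take i c @
    [(obj c i, Comp D (obj c (i + 2)) (obj c (i + 1)) (obj c i) (arr c i) (arr c (i + 1)))] @
    drop (i + 2) c"

definition merge_last :: "('o, 'f, 'h) hcat \<Rightarrow> 'h \<Rightarrow> ('o, 'f) chain \<Rightarrow> ('o, 'f) chain"
  where "merge_last D h c = (let n = length c - 1 in
    (obj c n, Comp D (obj c 1) (obj c 0) (obj c n) (Act D (obj c 0) (obj c n) h (arr c n)) (arr c 0))
      # butlast (tl c))"

definition rotate_chain :: "('o, 'f, 'h) hcat \<Rightarrow> 'h \<Rightarrow> ('o, 'f) chain \<Rightarrow> ('o, 'f) chain"
  where "rotate_chain D h c = (let n = length c - 1 in
    (obj c n, Act D (obj c 0) (obj c n) h (arr c n)) # butlast c)"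

text \<open>
  \<open>coface H M D n i\<close> and \<open>cyclic_op H M D n\<close> are \<open>\<delta>\<^sub>i : C\<^sup>n \<rightarrow> C\<^sup>n\<^sup>+\<^sup>1\<close>, for \<open>i \<le> n + 1\<close>, and
  \<open>\<tau>\<^sub>n : C\<^sup>n \<rightarrow> C\<^sup>n\<close>. The codegeneracies do not enter the cyclic bicomplex.
\<close>

definition coface :: "('h::complex_algebra) hopf \<Rightarrow> ('h, 'm::complex_vector) hopf_module \<Rightarrow>
    ('o, 'f::complex_vector, 'h) hcat \<Rightarrow> nat \<Rightarrow> nat \<Rightarrow> ('m, 'o, 'f) cochain \<Rightarrow> ('m, 'o, 'f) cochain"
  where "coface H M D n i \<phi> = extend_linearly D (Suc n) (\<lambda>m c.
    if i \<le> n then \<phi> (elementary D n m (merge D i c))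
    else tensor_lift (\<lambda>a x. \<phi> (elementary D n x (merge_last D (inv_into UNIV (antipode H) a) c))) (coact M m))"

definition cyclic_op :: "('h::complex_algebra) hopf \<Rightarrow> ('h, 'm::complex_vector) hopf_module \<Rightarrow>
    ('o, 'f::complex_vector, 'h) hcat \<Rightarrow> nat \<Rightarrow> ('m, 'o, 'f) cochain \<Rightarrow> ('m, 'o, 'f) cochain"
  where "cyclic_op H M D n \<phi> = extend_linearly D n (\<lambda>m c.
    tensor_lift (\<lambda>a x. \<phi> (elementary D n x (rotate_chain D (inv_into UNIV (antipode H) a) c))) (coact M m))"

definition hochschild_b :: "('h::complex_algebra) hopf \<Rightarrow> ('h, 'm::complex_vector) hopf_module \<Rightarrow>
    ('o, 'f::complex_vector, 'h) hcat \<Rightarrow> nat \<Rightarrow> ('m, 'o, 'f) cochain \<Rightarrow> ('m, 'o, 'f) cochain"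
  where "hochschild_b H M D n \<phi> = (\<Sum>i\<le>n + 1. (-1) ^ i *\<^sub>C coface H M D n i \<phi>)"

definition hochschild_b' :: "('h::complex_algebra) hopf \<Rightarrow> ('h, 'm::complex_vector) hopf_module \<Rightarrow>
    ('o, 'f::complex_vector, 'h) hcat \<Rightarrow> nat \<Rightarrow> ('m, 'o, 'f) cochain \<Rightarrow> ('m, 'o, 'f) cochain"
  where "hochschild_b' H M D n \<phi> = (\<Sum>i\<le>n. (-1) ^ i *\<^sub>C coface H M D n i \<phi>)"

definition lambda_op :: "('h::complex_algebra) hopf \<Rightarrow> ('h, 'm::complex_vector) hopf_module \<Rightarrow>
    ('o, 'f::complex_vector, 'h) hcat \<Rightarrow> nat \<Rightarrow> ('m, 'o, 'f) cochain \<Rightarrow> ('m, 'o, 'f) cochain"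
  where "lambda_op H M D n \<phi> = (-1) ^ n *\<^sub>C cyclic_op H M D n \<phi>"

definition norm_op :: "('h::complex_algebra) hopf \<Rightarrow> ('h, 'm::complex_vector) hopf_module \<Rightarrow>
    ('o, 'f::complex_vector, 'h) hcat \<Rightarrow> nat \<Rightarrow> ('m, 'o, 'f) cochain \<Rightarrow> ('m, 'o, 'f) cochain"
  where "norm_op H M D n \<phi> = (\<Sum>j\<le>n. (lambda_op H M D n ^^ j) \<phi>)"

section \<open>Double complexes and total cohomology\<close>

text \<open>
  First-quadrant double complexes of cochain type: column \<open>p\<close>, row \<open>q\<close>, with
  \<open>vert E p q : E\<^sup>p\<^sup>,\<^sup>q \<rightarrow> E\<^sup>p\<^sup>,\<^sup>q\<^sup>+\<^sup>1\<close> and \<open>horiz E p q : E\<^sup>p\<^sup>,\<^sup>q \<rightarrow> E\<^sup>p\<^sup>+\<^sup>1\<^sup>,\<^sup>q\<close> anticommuting.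
\<close>

record 'v bicomplex =
  entry :: "nat \<Rightarrow> nat \<Rightarrow> 'v set"
  vert :: "nat \<Rightarrow> nat \<Rightarrow> 'v \<Rightarrow> 'v"
  horiz :: "nat \<Rightarrow> nat \<Rightarrow> 'v \<Rightarrow> 'v"

definition double_complex :: "('v::complex_vector) bicomplex \<Rightarrow> bool"
  where "double_complex E \<longleftrightarrow> (\<forall>p q.
    cvec.subspace (entry E p q) \<and>
    vert E p q \<in> vect_hom (subsp (entry E p q)) (subsp (entry E p (Suc q))) \<and>
    horiz E p q \<in> vect_hom (subsp (entry E p q)) (subsp (entry E (Suc p) q)) \<and>
    (\<forall>x\<in>entry E p q.
      vert E p (Suc q) (vert E p q x) = 0 \<and>
      horiz E (Suc p) q (horiz E p q x) = 0 \<and>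
      vert E (Suc p) q (horiz E p q x) + horiz E p (Suc q) (vert E p q x) = 0))"

definition double_complex_morphism :: "('v::complex_vector) bicomplex \<Rightarrow>
    ('w::complex_vector) bicomplex \<Rightarrow> (nat \<Rightarrow> nat \<Rightarrow> 'v \<Rightarrow> 'w) \<Rightarrow> bool"
  where "double_complex_morphism E E' F \<longleftrightarrow> double_complex E \<and> double_complex E' \<and> (\<forall>p q.
    F p q \<in> vect_hom (subsp (entry E p q)) (subsp (entry E' p q)) \<and>
    (\<forall>x\<in>entry E p q.
      F p (Suc q) (vert E p q x) = vert E' p q (F p q x) \<and>
      F (Suc p) q (horiz E p q x) = horiz E' p q (F p q x)))"

text \<open>
  An element of total degree \<open>n\<close> is the family of its components \<open>x p \<in> E\<^sup>p\<^sup>,\<^sup>n\<^sup>-\<^sup>p\<close>, \<open>p \<le> n\<close>,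
  extended by \<open>0\<close>.
\<close>

definition tot :: "('v::complex_vector) bicomplex \<Rightarrow> nat \<Rightarrow> (nat \<Rightarrow> 'v) set"
  where "tot E n = {x. (\<forall>p\<le>n. x p \<in> entry E p (n - p)) \<and> (\<forall>p>n. x p = 0)}"

definition tot_diff :: "('v::complex_vector) bicomplex \<Rightarrow> nat \<Rightarrow> (nat \<Rightarrow> 'v) \<Rightarrow> (nat \<Rightarrow> 'v)"
  where "tot_diff E n x = (\<lambda>p.
    (if p \<le> n then vert E p (n - p) (x p) else 0) +
    (if 0 < p \<and> p \<le> Suc n then horiz E (p - 1) (n - (p - 1)) (x (p - 1)) else 0))"

definition tot_cocycles :: "('v::complex_vector) bicomplex \<Rightarrow> nat \<Rightarrow> (nat \<Rightarrow> 'v) set"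
  where "tot_cocycles E n = {x \<in> tot E n. tot_diff E n x = 0}"

definition tot_coboundaries :: "('v::complex_vector) bicomplex \<Rightarrow> nat \<Rightarrow> (nat \<Rightarrow> 'v) set"
  where "tot_coboundaries E n = (if n = 0 then {0} else tot_diff E (n - 1) ` tot E (n - 1))"

definition tot_cohomology :: "('v::complex_vector) bicomplex \<Rightarrow> nat \<Rightarrow> (complex, (nat \<Rightarrow> 'v) set) module"
  where "tot_cohomology E n = quotient_space (tot_cocycles E n) (tot_coboundaries E n)"

text \<open>
  The map induced in cohomology by a morphism \<open>F\<close> into \<open>E'\<close>: it sends the class of \<open>x\<close> to the
  class of \<open>F x\<close>, obtained as the set of all \<open>F x' + y\<close> with \<open>x'\<close> in the class of \<open>x\<close> and \<open>y\<close> a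
  coboundary.
\<close>

definition tot_cohomology_map :: "('w::complex_vector) bicomplex \<Rightarrow>
    (nat \<Rightarrow> nat \<Rightarrow> 'v::complex_vector \<Rightarrow> 'w) \<Rightarrow> nat \<Rightarrow> (nat \<Rightarrow> 'v) set \<Rightarrow> (nat \<Rightarrow> 'w) set"
  where "tot_cohomology_map E' F n A =
    (\<lambda>x p. if p \<le> n then F p (n - p) (x p) else 0) ` A + tot_coboundaries E' n"

definition cyclic_bicomplex :: "('h::complex_algebra) hopf \<Rightarrow> ('h, 'm::complex_vector) hopf_module \<Rightarrow>
    ('o, 'f::complex_vector, 'h) hcat \<Rightarrow> ('m, 'o, 'f) cochain bicomplex"
  where "cyclic_bicomplex H M D =
    \<lparr>entry = (\<lambda>p q. cochains H M D q),
     vert = (\<lambda>p q \<phi>. if even p then hochschild_b H M D q \<phi> else - hochschild_b' H M D q \<phi>),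
     horiz = (\<lambda>p q \<phi>. if even p then \<phi> - lambda_op H M D q \<phi> else norm_op H M D q \<phi>)\<rparr>"

definition HC :: "('h::complex_algebra) hopf \<Rightarrow> ('h, 'm::complex_vector) hopf_module \<Rightarrow>
    ('o, 'f::complex_vector, 'h) hcat \<Rightarrow> nat \<Rightarrow> (complex, (nat \<Rightarrow> ('m, 'o, 'f) cochain) set) module"
  where "HC H M D n = tot_cohomology (cyclic_bicomplex H M D) n"

subsection \<open>Maps induced by semifunctors\<close>

definition map_chain :: "('o, 'f, 'p, 'g) semifunctor \<Rightarrow> ('o, 'f) chain \<Rightarrow> ('p, 'g) chain"
  where "map_chain \<alpha> c =
    map (\<lambda>i. (obj_map \<alpha> (obj c i), arr_map \<alpha> (obj c (Suc i)) (obj c i) (arr c i))) [0..<length c]"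

definition cochain_map :: "('o, 'f::complex_vector, 'h) hcat \<Rightarrow> ('p, 'g::complex_vector, 'h) hcat \<Rightarrow>
    ('o, 'f, 'p, 'g) semifunctor \<Rightarrow> nat \<Rightarrow> ('m::complex_vector, 'p, 'g) cochain \<Rightarrow> ('m, 'o, 'f) cochain"
  where "cochain_map D D' \<alpha> n \<phi> =
    extend_linearly D n (\<lambda>m c. \<phi> (elementary D' n m (map_chain \<alpha> c)))"

definition bicomplex_map :: "('o, 'f::complex_vector, 'h) hcat \<Rightarrow> ('p, 'g::complex_vector, 'h) hcat \<Rightarrow>
    ('o, 'f, 'p, 'g) semifunctor \<Rightarrow>
    nat \<Rightarrow> nat \<Rightarrow> ('m::complex_vector, 'p, 'g) cochain \<Rightarrow> ('m, 'o, 'f) cochain"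
  where "bicomplex_map D D' \<alpha> p q = cochain_map D D' \<alpha> q"

definition HC_map :: "('h::complex_algebra) hopf \<Rightarrow> ('h, 'm::complex_vector) hopf_module \<Rightarrow>
    ('o, 'f::complex_vector, 'h) hcat \<Rightarrow> ('p, 'g::complex_vector, 'h) hcat \<Rightarrow>
    ('o, 'f, 'p, 'g) semifunctor \<Rightarrow> nat \<Rightarrow>
    (nat \<Rightarrow> ('m, 'p, 'g) cochain) set \<Rightarrow> (nat \<Rightarrow> ('m, 'o, 'f) cochain) set"
  where "HC_map H M D D' \<alpha> n =
    tot_cohomology_map (cyclic_bicomplex H M D) (bicomplex_map D D' \<alpha>) n"

end

theory Submission
  imports Defs
begin

text \<open>
  A cochain is a multilinear function \<open>F\<close> on chains with \<open>F(m h \<otimes> c) = F(m \<otimes> h c)\<close>; in this form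
  the cyclic operator is seen to preserve cochains by the anti-Yetter-Drinfeld condition, and to
  have order \<open>n + 1\<close> by stability.

  For the second part, let \<open>I\<close> be the contractible groupoid on two objects. The restriction along
  one of the two inclusions of \<open>D\<close> into \<open>D \<otimes> I\<close> is injective on cohomology, because its kernel
  has exact columns: a simplicial homotopy inserting identities does this for \<open>b\<close>, and a single
  inserted identity for \<open>b'\<close>. Now \<open>\<eta>\<close> defines a functor from \<open>D \<otimes> I\<close> to \<open>D\<close> that is the identity on
  the first copy of \<open>D\<close> and \<open>\<Phi>\<^sub>\<eta>\<close> on the second. It agrees on the first copy with the projection,
  hence has the same effect as the projection in cohomology, and restricting both to the second
  copy gives \<open>\<Phi>\<^sub>\<eta> = 1\<close>.
\<close>

section \<open>Linear maps and Sweedler calculus\<close>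

text \<open>A simplicial homotopy between the maps induced by \<open>\<Phi>\<close> and the identity
  concerns the \<open>b\<close> columns alone and need not commute with the horizontal maps, so it
  does not by itself act on the bicomplex. Exactness can however be tested column by column, and
  this is why a kernel is studied instead of a homotopy. The two functors from the doubled category
  restrict to the identity on the first copy on the nose, not merely up to coboundary; the
  difference of the two pulled-back cocycles therefore lies in the kernel itself. Invariance of
  \<open>\<eta>\<close> enters in making the twisted functor \<open>H\<close>-linear.

  A second obstacle is notational. Tensors are cosets of formal sums, and evaluating a function on
  one means choosing a representative. Identities in tensor powers of \<open>H\<close> are therefore
  tested against multilinear functions: Sweedler calculus becomes the interchange of finite sums
  together with the axioms in tested form. Multilinearity has to be carried through every step,
  since it is what makes the evaluation independent of the representative.\<close>

named_theorems clin

lemma clinear_iff: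
  "clinear f \<longleftrightarrow> (\<forall>x y. f (x + y) = f x + f y) \<and> (\<forall>a x. f (a *\<^sub>C x) = a *\<^sub>C f x)"
  by (simp add: Vector_Spaces.linear_iff cvec.vector_space_axioms)

lemma clinearI:
  assumes "\<And>x y. f (x + y) = f x + f y" "\<And>a x. f (a *\<^sub>C x) = a *\<^sub>C f x"
  shows "clinear f"
  using assms by (simp add: clinear_iff)

lemma clinear_addD: "clinear f \<Longrightarrow> f (x + y) = f x + f y"
  and clinear_scaleD: "clinear f \<Longrightarrow> f (a *\<^sub>C x) = a *\<^sub>C f x"
  by (simp_all add: clinear_iff)

lemma clinear_0: "clinear f \<Longrightarrow> f 0 = 0"
  by (metis add_cancel_right_right clinear_addD)

lemma clinear_sum: "clinear f \<Longrightarrow> f (\<Sum>i\<in>A. g i) = (\<Sum>i\<in>A. f (g i))"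
  by (induction A rule: infinite_finite_induct) (simp_all add: clinear_0 clinear_addD)

lemma clinear_comp: "clinear L \<Longrightarrow> clinear f \<Longrightarrow> clinear (\<lambda>x. L (f x))"
  by (simp add: clinear_iff)

lemma clinear_ident [clin]: "clinear (\<lambda>x. x)"
  by (simp add: clinear_iff)

lemma clinear_scale_right [clin]: "clinear f \<Longrightarrow> clinear (\<lambda>x. a *\<^sub>C f x)"
  by (simp add: clinear_iff scaleC_add_right scaleC_scaleC mult.commute)

lemma clinear_scale_left [clin]: "clinear f \<Longrightarrow> clinear (\<lambda>x. f x *\<^sub>C v)"
  unfolding clinear_iff by (simp add: scaleC_add_left scaleC_complex_def)

lemma clinear_mult_left [clin]:
  "clinear f \<Longrightarrow> clinear (\<lambda>x. f x * (b::'a::complex_algebra))"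
  by (simp add: clinear_iff distrib_right mult_scaleC_left)

lemma clinear_mult_right [clin]:
  "clinear f \<Longrightarrow> clinear (\<lambda>x. (b::'a::complex_algebra) * f x)"
  by (simp add: clinear_iff distrib_left mult_scaleC_right)

lemma tensor_lift_sum:
  "tensor_lift K t =
    (\<Sum>g\<in>Poly_Mapping.keys (rep_tensor t). Poly_Mapping.lookup (rep_tensor t) g *\<^sub>C K (fst g) (snd g))"
  by (simp add: tensor_lift_def free_lift_def case_prod_beta)

text \<open>A functional \<open>tensor_lift _ t\<close> is a finite sum, whence the next four lemmas need no bilinearity.\<close>

lemma linear_tensor_lift: "clinear L \<Longrightarrow> L (tensor_lift K t) = tensor_lift (\<lambda>a b. L (K a b)) t"
  by (simp add: tensor_lift_sum clinear_sum clinear_scaleD)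

lemma tensor_lift_swap:
  "tensor_lift (\<lambda>a b. tensor_lift (\<lambda>c d. K a b c d) s) t =
   tensor_lift (\<lambda>c d. tensor_lift (\<lambda>a b. K a b c d) t) s"
  unfolding tensor_lift_sum cvec.scale_sum_right scaleC_scaleC
  by (subst sum.swap) (simp add: mult.commute)

lemma tensor_lift_add:
  "tensor_lift (\<lambda>a b. K a b + K' a b) t = tensor_lift K t + tensor_lift K' t"
  by (simp add: tensor_lift_sum scaleC_add_right sum.distrib)

lemma clinear_tensor_lift_fun [clin]:
  assumes "\<And>a b. clinear (\<lambda>x. K x a b)"
  shows "clinear (\<lambda>x. tensor_lift (\<lambda>a b. K x a b) t)"
  using assms
  by (simp add: clinear_iff tensor_lift_sum scaleC_add_right sum.distrib cvec.scale_sum_right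
      scaleC_scaleC mult.commute)

lemma tensor_lift_scale:
  "tensor_lift (\<lambda>a b. k *\<^sub>C K a b) t = k *\<^sub>C tensor_lift K t"
  by (rule linear_tensor_lift[symmetric]) (intro clin)

text \<open>Here bilinearity of \<open>K\<close> matters: the representative chosen for a sum of
  tensors is not the sum of the chosen representatives.\<close>

lemma clinear_tensor_lift_arg [clin]:
  assumes "clinear f" "\<And>b. clinear (\<lambda>a. K a b)" "\<And>a. clinear (\<lambda>b. K a b)"
  shows "clinear (\<lambda>x. tensor_lift (\<lambda>a b. K a b) (f x))"
  using clinear_comp[OF clinear_tensor_lift[OF assms(2,3)] assms(1)] .

lemma tensor_lift_tensor_lift:
  assumes "\<And>b. clinear (\<lambda>a. K a b)" "\<And>a. clinear (\<lambda>b. K a b)"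
  shows "tensor_lift (\<lambda>a b. K a b) (tensor_lift G t) =
    tensor_lift (\<lambda>c d. tensor_lift (\<lambda>a b. K a b) (G c d)) t"
  by (rule linear_tensor_lift[OF clinear_tensor_lift[OF assms]])

text \<open>Functions of \<open>n\<close> arguments are functions on lists, constrained on lists of
  length \<open>n\<close> only. Singling out a slot as \<open>xs @ a # ys\<close> keeps fixing the
  first or the last arguments a matter of appending. For \<open>n = 0\<close> the condition is
  empty.\<close>

definition mlin :: "nat \<Rightarrow> ('a::complex_vector list \<Rightarrow> 'b::complex_vector) \<Rightarrow> bool"
  where "mlin n K \<longleftrightarrow>
    (\<forall>xs ys. Suc (length xs + length ys) = n \<longrightarrow> clinear (\<lambda>a. K (xs @ a # ys)))"

lemma mlinD: "mlin n K \<Longrightarrow> Suc (length xs + length ys) = n \<Longrightarrow> clinear (\<lambda>a. K (xs @ a # ys))"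
  by (simp add: mlin_def)

lemma mlin_append_left: "mlin (length xs + n) K \<Longrightarrow> mlin n (\<lambda>ys. K (xs @ ys))"
  unfolding mlin_def
proof (intro allI impI)
  fix us vs :: "'a list"
  assume K: "\<forall>us vs. Suc (length us + length vs) = length xs + n \<longrightarrow> clinear (\<lambda>a. K (us @ a # vs))"
    and "Suc (length us + length vs) = n"
  with K[rule_format, of "xs @ us" vs] show "clinear (\<lambda>a. K (xs @ us @ a # vs))" by simp
qed

lemma mlin_append_right: "mlin (n + length ys) K \<Longrightarrow> mlin n (\<lambda>xs. K (xs @ ys))"
  unfolding mlin_def
proof (intro allI impI)
  fix us vs :: "'a list"
  assume K: "\<forall>us vs. Suc (length us + length vs) = n + length ys \<longrightarrow> clinear (\<lambda>a. K (us @ a # vs))"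
    and "Suc (length us + length vs) = n"
  with K[rule_format, of us "vs @ ys"] show "clinear (\<lambda>a. K ((us @ a # vs) @ ys))" by simp
qed

lemma mlin_Cons: "mlin (Suc n) K \<Longrightarrow> mlin n (\<lambda>hs. K (a # hs))"
  using mlin_append_left[of "[a]" n K] by simp

lemma mlin_head: "mlin (Suc n) K \<Longrightarrow> length hs = n \<Longrightarrow> clinear (\<lambda>a. K (a # hs))"
  using mlinD[of "Suc n" K "[]" hs] by simp

section \<open>Iterated coproducts as finite sums\<close>

lemma sweedler_cong:
  assumes "\<And>hs. length hs = n \<Longrightarrow> K hs = K' hs"
  shows "sweedler H n h K = sweedler H n h K'"
  using assms
proof (induction H n h K arbitrary: K' rule: sweedler.induct)
  case (3 H n h K)
  have "sweedler H (Suc n) b (\<lambda>hs. K (a # hs)) = sweedler H (Suc n) b (\<lambda>hs. K' (a # hs))" for a b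
    by (rule 3) (simp add: 3)
  then show ?case by simp
qed simp_all

lemma clinear_sweedler_fun:
  assumes "\<And>hs. length hs = n \<Longrightarrow> clinear (\<lambda>x. K x hs)"
  shows "clinear (\<lambda>x. sweedler H' n h (K x))"
  using assms
proof (induction n arbitrary: h K)
  case (Suc n)
  then show ?case
    by (cases n) (auto intro!: clin)
qed (auto intro!: clin)

lemma linear_sweedler: "clinear L \<Longrightarrow> L (sweedler H n h K) = sweedler H n h (\<lambda>hs. L (K hs))"
  by (induction H n h K rule: sweedler.induct) (simp_all add: clinear_scaleD linear_tensor_lift)

lemma sweedler_scale: "sweedler H n h (\<lambda>hs. c *\<^sub>C K hs) = c *\<^sub>C sweedler H n h K"
  by (rule linear_sweedler[symmetric]) (intro clin)

text \<open>Both sides are the same finite sum over chosen representatives, so no linearity of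
  \<open>K\<close> is assumed; likewise for \<open>sweedler_swap\<close>.\<close>

lemma sweedler_tensor_lift:
  "sweedler H n h (\<lambda>hs. tensor_lift (\<lambda>a b. K hs a b) t) = tensor_lift (\<lambda>a b. sweedler H n h (\<lambda>hs. K hs a b)) t"
proof (induction H n h "\<lambda>hs. tensor_lift (\<lambda>a b. K hs a b) t" arbitrary: K rule: sweedler.induct)
  case (3 H n h)
  have "sweedler H (Suc n) b (\<lambda>hs. tensor_lift (\<lambda>c d. K (a # hs) c d) t) =
      tensor_lift (\<lambda>c d. sweedler H (Suc n) b (\<lambda>hs. K (a # hs) c d)) t" for a b
    by (rule 3) (rule refl)
  then show ?case by (simp add: tensor_lift_swap[where t = t])
qed (simp_all add: tensor_lift_scale)

lemma sweedler_swap: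
  "sweedler H n h (\<lambda>hs. sweedler H' m g (\<lambda>gs. K hs gs)) =
   sweedler H' m g (\<lambda>gs. sweedler H n h (\<lambda>hs. K hs gs))"
proof (induction H n h "\<lambda>hs. sweedler H' m g (\<lambda>gs. K hs gs)" arbitrary: K rule: sweedler.induct)
  case (3 H n h)
  have "sweedler H (Suc n) b (\<lambda>hs. sweedler H' m g (\<lambda>gs. K (a # hs) gs)) =
      sweedler H' m g (\<lambda>gs. sweedler H (Suc n) b (\<lambda>hs. K (a # hs) gs))" for a b
    by (rule 3) (rule refl)
  then show ?case by (simp add: sweedler_tensor_lift)
qed (simp_all add: sweedler_scale)

section \<open>The antipode and its inverse\<close>

context hopf_algebra
begin

abbreviation "\<Delta> \<equiv> comult H"
abbreviation "\<epsilon> \<equiv> counit H"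
abbreviation "S \<equiv> antipode H"
abbreviation "T \<equiv> inv_into UNIV (antipode H)"

lemmas clinear_comult [clin] = clinear_comp[OF comult_linear]
lemmas clinear_counit [clin] = clinear_comp[OF counit_linear]
lemmas clinear_antipode [clin] = clinear_comp[OF antipode_linear]

text \<open>The axiom is an equation in the triple tensor product; applying the linear map
  \<open>L\<close> induced by the trilinear \<open>K\<close> turns it into an equation of Sweedler
  sums, the only form in which it is used.\<close>

lemma comult_coassoc:
  assumes "\<And>b c. clinear (\<lambda>a. K a b c)" "\<And>a c. clinear (\<lambda>b. K a b c)" "\<And>a b. clinear (\<lambda>c. K a b c)"
  shows "tensor_lift (\<lambda>a c. tensor_lift (\<lambda>a1 a2. K a1 a2 c) (\<Delta> a)) (\<Delta> h) =
    tensor_lift (\<lambda>a c. tensor_lift (\<lambda>c1 c2. K a c1 c2) (\<Delta> c)) (\<Delta> h)"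
proof -
  define L where "L = tensor_lift (\<lambda>a t. tensor_lift (\<lambda>b c. K a b c) t)"
  have lin: "clinear L"
    unfolding L_def by (intro clin clinear_tensor_lift assms)
  have "L (a \<boxtimes> t) = tensor_lift (\<lambda>b c. K a b c) t" for a t
    unfolding L_def by (intro tensor_lift_pure clin assms)
  moreover have "tensor_lift (\<lambda>b c. K a b c) (b \<boxtimes> c) = K a b c" for a b c
    by (intro tensor_lift_pure assms)
  ultimately show ?thesis
    using arg_cong[OF coassoc[of h], of L] by (simp add: linear_tensor_lift[OF lin])
qed

lemma comult_counit_left: "clinear K \<Longrightarrow> tensor_lift (\<lambda>a b. \<epsilon> a *\<^sub>C K b) (\<Delta> h) = K h"
  using arg_cong[OF counit_left[of h], of K] by (simp add: linear_tensor_lift clinear_scaleD)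

lemma comult_counit_right: "clinear K \<Longrightarrow> tensor_lift (\<lambda>a b. \<epsilon> b *\<^sub>C K a) (\<Delta> h) = K h"
  using arg_cong[OF counit_right[of h], of K] by (simp add: linear_tensor_lift clinear_scaleD)

lemma comult_antipode_left:
  "clinear K \<Longrightarrow> tensor_lift (\<lambda>a b. K (S a * b)) (\<Delta> h) = \<epsilon> h *\<^sub>C K 1"
  using arg_cong[OF antipode_left[of h], of K] by (simp add: linear_tensor_lift clinear_scaleD)

lemma comult_antipode_right:
  "clinear K \<Longrightarrow> tensor_lift (\<lambda>a b. K (a * S b)) (\<Delta> h) = \<epsilon> h *\<^sub>C K 1"
  using arg_cong[OF antipode_right[of h], of K] by (simp add: linear_tensor_lift clinear_scaleD)

lemma tensor_lift_comult_mult: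
  assumes "\<And>b. clinear (\<lambda>a. K a b)" "\<And>a. clinear (\<lambda>b. K a b)"
  shows "tensor_lift (\<lambda>a b. K a b) (\<Delta> (g * h)) =
    tensor_lift (\<lambda>a b. tensor_lift (\<lambda>c d. K (a * c) (b * d)) (\<Delta> h)) (\<Delta> g)"
  by (simp add: comult_mult tensor_lift_tensor_lift[OF assms] tensor_lift_pure[OF assms])

lemma tensor_lift_comult_one:
  assumes "\<And>b. clinear (\<lambda>a. K a b)" "\<And>a. clinear (\<lambda>b. K a b)"
  shows "tensor_lift (\<lambda>a b. K a b) (\<Delta> 1) = K 1 1"
  by (simp add: comult_one tensor_lift_pure[OF assms])

text \<open>Both sides equal \<open>S(g\<^sub>1 h\<^sub>1) g\<^sub>2 h\<^sub>2 S(h\<^sub>3) S(g\<^sub>3)\<close>, bracketed in two ways.\<close>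

lemma antipode_mult: "S (g * h) = S h * S g"
proof -
  let ?t = "\<lambda>h K. tensor_lift K (\<Delta> h)"
  have "S (g * h) = ?t g (\<lambda>g1 g'. \<epsilon> g' *\<^sub>C ?t h (\<lambda>h1 h'. \<epsilon> h' *\<^sub>C S (g1 * h1)))"
    by (subst comult_counit_right, intro clin)+ (rule refl)
  also have "\<dots> = ?t g (\<lambda>g1 g'. ?t h (\<lambda>h1 h'. ?t g' (\<lambda>g2 g3. ?t h' (\<lambda>h2 h3.
      S (g1 * h1) * (g2 * (h2 * S h3) * S g3)))))"
  proof -
    have "?t h' (\<lambda>h2 h3. S (g1 * h1) * (g2 * (h2 * S h3) * S g3)) =
        \<epsilon> h' *\<^sub>C (S (g1 * h1) * (g2 * 1 * S g3))" for g1 h1 h' g2 g3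
      by (rule comult_antipode_right[where K = "\<lambda>z. S (g1 * h1) * (g2 * z * S g3)"]) (intro clin)
    moreover have "?t g' (\<lambda>g2 g3. \<epsilon> h' *\<^sub>C (S (g1 * h1) * (g2 * S g3))) =
        \<epsilon> g' *\<^sub>C \<epsilon> h' *\<^sub>C (S (g1 * h1) * 1)" for g1 h1 g' h'
      by (rule comult_antipode_right[where K = "\<lambda>z. \<epsilon> h' *\<^sub>C (S (g1 * h1) * z)"]) (intro clin)
    ultimately show ?thesis by (simp add: tensor_lift_scale[symmetric])
  qed
  also have "\<dots> = ?t g (\<lambda>x g3. ?t x (\<lambda>g1 g2. ?t h (\<lambda>h1 h'. ?t h' (\<lambda>h2 h3.
      S (g1 * h1) * (g2 * (h2 * S h3) * S g3)))))"
    by (subst comult_coassoc, (intro clin)+) (subst tensor_lift_swap, rule refl)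
  also have "\<dots> = ?t g (\<lambda>x g3. ?t x (\<lambda>g1 g2. ?t h (\<lambda>y h3. ?t y (\<lambda>h1 h2.
      S (g1 * h1) * (g2 * (h2 * S h3) * S g3)))))"
    by (subst comult_coassoc, (intro clin)+) (rule refl)
  also have "\<dots> = ?t g (\<lambda>x g3. ?t h (\<lambda>y h3. ?t x (\<lambda>g1 g2. ?t y (\<lambda>h1 h2.
      S (g1 * h1) * (g2 * h2) * (S h3 * S g3)))))"
    by (subst tensor_lift_swap) (simp add: mult.assoc)
  also have "\<dots> = ?t g (\<lambda>x g3. ?t h (\<lambda>y h3. \<epsilon> (x * y) *\<^sub>C (1 * (S h3 * S g3))))"
  proof -
    \<comment> \<open>The coproduct is multiplicative, so the two sums are one sum over the legs of
      \<open>x * y\<close>, to which the antipode axiom applies.\<close>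
    have "?t x (\<lambda>g1 g2. ?t y (\<lambda>h1 h2. S (g1 * h1) * (g2 * h2) * r)) = \<epsilon> (x * y) *\<^sub>C (1 * r)" for x y r
      by (subst tensor_lift_comult_mult[where K = "\<lambda>a b. S a * b * r", symmetric], (intro clin)+)
        (rule comult_antipode_left, intro clin)
    then show ?thesis by simp
  qed
  also have "\<dots> = S h * S g"
  proof -
    have "?t h (\<lambda>y h3. \<epsilon> (x * y) *\<^sub>C (1 * (S h3 * S g3))) = \<epsilon> x *\<^sub>C (S h * S g3)" for x g3
      using comult_counit_left[where K = "\<lambda>h3. \<epsilon> x *\<^sub>C (S h3 * S g3)" and h = h]
      by (simp add: counit_mult clin mult.commute)
    then show ?thesis
      by (simp add: comult_counit_left[where K = "\<lambda>g3. S h * S g3"] clin)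
  qed
  finally show ?thesis .
qed

text \<open>
  Both sides equal \<open>\<Delta>(S(h\<^sub>1)) \<Delta>(h\<^sub>2) (S(h\<^sub>4) \<otimes> S(h\<^sub>3))\<close>, bracketed in two ways. The product
  of \<open>H \<otimes> H\<close> is written out with \<open>tensor_lift\<close>, and applied to a test functional \<open>K\<close>.
\<close>

lemma tensor_lift_comult_antipode:
  assumes "\<And>b. clinear (\<lambda>a. K a b)" "\<And>a. clinear (\<lambda>b. K a b)"
  shows "tensor_lift (\<lambda>a b. K a b) (\<Delta> (S h)) = tensor_lift (\<lambda>a b. K (S b) (S a)) (\<Delta> h)"
proof -
  note K = assms[THEN clinear_comp]
  let ?t = "\<lambda>h K. tensor_lift K (\<Delta> h)"
  have "?t (S h) K = ?t h (\<lambda>h1 r. \<epsilon> r *\<^sub>C ?t (S h1) K)"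
    by (rule comult_counit_right[symmetric]) (intro clin assms)
  also have "\<dots> = ?t h (\<lambda>h1 r. ?t r (\<lambda>p h4. ?t p (\<lambda>h2 h3.
      ?t (S h1) (\<lambda>a b. ?t h2 (\<lambda>c d. K (a * c * S h4) (b * d * S h3))))))"
  proof -
    \<comment> \<open>Cancellation goes from the inside out: the second leg of \<open>h2\<close>
      meets \<open>S h3\<close>, after which \<open>p\<close> meets \<open>S h4\<close>.\<close>
    have "?t r (\<lambda>p h4. ?t p (\<lambda>h2 h3. ?t h2 (\<lambda>c d. K (a * c * S h4) (b * d * S h3)))) = \<epsilon> r *\<^sub>C K a b"
      for r a b
    proof -
      have "?t p (\<lambda>h2 h3. ?t h2 (\<lambda>c d. K (a * c * S h4) (b * d * S h3))) = K (a * p * S h4) b" for p h4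
      proof -
        have "?t p (\<lambda>h2 h3. ?t h2 (\<lambda>c d. K (a * c * S h4) (b * d * S h3))) =
            ?t p (\<lambda>c q. ?t q (\<lambda>d h3. K (a * c * S h4) (b * (d * S h3))))"
          by (subst comult_coassoc, (intro clin K)+) (simp add: mult.assoc)
        also have "\<dots> = ?t p (\<lambda>c q. \<epsilon> q *\<^sub>C K (a * c * S h4) (b * 1))"
          by (subst comult_antipode_right[where K = "\<lambda>z. K _ (b * z)"], (intro clin K)+) (rule refl)
        also have "\<dots> = K (a * p * S h4) b"
          by (subst comult_counit_right, (intro clin K)+) simp
        finally show ?thesis .
      qed
      then show ?thesis
        using comult_antipode_right[where K = "\<lambda>z. K (a * z) b" and h = r]
        by (simp add: mult.assoc K clin)
    qed
    then show ?thesis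
      by (simp add: tensor_lift_swap[where s = "\<Delta> (S _)"] tensor_lift_scale)
  qed
  also have "\<dots> = ?t h (\<lambda>h1 r. ?t r (\<lambda>h2 q. ?t q (\<lambda>h3 h4.
      ?t (S h1) (\<lambda>a b. ?t h2 (\<lambda>c d. K (a * c * S h4) (b * d * S h3))))))"
    by (subst comult_coassoc, (intro clin K)+) (rule refl)
  also have "\<dots> = ?t h (\<lambda>p q. ?t p (\<lambda>h1 h2. ?t q (\<lambda>h3 h4.
      ?t (S h1) (\<lambda>a b. ?t h2 (\<lambda>c d. K (a * c * S h4) (b * d * S h3))))))"
    by (subst comult_coassoc, (intro clin K)+) (rule refl)
  also have "\<dots> = ?t h (\<lambda>p q. \<epsilon> p *\<^sub>C ?t q (\<lambda>h3 h4. K (S h4) (S h3)))"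
  proof -
    \<comment> \<open>Multiplicativity joins the coproducts of \<open>S h1\<close> and
      \<open>h2\<close> to that of \<open>S h1 * h2\<close>, which sums to a multiple of the
      coproduct of 1.\<close>
    have "?t p (\<lambda>h1 h2. ?t (S h1) (\<lambda>a b. ?t h2 (\<lambda>c d. K (a * c * x) (b * d * y)))) =
        \<epsilon> p *\<^sub>C K x y" for p x y
    proof -
      have "?t p (\<lambda>h1 h2. ?t (S h1) (\<lambda>a b. ?t h2 (\<lambda>c d. K (a * c * x) (b * d * y)))) =
          ?t p (\<lambda>h1 h2. ?t (S h1 * h2) (\<lambda>a b. K (a * x) (b * y)))"
        by (subst tensor_lift_comult_mult, (intro clin K)+) (rule refl)
      also have "\<dots> = \<epsilon> p *\<^sub>C ?t 1 (\<lambda>a b. K (a * x) (b * y))"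
        by (rule comult_antipode_left) (intro clin K)
      also have "?t 1 (\<lambda>a b. K (a * x) (b * y)) = K x y"
        by (subst tensor_lift_comult_one, (intro clin K)+) simp
      finally show ?thesis .
    qed
    then have "?t p (\<lambda>h1 h2. ?t q (\<lambda>h3 h4. ?t (S h1) (\<lambda>a b. ?t h2 (\<lambda>c d.
        K (a * c * S h4) (b * d * S h3))))) = \<epsilon> p *\<^sub>C ?t q (\<lambda>h3 h4. K (S h4) (S h3))" for p q
      by (subst tensor_lift_swap) (simp add: tensor_lift_scale)
    then show ?thesis by simp
  qed
  also have "\<dots> = ?t h (\<lambda>a b. K (S b) (S a))"
    by (rule comult_counit_left) (intro clin K)
  finally show ?thesis .
qed

lemma antipode_one: "S 1 = 1"
  using antipode_left[of 1] by (simp add: tensor_lift_comult_one clin counit_one scaleC_one)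

lemma T_antipode [simp]: "T (S h) = h" and antipode_T [simp]: "S (T h) = h"
  using antipode_bij by (simp_all add: bij_def surj_f_inv_f)

lemma clinear_T: "clinear T"
proof (rule clinearI)
  show "T (x + y) = T x + T y" for x y
    using arg_cong[OF clinear_addD[OF antipode_linear, of "T x" "T y"], of T] by simp
  show "T (a *\<^sub>C x) = a *\<^sub>C T x" for a x
    using arg_cong[OF clinear_scaleD[OF antipode_linear, of a "T x"], of T] by simp
qed

lemmas clinear_T_comp [clin] = clinear_comp[OF clinear_T]

lemma T_mult: "T (g * h) = T h * T g"
  using arg_cong[OF antipode_mult[of "T h" "T g"], of T] by simp

lemma tensor_lift_comult_T:
  assumes "\<And>b. clinear (\<lambda>a. K a b)" "\<And>a. clinear (\<lambda>b. K a b)"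
  shows "tensor_lift (\<lambda>a b. K a b) (\<Delta> (T h)) = tensor_lift (\<lambda>a b. K (T b) (T a)) (\<Delta> h)"
  using tensor_lift_comult_antipode[where K = "\<lambda>a b. K (T b) (T a)" and h = "T h"]
  by (simp add: clin assms[THEN clinear_comp])

text \<open>The inverse antipode reverses products, so it carries h1 S(h2) = \<epsilon>(h) to h2
  T(h1) = \<epsilon>(h). This is the cancellation behind both \<open>stable_T\<close> and the
  invariance of the rotated cochain.\<close>

lemma comult_T_right:
  assumes "clinear K"
  shows "tensor_lift (\<lambda>a b. K (b * T a)) (\<Delta> h) = \<epsilon> h *\<^sub>C K 1"
  using comult_antipode_right[where K = "\<lambda>z. K (T z)" and h = h]
    arg_cong[OF antipode_one, of T]
  by (simp add: T_mult assms[THEN clinear_comp] clinear_T)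

lemma counit_T: "\<epsilon> (T h) = \<epsilon> h"
proof -
  have "\<epsilon> (S x) = \<epsilon> x" for x
  proof -
    have "\<epsilon> (S x) = tensor_lift (\<lambda>a b. \<epsilon> b *\<^sub>C \<epsilon> (S a)) (\<Delta> x)"
      by (rule comult_counit_right[symmetric]) (intro clin)
    also have "\<dots> = tensor_lift (\<lambda>a b. \<epsilon> (S a * b)) (\<Delta> x)"
      by (simp add: counit_mult scaleC_complex_def mult.commute)
    also have "\<dots> = \<epsilon> x"
      by (subst comult_antipode_left, intro clin) (simp add: counit_one scaleC_complex_def)
    finally show ?thesis .
  qed
  from this[of "T h"] show ?thesis by simp
qed

subsection \<open>Iterated coproducts\<close>

text \<open>The definition treats a single leg separately. By the counit axiom the recursion
  nevertheless starts at \<open>n = 0\<close>, which removes this case from all later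
  inductions.\<close>

lemma sweedler_Suc:
  assumes "mlin (Suc n) K"
  shows "sweedler H (Suc n) h K = tensor_lift (\<lambda>a b. sweedler H n b (\<lambda>hs. K (a # hs))) (\<Delta> h)"
proof (cases n)
  case 0
  have "clinear (\<lambda>a. K [a])"
    using mlin_head[OF assms, of "[]"] 0 by simp
  then show ?thesis using 0 by (simp add: comult_counit_right)
qed simp

lemma clinear_sweedler_arg:
  assumes "mlin n K"
  shows "clinear (\<lambda>h. sweedler H n h K)"
  using assms
proof (induction n arbitrary: K)
  case 0
  show ?case by (simp add: clin)
next
  case (Suc n)
  show ?case
    unfolding sweedler_Suc[OF Suc.prems]
    by (intro clin Suc.IH mlin_Cons[OF Suc.prems] clinear_sweedler_fun mlin_head[OF Suc.prems])
qed

text \<open>Generalised coassociativity: the first coproduct may be taken at any place of the list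
  of legs. Each induction step carries one leg across the cut by
  \<open>comult_coassoc\<close>.\<close>

lemma sweedler_append:
  assumes "mlin (p + q) K"
  shows "sweedler H (p + q) h K =
    tensor_lift (\<lambda>a b. sweedler H p a (\<lambda>hs. sweedler H q b (\<lambda>ks. K (hs @ ks)))) (\<Delta> h)"
  using assms
proof (induction p arbitrary: K h)
  case 0
  then show ?case by (simp add: comult_counit_left clinear_sweedler_arg)
next
  case (Suc p)
  have K: "mlin (Suc (p + q)) K" using Suc.prems by simp
  have lin: "clinear (\<lambda>a. sweedler H p c (\<lambda>hs. sweedler H q b (\<lambda>ks. K (a # hs @ ks))))"
    "clinear (\<lambda>c. sweedler H p c (\<lambda>hs. sweedler H q b (\<lambda>ks. K (a # hs @ ks))))"
    "clinear (\<lambda>b. sweedler H p c (\<lambda>hs. sweedler H q b (\<lambda>ks. K (a # hs @ ks))))" for a b c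
  proof -
    show "clinear (\<lambda>a. sweedler H p c (\<lambda>hs. sweedler H q b (\<lambda>ks. K (a # hs @ ks))))"
      by (intro clinear_sweedler_fun) (rule mlin_head[OF K], simp)
    have "mlin p (\<lambda>hs. sweedler H q b (\<lambda>ks. K (a # hs @ ks)))"
      unfolding mlin_def
    proof (intro allI impI clinear_sweedler_fun)
      fix xs ys ks :: "'h list" assume "Suc (length xs + length ys) = p" "length ks = q"
      then show "clinear (\<lambda>d. K (a # (xs @ d # ys) @ ks))"
        using mlinD[OF K, of "a # xs" "ys @ ks"] by simp
    qed
    then show "clinear (\<lambda>c. sweedler H p c (\<lambda>hs. sweedler H q b (\<lambda>ks. K (a # hs @ ks))))"
      by (rule clinear_sweedler_arg)
    show "clinear (\<lambda>b. sweedler H p c (\<lambda>hs. sweedler H q b (\<lambda>ks. K (a # hs @ ks))))"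
    proof (intro clinear_sweedler_fun clinear_sweedler_arg)
      fix hs :: "'h list" assume "length hs = p"
      then show "mlin q (\<lambda>ks. K (a # hs @ ks))"
        using mlin_append_left[of "a # hs" q K] K by simp
    qed
  qed
  have "sweedler H (Suc p + q) h K = tensor_lift (\<lambda>a r. sweedler H (p + q) r (\<lambda>hs. K (a # hs))) (\<Delta> h)"
    by (simp add: sweedler_Suc K)
  also have "\<dots> = tensor_lift (\<lambda>a r. tensor_lift (\<lambda>c b. sweedler H p c (\<lambda>hs. sweedler H q b (\<lambda>ks.
      K (a # hs @ ks)))) (\<Delta> r)) (\<Delta> h)"
    by (simp add: Suc.IH mlin_Cons[OF K])
  also have "\<dots> = tensor_lift (\<lambda>d b. tensor_lift (\<lambda>a c. sweedler H p c (\<lambda>hs. sweedler H q b (\<lambda>ks.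
      K (a # hs @ ks)))) (\<Delta> d)) (\<Delta> h)"
    by (rule comult_coassoc[symmetric]) (rule lin)+
  also have "\<dots> = tensor_lift (\<lambda>d b. sweedler H (Suc p) d (\<lambda>hs. sweedler H q b (\<lambda>ks. K (hs @ ks)))) (\<Delta> h)"
  proof -
    have "mlin (Suc p) (\<lambda>hs. sweedler H q b (\<lambda>ks. K (hs @ ks)))" for b
      unfolding mlin_def
    proof (intro allI impI clinear_sweedler_fun)
      fix xs ys ks :: "'h list" assume "Suc (length xs + length ys) = Suc p" "length ks = q"
      then show "clinear (\<lambda>d. K ((xs @ d # ys) @ ks))"
        using mlinD[OF K, of "xs" "ys @ ks"] by simp
    qed
    then show ?thesis by (simp add: sweedler_Suc)
  qed
  finally show ?case .
qed

lemma sweedler_snoc: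
  assumes "mlin (Suc n) K"
  shows "sweedler H (Suc n) h K = tensor_lift (\<lambda>a b. sweedler H n a (\<lambda>hs. K (hs @ [b]))) (\<Delta> h)"
  using sweedler_append[of n 1 K h] assms by simp

text \<open>One leg, at position \<open>p\<close>, is replaced by its own two legs. In this form
  coassociativity meets chains: \<open>K\<close> sees two neighbouring arrows where
  \<open>K'\<close> sees one, be it their composite or the arrow before an identity is inserted next
  to it.\<close>

lemma sweedler_insert:
  assumes K: "mlin (p + Suc (Suc q)) K"
    and K': "\<And>xs d ys. length xs = p \<Longrightarrow> length ys = q \<Longrightarrow>
      K' (xs @ d # ys) = tensor_lift (\<lambda>a b. K (xs @ a # b # ys)) (\<Delta> d)"
    and mlin: "mlin (p + Suc q) K'"
  shows "sweedler H (p + Suc (Suc q)) h K = sweedler H (p + Suc q) h K'"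
proof -
  have "sweedler H (Suc (Suc q)) v (\<lambda>ks. K (hs @ ks)) = sweedler H (Suc q) v (\<lambda>ks. K' (hs @ ks))"
    if hs: "length hs = p" for hs v
  proof -
    have lin: "clinear (\<lambda>a. K (hs @ a # b # ks))" "clinear (\<lambda>b. K (hs @ a # b # ks))"
      if "length ks = q" for a b ks
      using mlinD[OF K, of hs "b # ks"] mlinD[OF K, of "hs @ [a]" ks] hs that by simp_all
    have K1: "mlin (Suc (Suc q)) (\<lambda>ks. K (hs @ ks))"
      using K hs by (intro mlin_append_left) simp
    have K2: "mlin (Suc q) (\<lambda>ks. K' (hs @ ks))"
      using mlin hs by (intro mlin_append_left) simp
    have "sweedler H (Suc (Suc q)) v (\<lambda>ks. K (hs @ ks)) =
        tensor_lift (\<lambda>a w. tensor_lift (\<lambda>b z. sweedler H q z (\<lambda>ks. K (hs @ a # b # ks))) (\<Delta> w)) (\<Delta> v)"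
      by (simp only: sweedler_Suc[OF K1] sweedler_Suc[OF mlin_Cons[OF K1]])
    also have "\<dots> = tensor_lift (\<lambda>d z. tensor_lift (\<lambda>a b. sweedler H q z (\<lambda>ks. K (hs @ a # b # ks))) (\<Delta> d)) (\<Delta> v)"
      by (intro comult_coassoc[symmetric] clinear_sweedler_fun clinear_sweedler_arg lin
          mlin_Cons[OF mlin_Cons[OF K1]])
    also have "\<dots> = tensor_lift (\<lambda>d z. sweedler H q z (\<lambda>ks. tensor_lift (\<lambda>a b. K (hs @ a # b # ks)) (\<Delta> d))) (\<Delta> v)"
      by (simp add: sweedler_tensor_lift)
    also have "\<dots> = tensor_lift (\<lambda>d z. sweedler H q z (\<lambda>ks. K' (hs @ d # ks))) (\<Delta> v)"
      using K'[OF hs] by (simp cong: sweedler_cong)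
    also have "\<dots> = sweedler H (Suc q) v (\<lambda>ks. K' (hs @ ks))"
      by (simp only: sweedler_Suc[OF K2])
    finally show ?thesis .
  qed
  then show ?thesis
    by (simp only: sweedler_append[OF K] sweedler_append[OF mlin] cong: sweedler_cong)
qed

lemma sweedler_one:
  assumes "mlin n K"
  shows "sweedler H n 1 K = K (replicate n 1)"
  using assms
proof (induction n arbitrary: K)
  case 0
  show ?case by (simp add: counit_one scaleC_one)
next
  case (Suc n)
  show ?case
    by (simp add: sweedler_Suc Suc mlin_Cons[OF Suc.prems] tensor_lift_comult_one
        clinear_sweedler_arg clinear_sweedler_fun mlin_head[OF Suc.prems])
qed

lemma mlin_map2_mult_left:
  assumes "mlin n K" "length hs = n"
  shows "mlin n (\<lambda>gs. K (map2 (*) gs (hs :: 'h list)))"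
  unfolding mlin_def
proof (intro allI impI)
  fix xs ys :: "'h list" assume "Suc (length xs + length ys) = n"
  with assms have eq: "hs = take (length xs) hs @ hs ! length xs # drop (Suc (length xs)) hs"
    by (intro id_take_nth_drop) simp
  define us h vs where "us = take (length xs) hs" and "h = hs ! length xs" and "vs = drop (Suc (length xs)) hs"
  have len: "length us = length xs" "length vs = length ys"
    using \<open>Suc _ = n\<close> assms by (auto simp: us_def vs_def)
  have "hs = us @ h # vs" using eq by (simp add: us_def h_def vs_def)
  then show "clinear (\<lambda>a. K (map2 (*) (xs @ a # ys) hs))"
    using clinear_comp[OF mlinD[OF assms(1), of "map2 (*) xs us" "map2 (*) ys vs"], of "\<lambda>a. a * h"]
      len \<open>Suc _ = n\<close>
    by (simp add: clin)
qed

text \<open>The iterated coproduct is an algebra map. This makes the diagonal action on chains an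
  action once it is tested against multilinear functions.\<close>

lemma sweedler_mult:
  assumes "mlin n K"
  shows "sweedler H n (g * h) K = sweedler H n g (\<lambda>gs. sweedler H n h (\<lambda>hs. K (map2 (*) gs hs)))"
  using assms
proof (induction n arbitrary: K g h)
  case 0
  show ?case by (simp add: counit_mult)
next
  case (Suc n)
  let ?t = "\<lambda>h K. tensor_lift K (\<Delta> h)"
  have left: "mlin (Suc n) (\<lambda>hs. K (map2 (*) gs hs))" if "length gs = Suc n" for gs
    unfolding mlin_def
  proof (intro allI impI)
    fix xs ys :: "'h list" assume len: "Suc (length xs + length ys) = Suc n"
    then have eq: "gs = take (length xs) gs @ gs ! length xs # drop (Suc (length xs)) gs"
      using that by (intro id_take_nth_drop) simp
    define us h vs where "us = take (length xs) gs" and "h = gs ! length xs" and "vs = drop (Suc (length xs)) gs"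
    have "length us = length xs" "length vs = length ys"
      using len that by (auto simp: us_def vs_def)
    moreover have "gs = us @ h # vs" using eq by (simp add: us_def h_def vs_def)
    ultimately show "clinear (\<lambda>a. K (map2 (*) gs (xs @ a # ys)))"
      using clinear_comp[OF mlinD[OF Suc.prems, of "map2 (*) us xs" "map2 (*) vs ys"], of "\<lambda>a. h * a"] len
      by (simp add: clin)
  qed
  have right: "mlin (Suc n) (\<lambda>gs. sweedler H (Suc n) h (\<lambda>hs. K (map2 (*) gs hs)))"
    unfolding mlin_def
    by (intro allI impI clinear_sweedler_fun mlinD[OF mlin_map2_mult_left[OF Suc.prems]])
  have "sweedler H (Suc n) (g * h) K = ?t (g * h) (\<lambda>x y. sweedler H n y (\<lambda>hs. K (x # hs)))"
    by (rule sweedler_Suc[OF Suc.prems])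
  also have "\<dots> = ?t g (\<lambda>a b. ?t h (\<lambda>c d. sweedler H n (b * d) (\<lambda>hs. K (a * c # hs))))"
    by (intro tensor_lift_comult_mult clinear_sweedler_arg clinear_sweedler_fun mlin_head[OF Suc.prems]
        mlin_Cons[OF Suc.prems])
  also have "\<dots> = ?t g (\<lambda>a b. ?t h (\<lambda>c d. sweedler H n b (\<lambda>gs. sweedler H n d (\<lambda>hs. K (a * c # map2 (*) gs hs)))))"
    by (simp add: Suc.IH mlin_Cons[OF Suc.prems])
  also have "\<dots> = ?t g (\<lambda>a b. sweedler H n b (\<lambda>gs. ?t h (\<lambda>c d. sweedler H n d (\<lambda>hs. K (a * c # map2 (*) gs hs)))))"
    by (simp add: sweedler_tensor_lift)
  also have "\<dots> = ?t g (\<lambda>a b. sweedler H n b (\<lambda>gs. sweedler H (Suc n) h (\<lambda>hs. K (map2 (*) (a # gs) hs))))"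
    by (simp add: sweedler_Suc left cong: sweedler_cong)
  also have "\<dots> = sweedler H (Suc n) g (\<lambda>gs. sweedler H (Suc n) h (\<lambda>hs. K (map2 (*) gs hs)))"
    by (simp only: sweedler_Suc[OF right])
  finally show ?case .
qed

end

section \<open>Chains and their multilinear functions\<close>

text \<open>A normal form: every operation on chains is brought into it, so that identities between
  operations reduce to a comparison of objects and arrows at each index.\<close>

definition mk_chain :: "nat \<Rightarrow> (nat \<Rightarrow> 'o) \<Rightarrow> (nat \<Rightarrow> 'f) \<Rightarrow> ('o, 'f) chain"
  where "mk_chain n ob ar = map (\<lambda>i. (ob i, ar i)) [0..<Suc n]"

definition set_arr :: "('o, 'f) chain \<Rightarrow> nat \<Rightarrow> 'f \<Rightarrow> ('o, 'f) chain"
  where "set_arr c i f = c[i := (obj c i, f)]"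

lemma length_mk_chain [simp]: "length (mk_chain n ob ar) = Suc n"
  by (simp add: mk_chain_def)

lemma nth_mk_chain: "k \<le> n \<Longrightarrow> mk_chain n ob ar ! k = (ob k, ar k)"
  unfolding mk_chain_def by (subst nth_map) (simp_all del: upt_Suc)

lemma arr_mk_chain [simp]: "k \<le> n \<Longrightarrow> arr (mk_chain n ob ar) k = ar k"
  by (simp add: arr_def nth_mk_chain)

lemma obj_mk_chain [simp]: "k \<le> n \<Longrightarrow> obj (mk_chain n ob ar) k = ob k"
  by (simp add: obj_def nth_mk_chain)

lemma obj_mk_chain_wrap [simp]: "obj (mk_chain n ob ar) (Suc n) = ob 0"
  by (simp add: obj_def nth_mk_chain)

lemma obj_wrap: "length c = Suc n \<Longrightarrow> obj c (Suc n) = obj c 0"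
  by (simp add: obj_def)

lemma nth_chain: "i < length c \<Longrightarrow> c ! i = (obj c i, arr c i)"
  by (simp add: obj_def arr_def)

lemma chain_eqI:
  assumes "length c = Suc n" "length c' = Suc n"
    and "\<And>k. k \<le> n \<Longrightarrow> obj c k = obj c' k" "\<And>k. k \<le> n \<Longrightarrow> arr c k = arr c' k"
  shows "c = c'"
  using assms by (intro nth_equalityI) (simp_all add: nth_chain)

lemma chain_eq_mk_chain:
  assumes "length c = Suc n" "\<And>k. k \<le> n \<Longrightarrow> obj c k = ob k" "\<And>k. k \<le> n \<Longrightarrow> arr c k = ar k"
  shows "c = mk_chain n ob ar"
  using assms by (intro chain_eqI[of _ n]) simp_all

lemma length_set_arr [simp]: "length (set_arr c i f) = length c"
  by (simp add: set_arr_def)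

lemma obj_set_arr [simp]: "i < length c \<Longrightarrow> obj (set_arr c i f) k = obj c k"
  by (auto simp: obj_def set_arr_def nth_list_update)

lemma arr_set_arr [simp]: "i < length c \<Longrightarrow> arr (set_arr c i f) k = (if k = i then f else arr c k)"
  by (auto simp: arr_def set_arr_def nth_list_update)

lemma set_arr_arr: "i < length c \<Longrightarrow> set_arr c i (arr c i) = c"
  by (simp add: set_arr_def nth_chain[symmetric])

lemma hom_chainsD:
  assumes "c \<in> hom_chains D n"
  shows hom_chains_length: "length c = Suc n"
    and hom_chains_obj: "k \<le> Suc n \<Longrightarrow> obj c k \<in> Ob D"
    and hom_chains_arr: "k \<le> n \<Longrightarrow> arr c k \<in> Hom D (obj c (Suc k)) (obj c k)"
    and hom_chains_wrap: "obj c (Suc n) = obj c 0"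
proof -
  show len: "length c = Suc n" and "k \<le> n \<Longrightarrow> arr c k \<in> Hom D (obj c (Suc k)) (obj c k)"
    using assms by (simp_all add: hom_chains_def)
  show wrap: "obj c (Suc n) = obj c 0"
    by (rule obj_wrap[OF len])
  show "obj c k \<in> Ob D" if "k \<le> Suc n"
    using assms that wrap by (cases "k = Suc n") (simp_all add: hom_chains_def)
qed

lemma hom_chainsI:
  assumes "length c = Suc n" "\<And>k. k \<le> n \<Longrightarrow> obj c k \<in> Ob D"
    "\<And>k. k \<le> n \<Longrightarrow> arr c k \<in> Hom D (obj c (Suc k)) (obj c k)"
  shows "c \<in> hom_chains D n"
  using assms by (simp add: hom_chains_def)

text \<open>Knowing the objects up to index \<open>n + 1\<close> lets the hom space of the last
  arrow, whose source is object 0, be handled like all others.\<close>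

lemma obj_mk_chain_cyclic: "ob (Suc n) = ob 0 \<Longrightarrow> k \<le> Suc n \<Longrightarrow> obj (mk_chain n ob ar) k = ob k"
  by (cases "k = Suc n") simp_all

lemma mk_chain_hom:
  assumes "ob (Suc n) = ob 0" "\<And>k. k \<le> n \<Longrightarrow> ob k \<in> Ob D"
    "\<And>k. k \<le> n \<Longrightarrow> ar k \<in> Hom D (ob (Suc k)) (ob k)"
  shows "mk_chain n ob ar \<in> hom_chains D n"
  by (rule hom_chainsI) (use assms in \<open>simp_all add: obj_mk_chain_cyclic\<close>)

lemma set_arr_hom:
  assumes "c \<in> hom_chains D n" "i \<le> n" "f \<in> Hom D (obj c (Suc i)) (obj c i)"
  shows "set_arr c i f \<in> hom_chains D n"
  using assms by (auto simp: hom_chains_def)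

lemma merge_eq:
  assumes "length c = Suc (Suc n)" "i \<le> n"
  shows "merge D i c = mk_chain n (\<lambda>k. obj c (if k \<le> i then k else Suc k))
    (\<lambda>k. if k < i then arr c k
      else if k = i then Comp D (obj c (i + 2)) (obj c (i + 1)) (obj c i) (arr c i) (arr c (i + 1))
      else arr c (Suc k))"
proof (rule nth_equalityI)
  show "length (merge D i c) = length (mk_chain n (\<lambda>k. obj c (if k \<le> i then k else Suc k))
    (\<lambda>k. if k < i then arr c k
      else if k = i then Comp D (obj c (i + 2)) (obj c (i + 1)) (obj c i) (arr c i) (arr c (i + 1))
      else arr c (Suc k)))"
    using assms by (simp add: merge_def)
next
  fix k assume "k < length (merge D i c)"
  then have "k \<le> n" using assms by (simp add: merge_def)
  moreover consider "k < i" | "k = i" | x where "k = Suc (i + x)"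
    by (metis less_imp_Suc_add linorder_neqE_nat)
  ultimately show "merge D i c ! k = mk_chain n (\<lambda>k. obj c (if k \<le> i then k else Suc k))
    (\<lambda>k. if k < i then arr c k
      else if k = i then Comp D (obj c (i + 2)) (obj c (i + 1)) (obj c i) (arr c i) (arr c (i + 1))
      else arr c (Suc k)) ! k"
    using assms by cases (simp_all add: merge_def nth_append nth_mk_chain obj_def arr_def)
qed

lemma merge_last_eq:
  assumes "length c = Suc (Suc n)"
  shows "merge_last D h c = mk_chain n (\<lambda>k. if k = 0 then obj c (Suc n) else obj c k)
    (\<lambda>k. if k = 0 then Comp D (obj c 1) (obj c 0) (obj c (Suc n))
        (Act D (obj c 0) (obj c (Suc n)) h (arr c (Suc n))) (arr c 0)
      else arr c k)"
  using assms
  by (intro nth_equalityI)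
    (auto simp: merge_last_def Let_def nth_mk_chain nth_Cons nth_butlast nth_tl obj_def arr_def split: nat.split)

lemma rotate_chain_eq:
  assumes "length c = Suc n"
  shows "rotate_chain D h c = mk_chain n (\<lambda>k. if k = 0 then obj c n else obj c (k - 1))
    (\<lambda>k. if k = 0 then Act D (obj c 0) (obj c n) h (arr c n) else arr c (k - 1))"
  using assms
  by (intro nth_equalityI)
    (auto simp: rotate_chain_def Let_def nth_mk_chain nth_Cons nth_butlast obj_def arr_def split: nat.split)

lemma act_chain_eq:
  assumes "length c = Suc n"
  shows "act_chain D hs c = mk_chain n (obj c) (\<lambda>k. Act D (obj c (Suc k)) (obj c k) (hs ! k) (arr c k))"
  using assms by (simp add: act_chain_def mk_chain_def)

lemma map_chain_eq:
  assumes "length c = Suc n"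
  shows "map_chain \<alpha> c = mk_chain n (\<lambda>k. obj_map \<alpha> (obj c k))
    (\<lambda>k. arr_map \<alpha> (obj c (Suc k)) (obj c k) (arr c k))"
  using assms by (simp add: map_chain_def mk_chain_def)

section \<open>Multilinearity along chains\<close>

lemma vect_hom_subsp:
  "f \<in> vect_hom (subsp V) (subsp W) \<longleftrightarrow>
    (\<forall>x\<in>V. f x \<in> W) \<and> (\<forall>x\<in>V. \<forall>y\<in>V. f (x + y) = f x + f y) \<and> (\<forall>a. \<forall>x\<in>V. f (a *\<^sub>C x) = a *\<^sub>C f x)"
  by (auto simp: vect_hom_def subsp_def)

lemma vect_hom_ident: "(\<lambda>f. f) \<in> vect_hom (subsp V) (subsp V)"
  by (simp add: vect_hom_subsp)

definition chain_linear ::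
    "('o, 'f::complex_vector, 'h) hcat \<Rightarrow> nat \<Rightarrow> (('o, 'f) chain \<Rightarrow> complex) \<Rightarrow> bool"
  where "chain_linear D n K \<longleftrightarrow> (\<forall>c\<in>hom_chains D n. \<forall>i\<le>n. \<forall>a.
    \<forall>f\<in>Hom D (obj c (Suc i)) (obj c i). \<forall>f'\<in>Hom D (obj c (Suc i)) (obj c i).
    K (set_arr c i (a *\<^sub>C f + f')) = a *\<^sub>C K (set_arr c i f) + K (set_arr c i f'))"

definition multilinear :: "('o, 'f::complex_vector, 'h) hcat \<Rightarrow> nat \<Rightarrow>
    ('m::complex_vector \<Rightarrow> ('o, 'f) chain \<Rightarrow> complex) \<Rightarrow> bool"
  where "multilinear D n F \<longleftrightarrow> (\<forall>c\<in>hom_chains D n. clinear (\<lambda>m. F m c)) \<and> (\<forall>m. chain_linear D n (F m))"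

text \<open>Operations on chains through which multilinear functions can be pulled back.\<close>

definition multi :: "('o, 'f::complex_vector, 'h) hcat \<Rightarrow> nat \<Rightarrow> ('p, 'g::complex_vector, 'h) hcat \<Rightarrow> nat \<Rightarrow>
    (('o, 'f) chain \<Rightarrow> ('p, 'g) chain) \<Rightarrow> bool"
  where "multi D n D' n' u \<longleftrightarrow> (\<forall>c\<in>hom_chains D n. u c \<in> hom_chains D' n' \<and>
    (\<forall>i\<le>n. \<exists>j\<le>n'. \<exists>l\<in>vect_hom (subsp (Hom D (obj c (Suc i)) (obj c i)))
        (subsp (Hom D' (obj (u c) (Suc j)) (obj (u c) j))).
      \<forall>f\<in>Hom D (obj c (Suc i)) (obj c i). u (set_arr c i f) = set_arr (u c) j (l f)))"

lemma multi_hom: "multi D n D' n' u \<Longrightarrow> c \<in> hom_chains D n \<Longrightarrow> u c \<in> hom_chains D' n'"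
  by (simp add: multi_def)

lemma chain_linearD:
  "chain_linear D n K \<Longrightarrow> c \<in> hom_chains D n \<Longrightarrow> i \<le> n \<Longrightarrow> f \<in> Hom D (obj c (Suc i)) (obj c i) \<Longrightarrow>
    f' \<in> Hom D (obj c (Suc i)) (obj c i) \<Longrightarrow>
    K (set_arr c i (a *\<^sub>C f + f')) = a *\<^sub>C K (set_arr c i f) + K (set_arr c i f')"
  by (simp add: chain_linear_def)

lemma chain_linear_comp:
  assumes K: "chain_linear D' n' K" and u: "multi D n D' n' u"
    and sub: "\<And>X Y. X \<in> Ob D \<Longrightarrow> Y \<in> Ob D \<Longrightarrow> cvec.subspace (Hom D X Y)"
  shows "chain_linear D n (\<lambda>c. K (u c))"
  unfolding chain_linear_def
proof (intro ballI allI impI)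
  fix c i a f f'
  assume c: "c \<in> hom_chains D n" and i: "i \<le> n"
    and f: "f \<in> Hom D (obj c (Suc i)) (obj c i)" and f': "f' \<in> Hom D (obj c (Suc i)) (obj c i)"
  from u c i obtain j l where uc: "u c \<in> hom_chains D' n'" and j: "j \<le> n'"
    and l: "l \<in> vect_hom (subsp (Hom D (obj c (Suc i)) (obj c i))) (subsp (Hom D' (obj (u c) (Suc j)) (obj (u c) j)))"
    and eq: "\<And>f. f \<in> Hom D (obj c (Suc i)) (obj c i) \<Longrightarrow> u (set_arr c i f) = set_arr (u c) j (l f)"
    unfolding multi_def by blast
  have "cvec.subspace (Hom D (obj c (Suc i)) (obj c i))"
    using c i by (intro sub) (simp_all add: hom_chains_obj)
  then have af: "a *\<^sub>C f \<in> Hom D (obj c (Suc i)) (obj c i)"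
    and "a *\<^sub>C f + f' \<in> Hom D (obj c (Suc i)) (obj c i)"
    using f f' by (auto simp: cvec.subspace_def)
  then have "K (u (set_arr c i (a *\<^sub>C f + f'))) = K (set_arr (u c) j (a *\<^sub>C l f + l f'))"
    using l f f' by (simp add: eq vect_hom_subsp)
  also have "\<dots> = a *\<^sub>C K (set_arr (u c) j (l f)) + K (set_arr (u c) j (l f'))"
    using l f f' by (intro chain_linearD[OF K uc j]) (simp_all add: vect_hom_subsp)
  finally show "K (u (set_arr c i (a *\<^sub>C f + f'))) = a *\<^sub>C K (u (set_arr c i f)) + K (u (set_arr c i f'))"
    by (simp add: eq f f')
qed

lemma clinear_set_arr:
  assumes K: "chain_linear D n K" and c: "c \<in> hom_chains D n" and i: "i \<le> n"
    and g: "g \<in> vect_hom (subsp UNIV) (subsp (Hom D (obj c (Suc i)) (obj c i)))"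
    and sub: "cvec.subspace (Hom D (obj c (Suc i)) (obj c i))"
  shows "clinear (\<lambda>a. K (set_arr c i (g a)))"
proof (rule clinearI)
  have mem: "g x \<in> Hom D (obj c (Suc i)) (obj c i)" for x
    using g by (simp add: vect_hom_subsp)
  \<comment> \<open>Linearity is stated as one law for \<open>a *\<^sub>C f + f'\<close>; scaling
    follows from it with \<open>f' = 0\<close>, once the value at 0 is known to vanish.\<close>
  have 0: "K (set_arr c i 0) = 0"
    using chain_linearD[OF K c i, of 0 0 1] cvec.subspace_0[OF sub] by (simp add: scaleC_one)
  show "K (set_arr c i (g (x + y))) = K (set_arr c i (g x)) + K (set_arr c i (g y))" for x y
    using chain_linearD[OF K c i mem mem, of 1 x y] g by (simp add: scaleC_one vect_hom_subsp)
  show "K (set_arr c i (g (a *\<^sub>C x))) = a *\<^sub>C K (set_arr c i (g x))" for a x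
    using chain_linearD[OF K c i mem, of 0 a x] cvec.subspace_0[OF sub] g 0 by (simp add: vect_hom_subsp)
qed

section \<open>Cosets and functionals on the nerve\<close>

lemma coset_eq_iff: "cvec.subspace W \<Longrightarrow> x +o W = y +o W \<longleftrightarrow> x - y \<in> W"
proof
  assume W: "cvec.subspace W" and "x +o W = y +o W"
  moreover have "x \<in> x +o W"
    using cvec.subspace_0[OF W] by (auto simp: elt_set_plus_def)
  ultimately show "x - y \<in> W" by (auto simp: elt_set_plus_def)
next
  assume W: "cvec.subspace W" and d: "x - y \<in> W"
  have "x' +o W \<subseteq> y' +o W" if "x' - y' \<in> W" for x' y'
  proof
    fix z assume "z \<in> x' +o W"
    then obtain w where "w \<in> W" "z = x' + w" by (auto simp: elt_set_plus_def)
    then have "(x' - y') + w \<in> W" and z: "z = y' + ((x' - y') + w)"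
      using cvec.subspace_add[OF W that] by simp_all
    then show "z \<in> y' +o W" unfolding elt_set_plus_def by blast
  qed
  from this[OF d] this[of y x] show "x +o W = y +o W"
    using cvec.subspace_neg[OF W d] by auto
qed

lemma coset_mem: "cvec.subspace W \<Longrightarrow> x \<in> x +o W"
  using cvec.subspace_0[of W] by (auto simp: elt_set_plus_def)

lemma coset_add:
  assumes "cvec.subspace W"
  shows "(x +o W) + (y +o W) = (x + y) +o W"
proof -
  have "W + W = W"
    using cvec.subspace_add[OF assms] cvec.subspace_0[OF assms]
    by (force simp: set_plus_def)
  then show ?thesis
    by (simp add: set_plus_rearrange)
qed

lemma coset_scale:
  assumes "cvec.subspace W"
  shows "scaleC a ` (x +o W) + W = (a *\<^sub>C x) +o W"
proof (intro equalityI subsetI)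
  fix z assume "z \<in> scaleC a ` (x +o W) + W"
  then obtain w w' where w: "w \<in> W" "w' \<in> W" and "z = a *\<^sub>C (x + w) + w'"
    by (auto simp: set_plus_def elt_set_plus_def)
  then have z: "z = a *\<^sub>C x + (a *\<^sub>C w + w')"
    by (simp add: scaleC_add_right add.assoc)
  have "a *\<^sub>C w + w' \<in> W"
    using w assms by (intro cvec.subspace_add cvec.subspace_scale)
  then show "z \<in> (a *\<^sub>C x) +o W"
    unfolding z elt_set_plus_def by blast
next
  fix z assume "z \<in> (a *\<^sub>C x) +o W"
  then show "z \<in> scaleC a ` (x +o W) + W"
    using coset_mem[OF assms, of x] by (auto simp: set_plus_def elt_set_plus_def)
qed

lemma subspace_free_on: "cvec.subspace (free_on G)"
  unfolding cvec.subspace_def free_on_def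
  by (auto simp: in_keys_iff simp del: lookup_not_eq_zero_eq_in_keys)
    (metis add_0 in_keys_iff lookup_add subsetD)

lemma gen_free_on [simp]: "gen g \<in> free_on G \<longleftrightarrow> g \<in> G"
  by (simp add: free_on_def gen_def)

abbreviation nerve_rel_span ::
    "('o, 'f::complex_vector, 'h) hcat \<Rightarrow> nat \<Rightarrow> (('m::complex_vector \<times> ('o, 'f) chain) \<Rightarrow>\<^sub>0 complex) set"
  where "nerve_rel_span D n \<equiv> cvec.span (nerve_relations D n)"

lemma carrier_nerve_tensor:
  "carrier (nerve_tensor D n) = (\<lambda>p. p +o nerve_rel_span D n) ` free_on (UNIV \<times> hom_chains D n)"
  by (simp add: nerve_tensor_def quotient_space_def)

lemma nerve_tensor_ops:
  "(p +o nerve_rel_span D n) \<oplus>\<^bsub>nerve_tensor D n\<^esub> (q +o nerve_rel_span D n) = (p + q) +o nerve_rel_span D n"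
  "a \<odot>\<^bsub>nerve_tensor D n\<^esub> (p +o nerve_rel_span D n) = (a *\<^sub>C p) +o nerve_rel_span D n"
  by (simp_all add: nerve_tensor_def quotient_space_def coset_add coset_scale)

lemma poly_mapping_eq_sum_gen:
  "p = (\<Sum>g\<in>Poly_Mapping.keys p. Poly_Mapping.lookup p g *\<^sub>C gen g)"
  by (rule poly_mapping_eqI)
    (simp add: lookup_sum gen_def lookup_single scaleC_complex_def when_def in_keys_iff
      if_distrib[of "(*) _"] cong: if_cong)

lemma nerve_functional_eq:
  fixes \<phi> :: "('m::complex_vector, 'o, 'f::complex_vector) cochain"
  assumes phi: "\<phi> \<in> vect_hom (nerve_tensor D n) (subsp UNIV)" and p: "p \<in> free_on (UNIV \<times> hom_chains D n)"
  shows "\<phi> (p +o nerve_rel_span D n) = free_lift (\<lambda>(m, c). \<phi> (elementary D n m c)) p"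
proof -
  let ?V = "free_on (UNIV \<times> hom_chains D n) :: (('m \<times> ('o, 'f) chain) \<Rightarrow>\<^sub>0 complex) set"
    and ?f = "\<lambda>p. \<phi> (p +o nerve_rel_span D n)"
  have add: "?f (x + y) = ?f x + ?f y" if "x \<in> ?V" "y \<in> ?V" for x y
    using phi that by (auto simp: vect_hom_def carrier_nerve_tensor nerve_tensor_ops subsp_def)
  have scale: "?f (a *\<^sub>C x) = a *\<^sub>C ?f x" if "x \<in> ?V" for a x
    using phi that by (auto simp: vect_hom_def carrier_nerve_tensor nerve_tensor_ops subsp_def)
  \<comment> \<open>Membership of the partial sums is proved along, since \<open>\<phi>\<close> is
    additive only on cosets of elements of the free space.\<close>
  have "?f (\<Sum>g\<in>A. a g *\<^sub>C gen g) = (\<Sum>g\<in>A. a g *\<^sub>C ?f (gen g)) \<and> (\<Sum>g\<in>A. a g *\<^sub>C gen g) \<in> ?V"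
    if "A \<subseteq> UNIV \<times> hom_chains D n" "finite A" for A a
    using that(2,1)
  proof (induction A rule: finite_induct)
    case empty
    have "0 \<in> ?V"
      by (rule cvec.subspace_0[OF subspace_free_on])
    then show ?case using scale[of 0 0] by simp
  next
    case (insert g A)
    then have "a g *\<^sub>C gen g \<in> ?V"
      by (intro cvec.subspace_scale[OF subspace_free_on]) simp
    with insert show ?case
      by (simp add: add scale cvec.subspace_add[OF subspace_free_on])
  qed
  from this[of "Poly_Mapping.keys p" "Poly_Mapping.lookup p"] p
  show ?thesis
    by (subst poly_mapping_eq_sum_gen)
      (simp add: free_on_def free_lift_def elementary_def case_prod_beta)
qed

lemma nerve_functional_eqI:
  fixes \<phi> \<psi> :: "('m::complex_vector, 'o, 'f::complex_vector) cochain"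
  assumes "\<phi> \<in> vect_hom (nerve_tensor D n) (subsp UNIV)" "\<psi> \<in> vect_hom (nerve_tensor D n) (subsp UNIV)"
    and "\<And>A. A \<notin> carrier (nerve_tensor D n) \<Longrightarrow> \<phi> A = 0" "\<And>A. A \<notin> carrier (nerve_tensor D n) \<Longrightarrow> \<psi> A = 0"
    and eq: "\<And>m c. c \<in> hom_chains D n \<Longrightarrow> \<phi> (elementary D n m c) = \<psi> (elementary D n m c)"
  shows "\<phi> = \<psi>"
proof
  fix A
  show "\<phi> A = \<psi> A"
  proof (cases "A \<in> carrier (nerve_tensor D n)")
    case True
    then obtain p where A: "A = p +o nerve_rel_span D n" and p: "p \<in> free_on (UNIV \<times> hom_chains D n)"
      by (auto simp: carrier_nerve_tensor)
    have "free_lift (\<lambda>(m, c). \<phi> (elementary D n m c)) p = free_lift (\<lambda>(m, c). \<psi> (elementary D n m c)) p"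
      unfolding free_lift_def using p eq by (intro sum.cong) (auto simp: free_on_def)
    then show ?thesis by (simp add: A nerve_functional_eq[OF _ p] assms(1,2))
  qed (simp add: assms)
qed

lemma elementary_multilinear:
  assumes "c \<in> hom_chains D n"
  shows "elementary D n (a *\<^sub>C m + m') c = (a *\<^sub>C gen (m, c) + gen (m', c)) +o nerve_rel_span D n"
    and "i \<le> n \<Longrightarrow> f \<in> Hom D (obj c (Suc i)) (obj c i) \<Longrightarrow> f' \<in> Hom D (obj c (Suc i)) (obj c i) \<Longrightarrow>
      elementary D n m (set_arr c i (a *\<^sub>C f + f')) =
        (a *\<^sub>C gen (m, set_arr c i f) + gen (m, set_arr c i f')) +o nerve_rel_span D n"
proof -
  have *: "gen (a *\<^sub>C m + m', c) - (a *\<^sub>C gen (m, c) + gen (m', c)) \<in> nerve_rel_span D n"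
    unfolding diff_diff_eq[symmetric]
    using assms by (intro cvec.span_base) (unfold nerve_relations_def, blast)
  then show "elementary D n (a *\<^sub>C m + m') c = (a *\<^sub>C gen (m, c) + gen (m', c)) +o nerve_rel_span D n"
    by (simp add: elementary_def coset_eq_iff)
  assume "i \<le> n" "f \<in> Hom D (obj c (Suc i)) (obj c i)" "f' \<in> Hom D (obj c (Suc i)) (obj c i)"
  then have "gen (m, set_arr c i (a *\<^sub>C f + f')) - (a *\<^sub>C gen (m, set_arr c i f) + gen (m, set_arr c i f'))
      \<in> nerve_rel_span D n"
    unfolding diff_diff_eq[symmetric] set_arr_def
    using assms by (intro cvec.span_base) (unfold nerve_relations_def, blast)
  then show "elementary D n m (set_arr c i (a *\<^sub>C f + f')) =
        (a *\<^sub>C gen (m, set_arr c i f) + gen (m, set_arr c i f')) +o nerve_rel_span D n"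
    by (simp add: elementary_def coset_eq_iff)
qed

lemma nerve_functional_multilinear:
  fixes \<phi> :: "('m::complex_vector, 'o, 'f::complex_vector) cochain"
  assumes phi: "\<phi> \<in> vect_hom (nerve_tensor D n) (subsp UNIV)"
  shows "multilinear D n (\<lambda>m c. \<phi> (elementary D n m c))"
proof -
  have lin: "\<phi> ((a *\<^sub>C gen (m, c) + gen (m', c')) +o nerve_rel_span D n) =
      a *\<^sub>C \<phi> (elementary D n m c) + \<phi> (elementary D n m' c')"
    if "c \<in> hom_chains D n" "c' \<in> hom_chains D n" for a m m' c c'
  proof -
    have "a *\<^sub>C gen (m, c) + gen (m', c') \<in> free_on (UNIV \<times> hom_chains D n)"
      using that by (intro cvec.subspace_add[OF subspace_free_on] cvec.subspace_scale[OF subspace_free_on]) simp_all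
    then show ?thesis
      by (simp add: nerve_functional_eq[OF phi] free_lift_add free_lift_scale)
  qed
  show ?thesis
    unfolding multilinear_def chain_linear_def
  proof (intro conjI allI ballI impI)
    fix c assume c: "c \<in> hom_chains D n"
    have eq: "\<phi> (elementary D n (a *\<^sub>C m + m') c) = a *\<^sub>C \<phi> (elementary D n m c) + \<phi> (elementary D n m' c)" for a m m'
      by (simp only: elementary_multilinear[OF c] lin[OF c c])
    have 0: "\<phi> (elementary D n 0 c) = 0"
      using eq[of 1 0 0] by (simp add: scaleC_one)
    show "clinear (\<lambda>m. \<phi> (elementary D n m c))"
      using eq[of 1] eq[of _ _ 0] 0 by (intro clinearI) (simp_all add: scaleC_one)
    fix m i a f f'
    assume "i \<le> n" "f \<in> Hom D (obj c (Suc i)) (obj c i)" "f' \<in> Hom D (obj c (Suc i)) (obj c i)"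
    then show "\<phi> (elementary D n m (set_arr c i (a *\<^sub>C f + f'))) =
        a *\<^sub>C \<phi> (elementary D n m (set_arr c i f)) + \<phi> (elementary D n m (set_arr c i f'))"
      by (simp only: elementary_multilinear(2)[OF c] lin set_arr_hom[OF c])
  qed
qed

lemma free_lift_nerve_cong:
  assumes F: "multilinear D n F" and pq: "p - q \<in> nerve_rel_span D n"
  shows "free_lift (\<lambda>(m, c). F m c) p = free_lift (\<lambda>(m, c). F m c) q"
proof -
  let ?L = "free_lift (\<lambda>(m, c). F m c)"
  interpret L: Vector_Spaces.linear scaleC scaleC ?L by (rule clinear_free_lift)
  have "?L r = 0" if r: "r \<in> nerve_relations D n" for r
  proof -
    from r consider (1) a m m' c where "r = gen (a *\<^sub>C m + m', c) - a *\<^sub>C gen (m, c) - gen (m', c)" "c \<in> hom_chains D n"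
      | (2) a m c i f f' where "r = gen (m, set_arr c i (a *\<^sub>C f + f')) - a *\<^sub>C gen (m, set_arr c i f) - gen (m, set_arr c i f')"
        "c \<in> hom_chains D n" "i \<le> n" "f \<in> Hom D (obj c (Suc i)) (obj c i)" "f' \<in> Hom D (obj c (Suc i)) (obj c i)"
      unfolding nerve_relations_def set_arr_def by blast
    then show ?thesis
    proof cases
      case 1
      then have "clinear (\<lambda>m. F m c)" using F by (simp add: multilinear_def)
      from clinear_addD[OF this, of "a *\<^sub>C m" m'] clinear_scaleD[OF this, of a m]
      show ?thesis using 1 by (simp add: L.diff L.scale)
    next
      case 2
      then have "F m (set_arr c i (a *\<^sub>C f + f')) = a *\<^sub>C F m (set_arr c i f) + F m (set_arr c i f')"
        using F by (intro chain_linearD[where K = "F m"]) (simp_all add: multilinear_def)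
      then show ?thesis using 2 by (simp add: L.diff L.scale)
    qed
  qed
  then have "?L (p - q) = 0"
    using pq by (rule L.eq_0_on_span)
  then show ?thesis by (simp add: L.diff)
qed

text \<open>This removes the choice in \<open>extend_linearly\<close>: two representatives differ by
  relations, and these are killed by a multilinear function.\<close>

lemma extend_linearly_coset:
  assumes F: "multilinear D n F" and p: "p \<in> free_on (UNIV \<times> hom_chains D n)"
  shows "extend_linearly D n F (p +o nerve_rel_span D n) = free_lift (\<lambda>(m, c). F m c) p"
proof -
  have "(SOME q. q \<in> p +o nerve_rel_span D n) \<in> p +o nerve_rel_span D n"
    by (rule someI) (rule coset_mem, simp)
  then have "(SOME q. q \<in> p +o nerve_rel_span D n) - p \<in> nerve_rel_span D n"
    by (auto simp: elt_set_plus_def)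
  from free_lift_nerve_cong[OF F this] p show ?thesis
    by (auto simp: extend_linearly_def carrier_nerve_tensor)
qed

lemma extend_linearly_elementary:
  "multilinear D n F \<Longrightarrow> c \<in> hom_chains D n \<Longrightarrow> extend_linearly D n F (elementary D n m c) = F m c"
  by (simp add: elementary_def extend_linearly_coset)

lemma extend_linearly_outside: "A \<notin> carrier (nerve_tensor D n) \<Longrightarrow> extend_linearly D n F A = 0"
  by (simp add: extend_linearly_def)

lemma extend_linearly_vect_hom:
  fixes F :: "'m::complex_vector \<Rightarrow> ('o, 'f::complex_vector) chain \<Rightarrow> complex"
  assumes "multilinear D n F"
  shows "extend_linearly D n F \<in> vect_hom (nerve_tensor D n) (subsp UNIV)"
proof -
  have "x + y \<in> free_on (UNIV \<times> hom_chains D n)" "a *\<^sub>C x \<in> free_on (UNIV \<times> hom_chains D n)"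
    if "x \<in> free_on (UNIV \<times> hom_chains D n)" "y \<in> free_on (UNIV \<times> hom_chains D n)"
    for a and x y :: "('m \<times> ('o, 'f) chain) \<Rightarrow>\<^sub>0 complex"
    using that cvec.subspace_add[OF subspace_free_on] cvec.subspace_scale[OF subspace_free_on] by auto
  then show ?thesis
    by (auto simp: vect_hom_def carrier_nerve_tensor nerve_tensor_ops extend_linearly_coset[OF assms]
        free_lift_add free_lift_scale) (simp_all add: subsp_def)
qed

text \<open>Linearity of \<open>L\<close> is available on \<open>V\<close> only; the finite sum
  behind \<open>tensor_lift\<close> never leaves \<open>V\<close>.\<close>

lemma vect_hom_tensor_lift:
  assumes V: "cvec.subspace V" and G: "\<And>a b. G a b \<in> V" and L: "L \<in> vect_hom (subsp V) (subsp W)"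
  shows "L (tensor_lift G t) = tensor_lift (\<lambda>a b. L (G a b)) t"
proof -
  have 0: "L 0 = 0"
    using L cvec.subspace_0[OF V] unfolding vect_hom_subsp by (metis add_cancel_right_right)
  have "L (\<Sum>g\<in>A. a g *\<^sub>C G (fst g) (snd g)) = (\<Sum>g\<in>A. a g *\<^sub>C L (G (fst g) (snd g)))" if "finite A" for A a
    using that
  proof (induction A rule: finite_induct)
    case (insert g A)
    have "a g *\<^sub>C G (fst g) (snd g) \<in> V" "(\<Sum>g\<in>A. a g *\<^sub>C G (fst g) (snd g)) \<in> V"
      by (intro cvec.subspace_sum[OF V] cvec.subspace_scale[OF V] G)+
    with insert L G show ?case by (simp add: vect_hom_subsp)
  qed (simp add: 0)
  then show ?thesis by (simp add: tensor_lift_sum)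
qed

lemma chain_linear_vect_hom:
  assumes K: "chain_linear D n K" and c: "c \<in> hom_chains D n" and i: "i \<le> n"
    and sub: "cvec.subspace (Hom D (obj c (Suc i)) (obj c i))"
  shows "(\<lambda>f. K (set_arr c i f)) \<in> vect_hom (subsp (Hom D (obj c (Suc i)) (obj c i))) (subsp UNIV)"
proof -
  have 0: "K (set_arr c i 0) = 0"
    using chain_linearD[OF K c i, of 0 0 1] cvec.subspace_0[OF sub] by (simp add: scaleC_one)
  show ?thesis
    unfolding vect_hom_subsp
  proof (intro conjI ballI allI)
    fix f g assume "f \<in> Hom D (obj c (Suc i)) (obj c i)" "g \<in> Hom D (obj c (Suc i)) (obj c i)"
    then show "K (set_arr c i (f + g)) = K (set_arr c i f) + K (set_arr c i g)"
      using chain_linearD[OF K c i, of f g 1] by (simp add: scaleC_one)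
  next
    fix a f assume "f \<in> Hom D (obj c (Suc i)) (obj c i)"
    then show "K (set_arr c i (a *\<^sub>C f)) = a *\<^sub>C K (set_arr c i f)"
      using chain_linearD[OF K c i, of f 0 a] cvec.subspace_0[OF sub] 0 by simp
  qed simp
qed

lemma chain_linear_tensor_lift:
  assumes "\<And>a b. chain_linear D n (K a b)"
  shows "chain_linear D n (\<lambda>c. tensor_lift (\<lambda>a b. K a b c) t)"
  unfolding chain_linear_def
  by (auto simp: chain_linearD[OF assms] tensor_lift_add tensor_lift_scale)

lemma sweedler_add:
  "sweedler H n h (\<lambda>hs. K hs + K' hs) = sweedler H n h K + sweedler H n h K'"
proof (induction H n h K arbitrary: K' rule: sweedler.induct)
  case (3 H n h K)
  then have "sweedler H (Suc n) b (\<lambda>hs. K (a # hs) + K' (a # hs)) =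
    sweedler H (Suc n) b (\<lambda>hs. K (a # hs)) + sweedler H (Suc n) b (\<lambda>hs. K' (a # hs))" for a b
    by simp
  then show ?case by (simp add: tensor_lift_add)
qed (simp_all add: scaleC_add_right)

section \<open>Operations on chains\<close>

text \<open>\<open>u (h c) = h (u c)\<close> for the diagonal action, tested against multilinear functions.\<close>

definition equivariant :: "('h::complex_algebra) hopf \<Rightarrow> ('o, 'f::complex_vector, 'h) hcat \<Rightarrow> nat \<Rightarrow>
    ('p, 'g::complex_vector, 'h) hcat \<Rightarrow> nat \<Rightarrow> (('o, 'f) chain \<Rightarrow> ('p, 'g) chain) \<Rightarrow> bool"
  where "equivariant H D n D' n' u \<longleftrightarrow> (\<forall>K h. \<forall>c\<in>hom_chains D n. chain_linear D' n' K \<longrightarrow>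
    sweedler H (Suc n') h (\<lambda>hs. K (act_chain D' hs (u c))) =
    sweedler H (Suc n) h (\<lambda>hs. K (u (act_chain D hs c))))"

context left_H_category
begin

lemma Act_closed: "X \<in> Ob D \<Longrightarrow> Y \<in> Ob D \<Longrightarrow> f \<in> Hom D X Y \<Longrightarrow> Act D X Y h f \<in> Hom D X Y"
  using Act_linear_right by (simp add: vect_hom_subsp)

lemma Comp_closed: "X \<in> Ob D \<Longrightarrow> Y \<in> Ob D \<Longrightarrow> Z \<in> Ob D \<Longrightarrow> f \<in> Hom D X Y \<Longrightarrow> g \<in> Hom D Y Z \<Longrightarrow>
    Comp D X Y Z g f \<in> Hom D X Z"
  using Comp_linear_right by (simp add: vect_hom_subsp)

lemma chain_subspace:
  "c \<in> hom_chains D n \<Longrightarrow> i \<le> n \<Longrightarrow> cvec.subspace (Hom D (obj c (Suc i)) (obj c i))"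
  by (intro Hom_subspace hom_chains_obj[of c D n]) simp_all

lemma multilinear_comp:
  "multilinear D' n' F \<Longrightarrow> multi D n D' n' u \<Longrightarrow> multilinear D n (\<lambda>m c. F m (u c))"
  by (auto simp: multilinear_def multi_hom intro: chain_linear_comp Hom_subspace)

lemma act_chain_hom:
  assumes "c \<in> hom_chains D n"
  shows "act_chain D hs c \<in> hom_chains D n"
  unfolding act_chain_eq[OF hom_chains_length[OF assms]]
  by (intro mk_chain_hom Act_closed) (simp_all add: hom_chainsD[OF assms])

lemma act_chain_simps:
  assumes "c \<in> hom_chains D n"
  shows "length (act_chain D hs c) = Suc n"
    and "k \<le> Suc n \<Longrightarrow> obj (act_chain D hs c) k = obj c k"
    and "k \<le> n \<Longrightarrow> arr (act_chain D hs c) k = Act D (obj c (Suc k)) (obj c k) (hs ! k) (arr c k)"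
  by (simp_all add: act_chain_eq[OF hom_chains_length[OF assms]] obj_mk_chain_cyclic
      hom_chains_wrap[OF assms])

lemma act_chain_append:
  assumes c: "c \<in> hom_chains D n" and len: "length xs \<le> n"
  shows "act_chain D (xs @ a # ys) c = set_arr (act_chain D (xs @ b # ys) c) (length xs)
    (Act D (obj c (Suc (length xs))) (obj c (length xs)) a (arr c (length xs)))"
  by (rule chain_eqI[of _ n]) (use len in \<open>auto simp: act_chain_simps[OF c] nth_append nth_Cons'\<close>)

lemma mlin_act_chain:
  assumes K: "chain_linear D n K" and c: "c \<in> hom_chains D n"
  shows "mlin (Suc n) (\<lambda>hs. K (act_chain D hs c))"
  unfolding mlin_def
proof (intro allI impI)
  fix xs ys :: "'h list"
  assume "Suc (length xs + length ys) = Suc n"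
  then have len: "length xs \<le> n" by simp
  \<comment> \<open>The entry 0 is a placeholder: the slot is overwritten by \<open>set_arr\<close>,
    which exhibits the dependence on \<open>a\<close> as one varying arrow in a fixed chain.\<close>
  let ?i = "length xs" and ?c = "act_chain D (xs @ 0 # ys) c"
  have "(\<lambda>h. Act D (obj c (Suc ?i)) (obj c ?i) h (arr c ?i)) \<in>
      vect_hom (subsp UNIV) (subsp (Hom D (obj c (Suc ?i)) (obj c ?i)))"
    using len c by (intro Act_linear_left) (simp_all add: hom_chainsD[OF c])
  then have "clinear (\<lambda>a. K (set_arr ?c ?i (Act D (obj c (Suc ?i)) (obj c ?i) a (arr c ?i))))"
    using len chain_subspace[OF c len]
    by (intro clinear_set_arr[OF K act_chain_hom[OF c] len]) (simp_all add: act_chain_simps[OF c])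
  also have "(\<lambda>a. K (set_arr ?c ?i (Act D (obj c (Suc ?i)) (obj c ?i) a (arr c ?i)))) =
      (\<lambda>a. K (act_chain D (xs @ a # ys) c))"
    by (rule ext, subst act_chain_append[OF c len, where b = 0]) (rule refl)
  finally show "clinear (\<lambda>a. K (act_chain D (xs @ a # ys) c))" .
qed

lemma act_act_chain:
  assumes c: "c \<in> hom_chains D n" and "length gs = Suc n" "length hs = Suc n"
  shows "act_chain D gs (act_chain D hs c) = act_chain D (map2 (*) gs hs) c"
  by (rule chain_eqI[of _ n])
    (use assms(2,3) in \<open>simp_all add: act_chain_simps[OF c] act_chain_simps[OF act_chain_hom[OF c]]
      Act_mult hom_chainsD[OF c]\<close>)

lemma act_chain_one:
  assumes c: "c \<in> hom_chains D n"
  shows "act_chain D (replicate (Suc n) 1) c = c"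
  by (rule chain_eqI[of _ n])
    (simp_all add: act_chain_simps[OF c] Act_one hom_chainsD[OF c] del: replicate_Suc)

section \<open>Composing neighbouring arrows\<close>

lemma merge_simps:
  assumes c: "c \<in> hom_chains D (Suc n)" and i: "i \<le> n"
  shows "length (merge D i c) = Suc n"
    and "k \<le> Suc n \<Longrightarrow> obj (merge D i c) k = obj c (if k \<le> i then k else Suc k)"
    and "k \<le> n \<Longrightarrow> arr (merge D i c) k = (if k < i then arr c k
      else if k = i then Comp D (obj c (i + 2)) (obj c (i + 1)) (obj c i) (arr c i) (arr c (i + 1))
      else arr c (Suc k))"
  using i by (simp_all add: merge_eq[OF hom_chains_length[OF c] i] obj_mk_chain_cyclic hom_chains_wrap[OF c])

lemma merge_hom:
  assumes c: "c \<in> hom_chains D (Suc n)" and i: "i \<le> n"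
  shows "merge D i c \<in> hom_chains D n"
proof (rule hom_chainsI)
  show "length (merge D i c) = Suc n"
    by (rule merge_simps(1)[OF c i])
  fix k assume k: "k \<le> n"
  show "obj (merge D i c) k \<in> Ob D"
    using k hom_chains_obj[OF c] by (simp add: merge_simps[OF c i])
  consider "k < i" | "k = i" | "k > i" by linarith
  then show "arr (merge D i c) k \<in> Hom D (obj (merge D i c) (Suc k)) (obj (merge D i c) k)"
    by cases (use k i in \<open>simp_all add: merge_simps[OF c i] hom_chainsD[OF c] Comp_closed\<close>)
qed

lemma multi_merge:
  assumes i: "i \<le> n"
  shows "multi D (Suc n) D n (merge D i)"
  unfolding multi_def
proof (intro ballI conjI allI impI)
  fix c assume c: "c \<in> hom_chains D (Suc n)"
  show mc: "merge D i c \<in> hom_chains D n" by (rule merge_hom[OF c i])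
  fix j assume j: "j \<le> Suc n"
  note s = merge_simps[OF c i] merge_simps[OF set_arr_hom[OF c j] i] hom_chains_length[OF c]
  consider "j < i" | "j = i" | "j = Suc i" | k where "j = Suc k" "k > i"
    by (cases j) force+
  then show "\<exists>k\<le>n. \<exists>l\<in>vect_hom (subsp (Hom D (obj c (Suc j)) (obj c j)))
        (subsp (Hom D (obj (merge D i c) (Suc k)) (obj (merge D i c) k))).
      \<forall>f\<in>Hom D (obj c (Suc j)) (obj c j). merge D i (set_arr c j f) = set_arr (merge D i c) k (l f)"
  proof cases
    case 1
    have "merge D i (set_arr c j f) = set_arr (merge D i c) j f" if "f \<in> Hom D (obj c (Suc j)) (obj c j)" for f
      by (rule chain_eqI[of _ n]) (use 1 i j that in \<open>simp_all add: s\<close>)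
    then show ?thesis
      using 1 i by (intro exI[of _ j] conjI bexI[of _ "\<lambda>f. f"]) (simp_all add: s vect_hom_ident)
  next
    case 2
    note s = s[unfolded 2]
    let ?l = "\<lambda>f. Comp D (obj c (i + 2)) (obj c (i + 1)) (obj c i) f (arr c (i + 1))"
    have "merge D i (set_arr c j f) = set_arr (merge D i c) i (?l f)" if "f \<in> Hom D (obj c (Suc j)) (obj c j)" for f
      by (rule chain_eqI[of _ n]) (use 2 i j that in \<open>simp_all add: s\<close>)
    moreover have "?l \<in> vect_hom (subsp (Hom D (obj c (Suc j)) (obj c j)))
        (subsp (Hom D (obj (merge D i c) (Suc i)) (obj (merge D i c) i)))"
      using 2 i Comp_linear_left[of "obj c (i + 2)" "obj c (i + 1)" "obj c i" "arr c (i + 1)"]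
      by (simp add: s hom_chainsD[OF c])
    ultimately show ?thesis using i by (intro exI[of _ i] conjI bexI[of _ ?l] ballI)
  next
    case 3
    note s = s[unfolded 3]
    let ?l = "\<lambda>f. Comp D (obj c (i + 2)) (obj c (i + 1)) (obj c i) (arr c i) f"
    have "merge D i (set_arr c j f) = set_arr (merge D i c) i (?l f)" if "f \<in> Hom D (obj c (Suc j)) (obj c j)" for f
      by (rule chain_eqI[of _ n]) (use 3 i j that in \<open>simp_all add: s\<close>)
    moreover have "?l \<in> vect_hom (subsp (Hom D (obj c (Suc j)) (obj c j)))
        (subsp (Hom D (obj (merge D i c) (Suc i)) (obj (merge D i c) i)))"
      using 3 i Comp_linear_right[of "obj c (i + 2)" "obj c (i + 1)" "obj c i" "arr c i"]
      by (simp add: s hom_chainsD[OF c])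
    ultimately show ?thesis using i by (intro exI[of _ i] conjI bexI[of _ ?l] ballI)
  next
    case 4
    note s = s[unfolded 4(1)]
    have "merge D i (set_arr c j f) = set_arr (merge D i c) k f" if "f \<in> Hom D (obj c (Suc j)) (obj c j)" for f
      by (rule chain_eqI[of _ n]) (use 4 i j that in \<open>auto simp: s\<close>)
    then show ?thesis
      using 4 i j by (intro exI[of _ k] conjI bexI[of _ "\<lambda>f. f"]) (simp_all add: s vect_hom_ident)
  qed
qed

text \<open>This is the axiom h(gf) = (h1 g)(h2 f) inside a chain: the leg acting on the composite
  in slot \<open>i\<close> splits into the legs acting on its two factors, with
  \<open>q = n - i\<close> legs to the right.\<close>

lemma equivariant_merge:
  assumes i: "i \<le> n"
  shows "equivariant H D (Suc n) D n (merge D i)"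
  unfolding equivariant_def
proof (intro allI ballI impI)
  fix K :: "('o, 'f) chain \<Rightarrow> complex" and h c
  assume c: "c \<in> hom_chains D (Suc n)" and K: "chain_linear D n K"
  define q where "q = n - i"
  have n: "n = i + q" using i by (simp add: q_def)
  have mc: "merge D i c \<in> hom_chains D n" by (rule merge_hom[OF c i])
  have K2: "chain_linear D (Suc n) (\<lambda>c. K (merge D i c))"
    using K multi_merge[OF i] by (rule chain_linear_comp) (rule Hom_subspace)
  have "sweedler H (i + Suc (Suc q)) h (\<lambda>hs. K (merge D i (act_chain D hs c))) =
      sweedler H (i + Suc q) h (\<lambda>hs. K (act_chain D hs (merge D i c)))"
  proof (rule sweedler_insert)
    show "mlin (i + Suc (Suc q)) (\<lambda>hs. K (merge D i (act_chain D hs c)))"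
      using mlin_act_chain[OF K2 c] by (simp add: n)
    show "mlin (i + Suc q) (\<lambda>hs. K (act_chain D hs (merge D i c)))"
      using mlin_act_chain[OF K mc] by (simp add: n)
    fix xs ys :: "'h list" and d :: 'h
    assume len: "length xs = i" "length ys = q"
    let ?X = "obj c (i + 2)" and ?Y = "obj c (i + 1)" and ?Z = "obj c i"
    let ?C = "act_chain D (xs @ 0 # ys) (merge D i c)"
    let ?G = "\<lambda>a b. Comp D ?X ?Y ?Z (Act D ?Y ?Z a (arr c i)) (Act D ?X ?Y b (arr c (i + 1)))"
    have ob: "?X \<in> Ob D" "?Y \<in> Ob D" "?Z \<in> Ob D"
      and ar: "arr c i \<in> Hom D ?Y ?Z" "arr c (i + 1) \<in> Hom D ?X ?Y"
      using i by (simp_all add: hom_chainsD[OF c])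
    have C: "?C \<in> hom_chains D n" "obj ?C (Suc i) = ?X" "obj ?C i = ?Z" "length ?C = Suc n"
      using i by (simp_all add: act_chain_hom[OF mc] act_chain_simps[OF mc] merge_simps[OF c i])
    have "K (act_chain D (xs @ d # ys) (merge D i c)) =
        K (set_arr ?C i (Act D ?X ?Z d (Comp D ?X ?Y ?Z (arr c i) (arr c (i + 1)))))"
      using i len act_chain_append[OF mc, of xs d ys 0] by (simp add: merge_simps[OF c i])
    also have "\<dots> = K (set_arr ?C i (tensor_lift ?G (\<Delta> d)))"
      using ob ar by (simp add: Act_Comp)
    also have "\<dots> = tensor_lift (\<lambda>a b. K (set_arr ?C i (?G a b))) (\<Delta> d)"
    proof (rule vect_hom_tensor_lift[where V = "Hom D ?X ?Z" and L = "\<lambda>f. K (set_arr ?C i f)"])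
      show "cvec.subspace (Hom D ?X ?Z)" using ob by (intro Hom_subspace)
      show "?G a b \<in> Hom D ?X ?Z" for a b using ob ar by (intro Comp_closed Act_closed)
      show "(\<lambda>f. K (set_arr ?C i f)) \<in> vect_hom (subsp (Hom D ?X ?Z)) (subsp UNIV)"
        using chain_linear_vect_hom[OF K C(1) i] C chain_subspace[OF C(1) i] by simp
    qed
    also have "\<dots> = tensor_lift (\<lambda>a b. K (merge D i (act_chain D (xs @ a # b # ys) c))) (\<Delta> d)"
    proof -
      have "set_arr ?C i (?G a b) = merge D i (act_chain D (xs @ a # b # ys) c)" for a b
      proof (rule chain_eqI[of _ n])
        fix k assume k: "k \<le> n"
        show "obj (set_arr ?C i (?G a b)) k = obj (merge D i (act_chain D (xs @ a # b # ys) c)) k"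
          using k i C(4)
          by (simp add: merge_simps[OF act_chain_hom[OF c] i] act_chain_simps[OF c] act_chain_simps[OF mc]
              merge_simps[OF c i])
        show "arr (set_arr ?C i (?G a b)) k = arr (merge D i (act_chain D (xs @ a # b # ys) c)) k"
          using k i C(4) len
          by (auto simp: merge_simps[OF act_chain_hom[OF c] i] act_chain_simps[OF c] act_chain_simps[OF mc]
              merge_simps[OF c i] nth_append nth_Cons' Suc_diff_le)
      qed (simp_all add: C merge_simps[OF act_chain_hom[OF c] i])
      then show ?thesis by simp
    qed
    finally show "K (act_chain D (xs @ d # ys) (merge D i c)) =
      tensor_lift (\<lambda>a b. K (merge D i (act_chain D (xs @ a # b # ys) c))) (\<Delta> d)" .
  qed
  then show "sweedler H (Suc n) h (\<lambda>hs. K (act_chain D hs (merge D i c))) =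
      sweedler H (Suc (Suc n)) h (\<lambda>hs. K (merge D i (act_chain D hs c)))"
    by (simp add: n)
qed

text \<open>Associativity of composition enters for \<open>j = i\<close>, where the two compositions
  share an arrow; otherwise they concern disjoint pairs and only the indices shift.\<close>

lemma merge_merge:
  assumes c: "c \<in> hom_chains D (Suc (Suc n))" and ij: "i \<le> j" "j \<le> n"
  shows "merge D i (merge D (Suc j) c) = merge D j (merge D i c)"
proof -
  have i: "i \<le> n" "i \<le> Suc n" and j: "Suc j \<le> Suc n" using ij by auto
  note s = merge_simps[OF merge_hom[OF c j] i(1)] merge_simps[OF merge_hom[OF c i(2)] ij(2)]
    merge_simps[OF c j] merge_simps[OF c i(2)]
  show ?thesis
  proof (rule chain_eqI[of _ n])
    fix k assume k: "k \<le> n"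
    show "obj (merge D i (merge D (Suc j) c)) k = obj (merge D j (merge D i c)) k"
      by (cases "k \<le> i"; cases "k \<le> j") (use k ij in \<open>simp_all add: s\<close>)
    show "arr (merge D i (merge D (Suc j) c)) k = arr (merge D j (merge D i c)) k"
    proof (cases "j = i")
 case True
      note s = s[unfolded True]
      consider "k < i" | "k = i" | "k > i" by linarith
      then show ?thesis
        by cases (use True k ij in \<open>simp_all add: s Comp_assoc hom_chainsD[OF c]\<close>)
    next
      case False
      consider "k < i" | "k = i" | "i < k" "k < j" | "k = j" | "k > j" by linarith
      then show ?thesis
        by cases (use False k ij in \<open>simp_all add: s\<close>)
    qed
  qed (simp_all add: s)
qed

section \<open>Rotating chains\<close>

lemma rotate_simps:
  assumes c: "c \<in> hom_chains D n"
  shows "length (rotate_chain D h c) = Suc n"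
    and "k \<le> Suc n \<Longrightarrow> obj (rotate_chain D h c) k = (if k = 0 then obj c n else obj c (k - 1))"
    and "k \<le> n \<Longrightarrow> arr (rotate_chain D h c) k =
      (if k = 0 then Act D (obj c 0) (obj c n) h (arr c n) else arr c (k - 1))"
  by (simp_all add: rotate_chain_eq[OF hom_chains_length[OF c]] obj_mk_chain_cyclic hom_chains_wrap[OF c])

lemma rotate_hom:
  assumes c: "c \<in> hom_chains D n"
  shows "rotate_chain D h c \<in> hom_chains D n"
proof (rule hom_chainsI)
  show "length (rotate_chain D h c) = Suc n"
    by (rule rotate_simps(1)[OF c])
  fix k assume k: "k \<le> n"
  show "obj (rotate_chain D h c) k \<in> Ob D"
    using k hom_chains_obj[OF c] by (simp add: rotate_simps[OF c])
  have "arr c n \<in> Hom D (obj c 0) (obj c n)"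
    using hom_chains_arr[OF c, of n] by (simp add: hom_chains_wrap[OF c])
  then show "arr (rotate_chain D h c) k \<in> Hom D (obj (rotate_chain D h c) (Suc k)) (obj (rotate_chain D h c) k)"
    using k hom_chains_arr[OF c, of "k - 1"] hom_chains_obj[OF c]
    by (cases k) (simp_all add: rotate_simps[OF c] Act_closed)
qed

lemma multi_rotate: "multi D n D n (rotate_chain D h)"
  unfolding multi_def
proof (intro ballI conjI allI impI)
  fix c assume c: "c \<in> hom_chains D n"
  show "rotate_chain D h c \<in> hom_chains D n" by (rule rotate_hom[OF c])
  fix j assume j: "j \<le> n"
  note s = rotate_simps[OF c] rotate_simps[OF set_arr_hom[OF c j]] hom_chains_length[OF c]
  show "\<exists>k\<le>n. \<exists>l\<in>vect_hom (subsp (Hom D (obj c (Suc j)) (obj c j)))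
        (subsp (Hom D (obj (rotate_chain D h c) (Suc k)) (obj (rotate_chain D h c) k))).
      \<forall>f\<in>Hom D (obj c (Suc j)) (obj c j). rotate_chain D h (set_arr c j f) = set_arr (rotate_chain D h c) k (l f)"
  proof (cases "j = n")
    case True
    note s = s[unfolded True]
    have "rotate_chain D h (set_arr c j f) = set_arr (rotate_chain D h c) 0 (Act D (obj c 0) (obj c n) h f)"
      if "f \<in> Hom D (obj c (Suc j)) (obj c j)" for f
      by (rule chain_eqI[of _ n]) (use True that in \<open>auto simp: s\<close>)
    moreover have "Act D (obj c 0) (obj c n) h \<in> vect_hom (subsp (Hom D (obj c (Suc j)) (obj c j)))
        (subsp (Hom D (obj (rotate_chain D h c) (Suc 0)) (obj (rotate_chain D h c) 0)))"
      using True Act_linear_right[of "obj c 0" "obj c n" h] by (simp add: s hom_chainsD[OF c])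
    ultimately show ?thesis by (intro exI[of _ 0] conjI bexI[of _ "Act D (obj c 0) (obj c n) h"] ballI) simp_all
  next
    case False
    have "rotate_chain D h (set_arr c j f) = set_arr (rotate_chain D h c) (Suc j) f"
      if "f \<in> Hom D (obj c (Suc j)) (obj c j)" for f
      by (rule chain_eqI[of _ n]) (use False j that in \<open>auto simp: s\<close>)
    then show ?thesis
      using False j by (intro exI[of _ "Suc j"] conjI bexI[of _ "\<lambda>f. f"]) (simp_all add: s vect_hom_ident)
  qed
qed

lemma rotate_chain_set_arr:
  assumes c: "c \<in> hom_chains D n"
  shows "rotate_chain D h c = set_arr (rotate_chain D g c) 0 (Act D (obj c 0) (obj c n) h (arr c n))"
  by (rule chain_eqI[of _ n]) (auto simp: rotate_simps[OF c])

lemma clinear_rotate: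
  assumes K: "chain_linear D n K" and c: "c \<in> hom_chains D n"
  shows "clinear (\<lambda>h. K (rotate_chain D h c))"
proof -
  let ?c = "rotate_chain D 0 c"
  have "(\<lambda>h. Act D (obj c 0) (obj c n) h (arr c n)) \<in>
      vect_hom (subsp UNIV) (subsp (Hom D (obj c 0) (obj c n)))"
    using hom_chains_arr[OF c, of n] hom_chains_obj[OF c] hom_chains_wrap[OF c] by (intro Act_linear_left) simp_all
  then have "clinear (\<lambda>h. K (set_arr ?c 0 (Act D (obj c 0) (obj c n) h (arr c n))))"
    using chain_subspace[OF rotate_hom[OF c, of 0], of 0]
    by (intro clinear_set_arr[OF K rotate_hom[OF c]]) (simp_all add: rotate_simps[OF c])
  also have "(\<lambda>h. K (set_arr ?c 0 (Act D (obj c 0) (obj c n) h (arr c n)))) = (\<lambda>h. K (rotate_chain D h c))"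
    by (rule ext, subst rotate_chain_set_arr[OF c, of _ 0]) (rule refl)
  finally show ?thesis .
qed

text \<open>The bound \<open>i < n\<close> keeps the last arrow, the one that is moved and acted
  upon, out of the composition. The case \<open>i = n\<close> involves the coproduct and is the
  subject of \<open>rotated_rotated_merge\<close>.\<close>

lemma merge_rotate:
  assumes c: "c \<in> hom_chains D (Suc n)" and i: "i < n"
  shows "merge D (Suc i) (rotate_chain D h c) = rotate_chain D h (merge D i c)"
proof -
  have i': "i \<le> n" "Suc i \<le> n" using i by auto
  note s = merge_simps[OF rotate_hom[OF c] i'(2)] rotate_simps[OF merge_hom[OF c i'(1)]]
    merge_simps[OF c i'(1)] rotate_simps[OF c]
  show ?thesis
  proof (rule chain_eqI[of _ n])
    fix k assume k: "k \<le> n"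
    show "obj (merge D (Suc i) (rotate_chain D h c)) k = obj (rotate_chain D h (merge D i c)) k"
      by (cases k) (use k i in \<open>auto simp: s\<close>)
    show "arr (merge D (Suc i) (rotate_chain D h c)) k = arr (rotate_chain D h (merge D i c)) k"
      by (cases k) (use k i in \<open>auto simp: s\<close>)
  qed (simp_all add: s)
qed

text \<open>The chain form of \<delta>_(n+1) = \<tau> \<delta>_0, through which all relations for
  the last coface are later derived.\<close>

lemma merge_0_rotate:
  assumes c: "c \<in> hom_chains D (Suc n)"
  shows "merge D 0 (rotate_chain D h c) = merge_last D h c"
  unfolding merge_last_eq[OF hom_chains_length[OF c]]
  by (rule chain_eq_mk_chain)
    (auto simp: merge_simps[OF rotate_hom[OF c]] rotate_simps[OF c])

end

section \<open>Cochains with coefficients in a SAYD module\<close>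

context sayd_module
begin

lemmas clinear_ract_left [clin] = clinear_comp[OF ract_linear_left]
lemmas clinear_ract_right [clin] = clinear_comp[OF ract_linear_right]

lemma coact_coassoc_lift:
  assumes "\<And>b x. clinear (\<lambda>a. K a b x)" "\<And>a x. clinear (\<lambda>b. K a b x)" "\<And>a b. clinear (\<lambda>x. K a b x)"
  shows "tensor_lift (\<lambda>a x. tensor_lift (\<lambda>a1 a2. K a1 a2 x) (\<Delta> a)) (coact M m) =
    tensor_lift (\<lambda>a x. tensor_lift (\<lambda>b y. K a b y) (coact M x)) (coact M m)"
proof -
  define L where "L = tensor_lift (\<lambda>a t. tensor_lift (\<lambda>b x. K a b x) t)"
  have lin: "clinear L"
    unfolding L_def by (intro clin clinear_tensor_lift assms)
  have "L (a \<boxtimes> t) = tensor_lift (\<lambda>b x. K a b x) t" for a t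
    unfolding L_def by (intro tensor_lift_pure clin assms)
  moreover have "tensor_lift (\<lambda>b x. K a b x) (b \<boxtimes> x) = K a b x" for a b x
    by (intro tensor_lift_pure assms)
  ultimately show ?thesis
    using arg_cong[OF coact_coassoc[of m], of L] by (simp add: linear_tensor_lift[OF lin])
qed

lemma coact_counit_lift: "clinear K \<Longrightarrow> tensor_lift (\<lambda>a x. \<epsilon> a *\<^sub>C K x) (coact M m) = K m"
  using arg_cong[OF coact_counit[of m], of K] by (simp add: linear_tensor_lift clinear_scaleD)

lemma coact_ract_lift:
  assumes "\<And>x. clinear (\<lambda>a. K a x)" "\<And>a. clinear (\<lambda>x. K a x)"
  shows "tensor_lift (\<lambda>a x. K a x) (coact M (ract M m h)) =
    tensor_lift (\<lambda>h1 q. tensor_lift (\<lambda>h2 h3. tensor_lift (\<lambda>a x. K (S h3 * a * h1) (ract M x h2)) (coact M m))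
      (\<Delta> q)) (\<Delta> h)"
  by (simp add: anti_yetter_drinfeld eval_nat_numeral linear_tensor_lift[OF clinear_tensor_lift[OF assms]]
      tensor_lift_pure[OF assms])

text \<open>Stability of m(0) allows the factor m(0)(-1) to be inserted in front of T(m(-1)). By
  coassociativity of the coaction the two become the second leg of m(-1) times T of the first, which
  \<open>comult_T_right\<close> cancels. The cyclic operator twists by \<open>T\<close>, so this is
  the form of stability that closes a full turn.\<close>

lemma stable_T: "tensor_lift (\<lambda>a x. ract M x (T a)) (coact M m) = m"
proof -
  have "ract M x (T a) = tensor_lift (\<lambda>b y. ract M y (b * T a)) (coact M x)" for a x
  proof -
    have "ract M x (T a) = ract M (tensor_lift (\<lambda>b y. ract M y b) (coact M x)) (T a)"
      by (simp add: stable)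
    also have "\<dots> = tensor_lift (\<lambda>b y. ract M (ract M y b) (T a)) (coact M x)"
      by (rule linear_tensor_lift) (rule ract_linear_left)
    finally show ?thesis by (simp add: ract_mult)
  qed
  then have "tensor_lift (\<lambda>a x. ract M x (T a)) (coact M m) =
      tensor_lift (\<lambda>a x. tensor_lift (\<lambda>b y. ract M y (b * T a)) (coact M x)) (coact M m)"
    by simp
  also have "\<dots> = tensor_lift (\<lambda>a x. tensor_lift (\<lambda>a1 a2. ract M x (a2 * T a1)) (\<Delta> a)) (coact M m)"
    by (rule coact_coassoc_lift[symmetric]) (intro clin)+
  also have "\<dots> = tensor_lift (\<lambda>a x. \<epsilon> a *\<^sub>C ract M x 1) (coact M m)"
    by (simp add: comult_T_right[where K = "ract M _"] ract_linear_right)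
  finally show ?thesis by (simp add: ract_one coact_counit)
qed

end

locale cyclic_module = sayd_module H M + left_H_category H D
  for H :: "('h::complex_algebra) hopf"
    and M :: "('h, 'm::complex_vector) hopf_module"
    and D :: "('o, 'f::complex_vector, 'h) hcat"
begin

text \<open>
  Cochains are the functionals on \<open>M \<otimes>\<^sub>H CN\<^sub>n\<close>: by the antipode axioms the invariance
  \<open>F(m h\<^sub>1 \<otimes> S(h\<^sub>2) c) = \<epsilon>(h) F(m \<otimes> c)\<close> amounts to \<open>F(m h \<otimes> c) = F(m \<otimes> h c)\<close>.
\<close>

definition balanced :: "nat \<Rightarrow> ('m \<Rightarrow> ('o, 'f) chain \<Rightarrow> complex) \<Rightarrow> bool"
  where "balanced n F \<longleftrightarrow> (\<forall>m h. \<forall>c\<in>hom_chains D n.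
    F (ract M m h) c = sweedler H (Suc n) h (\<lambda>hs. F m (act_chain D hs c)))"

lemma balancedD:
  "balanced n F \<Longrightarrow> c \<in> hom_chains D n \<Longrightarrow>
    F (ract M m h) c = sweedler H (Suc n) h (\<lambda>hs. F m (act_chain D hs c))"
  by (simp add: balanced_def)

lemma multilinear_clinear: "multilinear D n F \<Longrightarrow> c \<in> hom_chains D n \<Longrightarrow> clinear (\<lambda>m. F m c)"
  and multilinear_chain_linear: "multilinear D n F \<Longrightarrow> chain_linear D n (F m)"
  by (simp_all add: multilinear_def)

lemma balanced_iff:
  assumes F: "multilinear D n F"
  shows "balanced n F \<longleftrightarrow> (\<forall>h m. \<forall>c\<in>hom_chains D n.
      tensor_lift (\<lambda>a b. sweedler H (Suc n) (S b) (\<lambda>hs. F (ract M m a) (act_chain D hs c))) (\<Delta> h)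
      = \<epsilon> h * F m c)" (is "_ \<longleftrightarrow> ?inv")
proof -
  \<comment> \<open>\<open>P c m h\<close> is F(m \<otimes> h c); both conditions become statements
    about this one function, linear in \<open>m\<close> and in \<open>h\<close>.\<close>
  define P where "P c m h = sweedler H (Suc n) h (\<lambda>hs. F m (act_chain D hs c))" for c m h
  have mlin: "mlin (Suc n) (\<lambda>hs. F m (act_chain D hs c))" if "c \<in> hom_chains D n" for c m
    by (rule mlin_act_chain[OF multilinear_chain_linear[OF F] that])
  have P1: "clinear (\<lambda>m. P c m h)" and P2: "clinear (\<lambda>h. P c m h)" if "c \<in> hom_chains D n" for c m h
    unfolding P_def using mlin[OF that] multilinear_clinear[OF F] act_chain_hom[OF that]
    by (auto intro: clinear_sweedler_fun clinear_sweedler_arg)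
  have P_mult: "sweedler H (Suc n) g (\<lambda>hs. P (act_chain D hs c) m h) = P c m (h * g)"
    if c: "c \<in> hom_chains D n" for c m g h
  proof -
    have "P c m (h * g) = sweedler H (Suc n) g (\<lambda>hs. sweedler H (Suc n) h (\<lambda>gs. F m (act_chain D (map2 (*) gs hs) c)))"
      unfolding P_def sweedler_mult[OF mlin[OF c]] by (rule sweedler_swap)
    then show ?thesis
      unfolding P_def by (simp add: act_act_chain[OF c] cong: sweedler_cong)
  qed
  have P_one: "P c m 1 = F m c" if "c \<in> hom_chains D n" for c m
    unfolding P_def sweedler_one[OF mlin[OF that]] act_chain_one[OF that] ..
  have sweedler_F: "sweedler H (Suc n) g (\<lambda>hs. F m (act_chain D hs c)) = P c m g" for g m c
    by (simp add: P_def)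
  show ?thesis
  proof
    assume bal: "balanced n F"
    show ?inv
    proof (intro allI ballI)
      fix h m c assume c: "c \<in> hom_chains D n"
      have "sweedler H (Suc n) g (\<lambda>hs. F (ract M m a) (act_chain D hs c)) = P c m (a * g)" for a g
        using bal c by (simp add: balancedD act_chain_hom sweedler_F P_mult)
      then show "tensor_lift (\<lambda>a b. sweedler H (Suc n) (S b) (\<lambda>hs. F (ract M m a) (act_chain D hs c))) (\<Delta> h)
          = \<epsilon> h * F m c"
        using comult_antipode_right[OF P2[OF c], of m h] by (simp add: P_one[OF c] scaleC_complex_def)
    qed
  next
    assume inv: ?inv
    show "balanced n F"
      unfolding balanced_def
    proof (intro allI ballI)
      fix m h c assume c: "c \<in> hom_chains D n"
      \<comment> \<open>The invariance is needed for the chain g c with arbitrary \<open>g\<close>,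
        because the third leg of \<open>h\<close> will stand there.\<close>
      have inv_P: "tensor_lift (\<lambda>a b. P c (ract M m a) (S b * g)) (\<Delta> h) = \<epsilon> h *\<^sub>C P c m g" for h g
      proof -
        have "tensor_lift (\<lambda>a b. P c (ract M m a) (S b * g)) (\<Delta> h) =
            tensor_lift (\<lambda>a b. sweedler H (Suc n) g (\<lambda>hs. P (act_chain D hs c) (ract M m a) (S b))) (\<Delta> h)"
          by (simp add: P_mult[OF c])
        also have "\<dots> = sweedler H (Suc n) g (\<lambda>hs. tensor_lift (\<lambda>a b. P (act_chain D hs c) (ract M m a) (S b)) (\<Delta> h))"
          by (rule sweedler_tensor_lift[symmetric])
        also have "\<dots> = sweedler H (Suc n) g (\<lambda>hs. \<epsilon> h *\<^sub>C F m (act_chain D hs c))"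
          using inv act_chain_hom[OF c] by (simp add: P_def scaleC_complex_def)
        finally show ?thesis by (simp add: sweedler_scale P_def)
      qed
      note P = P1[OF c, THEN clinear_comp] P2[OF c, THEN clinear_comp]
      \<comment> \<open>The computation is F(m h \<otimes> c) = F(m h1 \<otimes> S(h2) h3 c) =
        \<epsilon>(h1) F(m \<otimes> h2 c) = F(m \<otimes> h c).\<close>
      have "F (ract M m h) c = P c (ract M m h) 1"
        by (simp add: P_one[OF c])
      also have "\<dots> = tensor_lift (\<lambda>a q. \<epsilon> q *\<^sub>C P c (ract M m a) 1) (\<Delta> h)"
        by (rule comult_counit_right[symmetric]) (intro clin P)
      also have "\<dots> = tensor_lift (\<lambda>a q. tensor_lift (\<lambda>b d. P c (ract M m a) (S b * d)) (\<Delta> q)) (\<Delta> h)"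
        by (simp add: comult_antipode_left[OF P2[OF c]])
      also have "\<dots> = tensor_lift (\<lambda>q d. tensor_lift (\<lambda>a b. P c (ract M m a) (S b * d)) (\<Delta> q)) (\<Delta> h)"
        by (rule comult_coassoc[symmetric]) (intro clin P)+
      also have "\<dots> = tensor_lift (\<lambda>q d. \<epsilon> q *\<^sub>C P c m d) (\<Delta> h)"
        by (simp add: inv_P)
      also have "\<dots> = P c m h"
        by (rule comult_counit_left[OF P2[OF c]])
      finally show "F (ract M m h) c = sweedler H (Suc n) h (\<lambda>hs. F m (act_chain D hs c))"
        by (simp add: P_def)
    qed
  qed
qed

section \<open>Cochains as balanced multilinear functions\<close>

abbreviation C :: "nat \<Rightarrow> ('m, 'o, 'f) cochain set"
  where "C n \<equiv> cochains H M D n"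

lemma cochains_iff:
  "\<phi> \<in> C n \<longleftrightarrow> \<phi> \<in> vect_hom (nerve_tensor D n) (subsp UNIV) \<and>
    (\<forall>A. A \<notin> carrier (nerve_tensor D n) \<longrightarrow> \<phi> A = 0) \<and> balanced n (\<lambda>m c. \<phi> (elementary D n m c))"
  unfolding cochains_def using balanced_iff[OF nerve_functional_multilinear, of \<phi> n] by auto

lemma cochain_multilinear: "\<phi> \<in> C n \<Longrightarrow> multilinear D n (\<lambda>m c. \<phi> (elementary D n m c))"
  and cochain_balanced: "\<phi> \<in> C n \<Longrightarrow> balanced n (\<lambda>m c. \<phi> (elementary D n m c))"
  by (simp_all add: cochains_iff nerve_functional_multilinear)

lemma extend_linearly_cochain:
  assumes "multilinear D n F" "balanced n F"
  shows "extend_linearly D n F \<in> C n"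
  using assms
  by (simp add: cochains_iff extend_linearly_vect_hom extend_linearly_outside balanced_def
      extend_linearly_elementary act_chain_hom)

lemma cochain_eqI:
  assumes "\<phi> \<in> C n" "\<psi> \<in> C n"
    and "\<And>m c. c \<in> hom_chains D n \<Longrightarrow> \<phi> (elementary D n m c) = \<psi> (elementary D n m c)"
  shows "\<phi> = \<psi>"
  using assms by (intro nerve_functional_eqI[of \<phi> D n \<psi>]) (simp_all add: cochains_iff)

lemma subspace_cochains: "cvec.subspace (C n)"
proof -
  have lin: "(\<lambda>A. a *\<^sub>C \<phi> A + \<psi> A) \<in> C n" if \<phi>: "\<phi> \<in> C n" and \<psi>: "\<psi> \<in> C n" for a \<phi> \<psi>
  proof -
    have "(\<lambda>A. a *\<^sub>C \<phi> A + \<psi> A) \<in> vect_hom (nerve_tensor D n) (subsp UNIV)"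
      using \<phi> \<psi> unfolding cochains_iff vect_hom_def
      by (auto simp: subsp_def algebra_simps scaleC_complex_def)
    moreover have "balanced n (\<lambda>m c. a *\<^sub>C \<phi> (elementary D n m c) + \<psi> (elementary D n m c))"
      using cochain_balanced[OF \<phi>] cochain_balanced[OF \<psi>]
      unfolding balanced_def sweedler_add sweedler_scale by simp
    ultimately show ?thesis
      using \<phi> \<psi> by (simp add: cochains_iff)
  qed
  have zero: "0 \<in> C n"
    by (simp add: cochains_iff vect_hom_def subsp_def balanced_def sweedler_scale[where c = 0, simplified]
        linear_sweedler[where L = "\<lambda>_. 0", simplified])
  show ?thesis
    unfolding cvec.subspace_def
  proof (intro conjI ballI allI zero)
    show "\<phi> + \<psi> \<in> C n" if "\<phi> \<in> C n" "\<psi> \<in> C n" for \<phi> \<psi>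
      using lin[OF that, of 1] by (simp add: scaleC_one plus_fun_def)
    show "a *\<^sub>C \<phi> \<in> C n" if "\<phi> \<in> C n" for a \<phi>
      using lin[OF that zero, of a] by (simp add: scaleC_fun_def zero_fun_def)
  qed
qed

subsection \<open>The cyclic operator\<close>

text \<open>The cyclic operator on plain functions of chains, so that its properties can be computed
  before passing to functionals on the nerve.\<close>

definition rotated :: "nat \<Rightarrow> ('m \<Rightarrow> ('o, 'f) chain \<Rightarrow> complex) \<Rightarrow> 'm \<Rightarrow> ('o, 'f) chain \<Rightarrow> complex"
  where "rotated n F m c = tensor_lift (\<lambda>a x. F x (rotate_chain D (T a) c)) (coact M m)"

lemma rotated_clinear:
  assumes F: "multilinear D n F" and c: "c \<in> hom_chains D n"
  shows "clinear (\<lambda>a. F x (rotate_chain D a c))" "clinear (\<lambda>x. F x (rotate_chain D a c))"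
  using clinear_rotate[OF multilinear_chain_linear[OF F] c] multilinear_clinear[OF F rotate_hom[OF c]] .

lemma multilinear_rotated:
  assumes F: "multilinear D n F"
  shows "multilinear D n (rotated n F)"
  unfolding multilinear_def
proof (intro conjI ballI allI)
  fix c assume c: "c \<in> hom_chains D n"
  show "clinear (\<lambda>m. rotated n F m c)"
    unfolding rotated_def
    by (intro clinear_tensor_lift_arg coact_linear clinear_comp[OF rotated_clinear(1)[OF F c]] clinear_T
        rotated_clinear(2)[OF F c])
next
  show "chain_linear D n (rotated n F m)" for m
    unfolding rotated_def
    by (intro chain_linear_tensor_lift chain_linear_comp[OF multilinear_chain_linear[OF F] multi_rotate] Hom_subspace)
qed

text \<open>The parameter of the rotation and the leg of the moved arrow act on the same arrow,
  hence combine to a product, in the order in which they are applied. The entry 1 marks that the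
  last arrow has no further leg of its own.\<close>

lemma act_rotate:
  assumes c: "c \<in> hom_chains D n" and "length ks = n"
  shows "act_chain D (b # ks) (rotate_chain D k c) = rotate_chain D (b * k) (act_chain D (ks @ [1]) c)"
    and "rotate_chain D k (act_chain D (ks @ [g]) c) = rotate_chain D (k * g) (act_chain D (ks @ [1]) c)"
proof -
  note s = act_chain_simps[OF rotate_hom[OF c]] act_chain_simps[OF c] rotate_simps[OF c]
    rotate_simps[OF act_chain_hom[OF c]] hom_chainsD[OF c]
  have last: "arr c n \<in> Hom D (obj c 0) (obj c n)" and first: "obj c 0 \<in> Ob D"
    using hom_chains_arr[OF c, of n] hom_chains_obj[OF c, of 0] by (simp_all add: hom_chains_wrap[OF c])
  show "act_chain D (b # ks) (rotate_chain D k c) = rotate_chain D (b * k) (act_chain D (ks @ [1]) c)"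
  proof (rule chain_eqI[of _ n])
    fix i assume "i \<le> n"
    then show "arr (act_chain D (b # ks) (rotate_chain D k c)) i = arr (rotate_chain D (b * k) (act_chain D (ks @ [1]) c)) i"
      using assms(2) last first by (cases i) (simp_all add: s Act_mult Act_one nth_append)
  qed (simp_all add: s)
  show "rotate_chain D k (act_chain D (ks @ [g]) c) = rotate_chain D (k * g) (act_chain D (ks @ [1]) c)"
  proof (rule chain_eqI[of _ n])
    fix i assume "i \<le> n"
    then show "arr (rotate_chain D k (act_chain D (ks @ [g]) c)) i = arr (rotate_chain D (k * g) (act_chain D (ks @ [1]) c)) i"
      using assms(2) last first by (cases i) (simp_all add: s Act_mult Act_one nth_append)
  qed (simp_all add: s)
qed

text \<open>By the anti-Yetter-Drinfeld condition the value at m h is F(m(0) h2 \<otimes> c rotated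
  with T(S(h3) m(-1) h1)), and this parameter equals T(h1) T(m(-1)) h3. Balancing moves h2 to the
  chain, where its first leg lands in front of T(h1) and cancels with it. What is left is T(m(-1))
  h3 on the moved arrow and the earlier legs on the others: the rotation of h c.\<close>

lemma balanced_rotated:
  assumes F: "multilinear D n F" and bal: "balanced n F"
  shows "balanced n (rotated n F)"
  unfolding balanced_def
proof (intro allI ballI)
  fix m h c assume c: "c \<in> hom_chains D n"
  let ?t = "\<lambda>h K. tensor_lift K (\<Delta> h)"
  \<comment> \<open>In \<open>V\<close>, the argument \<open>z\<close> collects what stands to the
    left of T(m(-1)) and \<open>h3\<close> what stands to its right, so that the cancellation takes
    place in \<open>z\<close> alone.\<close>
  define G where "G x k ks = F x (rotate_chain D k (act_chain D (ks @ [1]) c))" for x k ks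
  define W where "W x k b = sweedler H n b (G x k)" for x k b
  define V where "V z b h3 = tensor_lift (\<lambda>a x. W x (z * (T a * h3)) b) (coact M m)" for z b h3
  have "mlin n (G x k)" for x k
    unfolding G_def
    by (rule mlin_append_right[where ys = "[1]" and K = "\<lambda>hs. F x (rotate_chain D k (act_chain D hs c))"])
      (simp add: mlin_act_chain[OF chain_linear_comp[OF multilinear_chain_linear[OF F] multi_rotate] c] Hom_subspace)
  then have W3: "clinear (\<lambda>b. W x k b)" for x k
    unfolding W_def by (rule clinear_sweedler_arg)
  have W12: "clinear (\<lambda>x. W x k b)" "clinear (\<lambda>k. W x k b)" for x k b
    unfolding W_def G_def by (intro clinear_sweedler_fun rotated_clinear[OF F act_chain_hom[OF c]])+
  note W = W3[THEN clinear_comp] W12[THEN clinear_comp]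
  have V': "clinear (\<lambda>z. V z b h3)" "clinear (\<lambda>b. V z b h3)" "clinear (\<lambda>h3. V z b h3)" for z b h3
    unfolding V_def by (intro clin W)+
  note V = V'[THEN clinear_comp]
  have F_act: "F (ract M x g) (rotate_chain D k c) = ?t g (\<lambda>b b'. W x (b * k) b')" for x g k
  proof -
    have "F (ract M x g) (rotate_chain D k c) = sweedler H (Suc n) g (\<lambda>hs. F x (act_chain D hs (rotate_chain D k c)))"
      by (rule balancedD[OF bal rotate_hom[OF c]])
    also have "\<dots> = ?t g (\<lambda>b b'. sweedler H n b' (\<lambda>ks. F x (act_chain D (b # ks) (rotate_chain D k c))))"
      by (rule sweedler_Suc[OF mlin_act_chain[OF multilinear_chain_linear[OF F] rotate_hom[OF c]]])
    finally show ?thesis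
      by (simp add: W_def G_def[abs_def] act_rotate(1)[OF c] cong: sweedler_cong)
  qed
  have "rotated n F (ract M m h) c = ?t h (\<lambda>h1 q. ?t q (\<lambda>h2 h3. tensor_lift (\<lambda>a x.
      F (ract M x h2) (rotate_chain D (T (S h3 * a * h1)) c)) (coact M m)))"
    unfolding rotated_def
    by (rule coact_ract_lift) (intro clinear_comp[OF rotated_clinear(1)[OF F c]] clinear_T rotated_clinear(2)[OF F c])+
  also have "\<dots> = ?t h (\<lambda>h1 q. ?t q (\<lambda>h2 h3. tensor_lift (\<lambda>a x. ?t h2 (\<lambda>b b'.
      W x (b * (T h1 * (T a * h3))) b')) (coact M m)))"
    by (simp add: F_act T_mult)
  also have "\<dots> = ?t h (\<lambda>h1 q. ?t q (\<lambda>h2 h3. ?t h2 (\<lambda>b b'. V (b * T h1) b' h3)))"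
    unfolding V_def by (subst tensor_lift_swap) (simp add: mult.assoc)
  also have "\<dots> = ?t h (\<lambda>h1 q. ?t q (\<lambda>b q'. ?t q' (\<lambda>b' h3. V (b * T h1) b' h3)))"
    by (subst comult_coassoc, (intro clin V)+) (rule refl)
  also have "\<dots> = ?t h (\<lambda>p q'. ?t p (\<lambda>h1 b. ?t q' (\<lambda>b' h3. V (b * T h1) b' h3)))"
    by (rule comult_coassoc[symmetric]) (intro clin V)+
  also have "\<dots> = ?t h (\<lambda>p q'. ?t q' (\<lambda>b' h3. ?t p (\<lambda>h1 b. V (b * T h1) b' h3)))"
    by (subst tensor_lift_swap) (rule refl)
  also have "\<dots> = ?t h (\<lambda>p q'. \<epsilon> p *\<^sub>C ?t q' (\<lambda>b' h3. V 1 b' h3))"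
    by (simp add: comult_T_right[OF V'(1)] tensor_lift_scale)
  also have "\<dots> = ?t h (\<lambda>b' h3. V 1 b' h3)"
    by (rule comult_counit_left) (intro clin V)
  also have "\<dots> = ?t h (\<lambda>b' h3. sweedler H n b' (\<lambda>ks. rotated n F m (act_chain D (ks @ [h3]) c)))"
  proof -
    have "sweedler H n b' (\<lambda>ks. rotated n F m (act_chain D (ks @ [h3]) c)) =
        sweedler H n b' (\<lambda>ks. tensor_lift (\<lambda>a x. G x (T a * h3) ks) (coact M m))" for b' h3
      by (rule sweedler_cong) (simp only: rotated_def G_def act_rotate(2)[OF c, where g = h3])
    then show ?thesis
      by (simp add: V_def W_def sweedler_tensor_lift)
  qed
  also have "\<dots> = sweedler H (Suc n) h (\<lambda>hs. rotated n F m (act_chain D hs c))"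
    by (rule sweedler_snoc[symmetric])
      (rule mlin_act_chain[OF multilinear_chain_linear[OF multilinear_rotated[OF F]] c])
  finally show "rotated n F (ract M m h) c = sweedler H (Suc n) h (\<lambda>hs. rotated n F m (act_chain D hs c))" .
qed

text \<open>The \<open>k\<close>-fold rotation of \<open>c\<close>, with \<open>hs\<close> acting on the arrows moved to the front.\<close>

definition rotate_by :: "nat \<Rightarrow> 'h list \<Rightarrow> ('o, 'f) chain \<Rightarrow> nat \<Rightarrow> ('o, 'f) chain"
  where "rotate_by k hs c n = mk_chain n
    (\<lambda>j. if j < k then obj c (j + Suc n - k) else obj c (j - k))
    (\<lambda>j. if j < k then Act D (obj c (Suc (j + Suc n - k))) (obj c (j + Suc n - k)) (hs ! j) (arr c (j + Suc n - k))
      else arr c (j - k))"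

lemma rotate_by_simps:
  assumes c: "c \<in> hom_chains D n" and k: "k \<le> Suc n"
  shows "length (rotate_by k hs c n) = Suc n"
    and "j \<le> Suc n \<Longrightarrow> obj (rotate_by k hs c n) j = (if j < k then obj c (j + Suc n - k) else obj c (j - k))"
    and "j \<le> n \<Longrightarrow> arr (rotate_by k hs c n) j =
      (if j < k then Act D (obj c (Suc (j + Suc n - k))) (obj c (j + Suc n - k)) (hs ! j) (arr c (j + Suc n - k))
      else arr c (j - k))"
  using k by (cases k; simp add: rotate_by_def obj_mk_chain_cyclic hom_chains_wrap[OF c])+

lemma rotate_by_hom:
  assumes c: "c \<in> hom_chains D n" and k: "k \<le> Suc n"
  shows "rotate_by k hs c n \<in> hom_chains D n"
proof (rule hom_chainsI)
  fix j assume j: "j \<le> n"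
  show "obj (rotate_by k hs c n) j \<in> Ob D"
    using j k hom_chains_obj[OF c] by (simp add: rotate_by_simps[OF c k])
  consider "Suc j < k" | "Suc j = k" | "k \<le> j" by linarith
  then show "arr (rotate_by k hs c n) j \<in> Hom D (obj (rotate_by k hs c n) (Suc j)) (obj (rotate_by k hs c n) j)"
  proof cases
    case 1
    then show ?thesis
      using j k hom_chains_arr[OF c, of "j + Suc n - k"] hom_chains_obj[OF c]
      by (simp add: rotate_by_simps[OF c k] Act_closed Suc_diff_le)
  next
    case 2
    then show ?thesis
      using j k hom_chains_arr[OF c, of n] hom_chains_obj[OF c] hom_chains_wrap[OF c]
      by (auto simp: rotate_by_simps[OF c k] intro!: Act_closed)
  next
    case 3
    then show ?thesis
      using j k hom_chains_arr[OF c, of "j - k"]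
      by (simp add: rotate_by_simps[OF c k] Suc_diff_le)
  qed
qed (rule rotate_by_simps(1)[OF c k])

lemma mlin_rotate_by:
  assumes K: "chain_linear D n K" and c: "c \<in> hom_chains D n" and k: "k \<le> Suc n"
  shows "mlin k (\<lambda>hs. K (rotate_by k hs c n))"
  unfolding mlin_def
proof (intro allI impI)
  fix xs ys :: "'h list"
  assume len: "Suc (length xs + length ys) = k"
  let ?i = "length xs" and ?c = "rotate_by k (xs @ 0 # ys) c n"
  \<comment> \<open>The position in \<open>c\<close> of the arrow that the rotation brings to place
    \<open>?i\<close>.\<close>
  let ?j = "?i + Suc n - k"
  have j: "?i \<le> n" "?j \<le> n" "?i < k" using len k by auto
  have C: "?c \<in> hom_chains D n" by (rule rotate_by_hom[OF c k])
  have ob: "obj ?c (Suc ?i) = obj c (Suc ?j)" "obj ?c ?i = obj c ?j"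
  proof -
    show "obj ?c ?i = obj c ?j"
      using j by (simp add: rotate_by_simps[OF c k])
    show "obj ?c (Suc ?i) = obj c (Suc ?j)"
    proof (cases "Suc ?i = k")
      case True
      then have "Suc ?j = Suc n" using k by simp
      then show ?thesis using True k by (simp add: rotate_by_simps[OF c k] hom_chains_wrap[OF c])
    next
      case False
      then show ?thesis using j k by (simp add: rotate_by_simps[OF c k] Suc_diff_le)
    qed
  qed
  have "(\<lambda>h. Act D (obj c (Suc ?j)) (obj c ?j) h (arr c ?j)) \<in>
      vect_hom (subsp UNIV) (subsp (Hom D (obj c (Suc ?j)) (obj c ?j)))"
    using j by (intro Act_linear_left hom_chainsD[OF c]) simp_all
  then have "clinear (\<lambda>a. K (set_arr ?c ?i (Act D (obj c (Suc ?j)) (obj c ?j) a (arr c ?j))))"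
    using chain_subspace[OF C j(1)]
    by (intro clinear_set_arr[OF K C j(1)]) (simp_all only: ob)
  also have "(\<lambda>a. K (set_arr ?c ?i (Act D (obj c (Suc ?j)) (obj c ?j) a (arr c ?j)))) =
      (\<lambda>a. K (rotate_by k (xs @ a # ys) c n))"
  proof
    fix a
    have "set_arr ?c ?i (Act D (obj c (Suc ?j)) (obj c ?j) a (arr c ?j)) = rotate_by k (xs @ a # ys) c n"
      by (rule chain_eqI[of _ n]) (use j in \<open>auto simp: rotate_by_simps[OF c k] nth_append nth_Cons'\<close>)
    then show "K (set_arr ?c ?i (Act D (obj c (Suc ?j)) (obj c ?j) a (arr c ?j))) = K (rotate_by k (xs @ a # ys) c n)"
      by simp
  qed
  finally show "clinear (\<lambda>a. K (rotate_by k (xs @ a # ys) c n))" .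
qed

lemma rotate_by_rotate:
  assumes c: "c \<in> hom_chains D n" and k: "k \<le> n" and len: "length hs = k"
  shows "rotate_by k hs (rotate_chain D g c) n = rotate_by (Suc k) (hs @ [g]) c n"
proof -
  have k': "k \<le> Suc n" "Suc k \<le> Suc n" using k by auto
  note s = rotate_by_simps[OF rotate_hom[OF c] k'(1)] rotate_by_simps[OF c k'(2)] rotate_simps[OF c]
  show ?thesis
  proof (rule chain_eqI[of _ n])
    fix j assume j: "j \<le> n"
    consider "j < k" | "j = k" | "k < j" by linarith
    then show "obj (rotate_by k hs (rotate_chain D g c) n) j = obj (rotate_by (Suc k) (hs @ [g]) c n) j"
      by cases (use j k in \<open>simp_all add: s\<close>)
    consider "j < k" | "j = k" | "k < j" by linarith
    then show "arr (rotate_by k hs (rotate_chain D g c) n) j = arr (rotate_by (Suc k) (hs @ [g]) c n) j"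
      by cases (use j k len in \<open>simp_all add: s nth_append hom_chains_wrap[OF c] Suc_diff_le\<close>)
  qed (simp_all add: s)
qed

text \<open>The \<open>k\<close> coactions collapse by coassociativity into one, whose left factor
  is split into \<open>k\<close> legs. The unfolded rotation is the one applied first to
  \<open>c\<close>, whose arrow ends up behind those moved later; since \<open>T\<close> reverses
  the legs, its parameter is the last leg, hence \<open>sweedler_snoc\<close>.\<close>

lemma rotated_funpow:
  assumes F: "multilinear D n F" and "k \<le> Suc n" and "c \<in> hom_chains D n"
  shows "(rotated n ^^ k) F m c =
    tensor_lift (\<lambda>a x. sweedler H k (T a) (\<lambda>hs. F x (rotate_by k hs c n))) (coact M m)"
  using assms(2,3)
proof (induction k arbitrary: m c)
  case 0
  have "rotate_by 0 [] c n = c"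
    by (rule chain_eqI[of _ n])
      (simp_all add: rotate_by_simps[OF 0(2)] hom_chains_length[OF 0(2)])
  then show ?case
    using coact_counit_lift[OF multilinear_clinear[OF F 0(2)]] by (simp add: counit_T)
next
  case (Suc k)
  note c = Suc.prems(2)
  let ?W = "\<lambda>b2 b1 x. sweedler H k b1 (\<lambda>hs. F x (rotate_by (Suc k) (hs @ [b2]) c n))"
  have mlin: "mlin (Suc k) (\<lambda>hs. F x (rotate_by (Suc k) hs c n))" for x
    by (rule mlin_rotate_by[OF multilinear_chain_linear[OF F] c Suc.prems(1)])
  have W': "clinear (\<lambda>b2. ?W b2 b1 x)" "clinear (\<lambda>b1. ?W b2 b1 x)" "clinear (\<lambda>x. ?W b2 b1 x)" for b1 b2 x
  proof -
    show "clinear (\<lambda>b2. ?W b2 b1 x)"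
      by (intro clinear_sweedler_fun mlinD[OF mlin, where ys = "[]"]) simp
    show "clinear (\<lambda>b1. ?W b2 b1 x)"
      using mlin_append_right[of k "[b2]" "\<lambda>hs. F x (rotate_by (Suc k) hs c n)"] mlin
      by (intro clinear_sweedler_arg) simp
    show "clinear (\<lambda>x. ?W b2 b1 x)"
      by (intro clinear_sweedler_fun multilinear_clinear[OF F] rotate_by_hom[OF c Suc.prems(1)])
  qed
  note W = W'[THEN clinear_comp]
  have "(rotated n ^^ Suc k) F m c =
      tensor_lift (\<lambda>a x. (rotated n ^^ k) F x (rotate_chain D (T a) c)) (coact M m)"
    by (simp add: rotated_def)
  also have "\<dots> = tensor_lift (\<lambda>a x. tensor_lift (\<lambda>b y. ?W (T a) (T b) y) (coact M x)) (coact M m)"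
    using Suc.prems by (simp add: Suc.IH rotate_hom rotate_by_rotate cong: sweedler_cong)
  also have "\<dots> = tensor_lift (\<lambda>a x. tensor_lift (\<lambda>a1 a2. ?W (T a1) (T a2) x) (\<Delta> a)) (coact M m)"
    by (rule coact_coassoc_lift[symmetric]) (intro clin W)+
  also have "\<dots> = tensor_lift (\<lambda>a x. tensor_lift (\<lambda>b1 b2. ?W b2 b1 x) (\<Delta> (T a))) (coact M m)"
    by (subst tensor_lift_comult_T, (intro clin W)+) (rule refl)
  also have "\<dots> = tensor_lift (\<lambda>a x. sweedler H (Suc k) (T a) (\<lambda>hs. F x (rotate_by (Suc k) hs c n))) (coact M m)"
    by (simp only: sweedler_snoc[OF mlin])
  finally show ?case .
qed

text \<open>After a full turn every arrow is back in place and T(m(-1)) acts diagonally. Balancing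
  carries it over to m(0), where stability absorbs it.\<close>

lemma rotated_cyclic:
  assumes F: "multilinear D n F" and bal: "balanced n F" and c: "c \<in> hom_chains D n"
  shows "(rotated n ^^ Suc n) F m c = F m c"
proof -
  have rot: "rotate_by (Suc n) hs c n = act_chain D hs c" for hs
    by (rule chain_eqI[of _ n]) (simp_all add: rotate_by_simps[OF c] act_chain_simps[OF c])
  have "(rotated n ^^ Suc n) F m c = tensor_lift (\<lambda>a x. F (ract M x (T a)) c) (coact M m)"
    unfolding rotated_funpow[OF F order_refl c] rot balancedD[OF bal c] ..
  also have "\<dots> = F m c"
    using linear_tensor_lift[OF multilinear_clinear[OF F c], of "\<lambda>a x. ract M x (T a)" "coact M m"]
    by (simp add: stable_T)
  finally show ?thesis .
qed

lemma rotated_merge_Suc: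
  assumes "c \<in> hom_chains D (Suc n)" "i < n"
  shows "rotated (Suc n) (\<lambda>m c. F m (merge D (Suc i) c)) m c = rotated n F m (merge D i c)"
  by (simp add: rotated_def merge_rotate[OF assms])

text \<open>The relation \<tau> \<tau> \<delta>_0 = \<delta>_n \<tau>. The two coactions supply two
  legs, one for each of the last two arrows; \<open>T\<close> puts the legs in the order in which
  the arrows are composed, so that \<open>Act_Comp\<close> reassembles the action on the
  composite.\<close>

lemma rotated_rotated_merge:
  assumes F: "multilinear D n F" and c: "c \<in> hom_chains D (Suc n)"
  shows "rotated (Suc n) (rotated (Suc n) (\<lambda>m c. F m (merge D 0 c))) m c = rotated n F m (merge D n c)"
proof -
  let ?F = "\<lambda>b1 b2 x. F x (merge D 0 (rotate_chain D b1 (rotate_chain D b2 c)))"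
  let ?X = "obj c 0" and ?Y = "obj c (Suc n)" and ?Z = "obj c n"
  have F': "multilinear D (Suc n) (\<lambda>m c. F m (merge D 0 c))"
    by (rule multilinear_comp[OF F multi_merge]) simp
  have lin': "clinear (\<lambda>b1. ?F b1 b2 x)" "clinear (\<lambda>b2. ?F b1 b2 x)" "clinear (\<lambda>x. ?F b1 b2 x)" for b1 b2 x
    using rotated_clinear[OF F' rotate_hom[OF c]]
      clinear_rotate[OF chain_linear_comp[OF multilinear_chain_linear[OF F'] multi_rotate Hom_subspace] c]
    by simp_all
  note lin = lin'[THEN clinear_comp]
  have merge: "tensor_lift (\<lambda>b1 b2. ?F b1 b2 x) (\<Delta> h) = F x (rotate_chain D h (merge D n c))" for x h
  proof -
    let ?C = "rotate_chain D h (merge D n c)"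
    let ?G = "\<lambda>b1 b2. Comp D ?X ?Y ?Z (Act D ?Y ?Z b1 (arr c n)) (Act D ?X ?Y b2 (arr c (Suc n)))"
    have mc: "merge D n c \<in> hom_chains D n" by (rule merge_hom[OF c order_refl])
    have ob: "?X \<in> Ob D" "?Y \<in> Ob D" "?Z \<in> Ob D"
      and ar: "arr c n \<in> Hom D ?Y ?Z" "arr c (Suc n) \<in> Hom D ?X ?Y"
      using hom_chains_arr[OF c, of n] hom_chains_arr[OF c, of "Suc n"] hom_chains_obj[OF c]
      by (simp_all add: hom_chains_wrap[OF c])
    have C: "?C \<in> hom_chains D n" "obj ?C (Suc 0) = ?X" "obj ?C 0 = ?Z" "length ?C = Suc n"
      by (simp_all add: rotate_hom[OF mc] rotate_simps[OF mc] merge_simps[OF c order_refl])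
    have "tensor_lift (\<lambda>b1 b2. ?F b1 b2 x) (\<Delta> h) = tensor_lift (\<lambda>b1 b2. F x (set_arr ?C 0 (?G b1 b2))) (\<Delta> h)"
    proof -
      have "merge D 0 (rotate_chain D b1 (rotate_chain D b2 c)) = set_arr ?C 0 (?G b1 b2)" for b1 b2
      proof (rule chain_eqI[of _ n])
        note s = merge_simps[OF rotate_hom[OF rotate_hom[OF c]]] rotate_simps[OF rotate_hom[OF c]]
          rotate_simps[OF c] rotate_simps[OF mc] merge_simps[OF c order_refl] C(4)
        fix k assume k: "k \<le> n"
        show "obj (merge D 0 (rotate_chain D b1 (rotate_chain D b2 c))) k = obj (set_arr ?C 0 (?G b1 b2)) k"
          by (cases k) (use k in \<open>simp_all add: s\<close>)
        show "arr (merge D 0 (rotate_chain D b1 (rotate_chain D b2 c))) k = arr (set_arr ?C 0 (?G b1 b2)) k"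
          by (cases k) (use k in \<open>simp_all add: s\<close>)
      qed (simp_all add: merge_simps[OF rotate_hom[OF rotate_hom[OF c]]] C(4))
      then show ?thesis by simp
    qed
    also have "\<dots> = F x (set_arr ?C 0 (tensor_lift ?G (\<Delta> h)))"
    proof (rule vect_hom_tensor_lift[where V = "Hom D ?X ?Z" and L = "\<lambda>f. F x (set_arr ?C 0 f)", symmetric])
      show "cvec.subspace (Hom D ?X ?Z)" using ob by (intro Hom_subspace)
      show "?G a b \<in> Hom D ?X ?Z" for a b using ob ar by (intro Comp_closed Act_closed)
      show "(\<lambda>f. F x (set_arr ?C 0 f)) \<in> vect_hom (subsp (Hom D ?X ?Z)) (subsp UNIV)"
        using chain_linear_vect_hom[OF multilinear_chain_linear[OF F] C(1), of 0] C chain_subspace[OF C(1), of 0]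
        by simp
    qed
    also have "tensor_lift ?G (\<Delta> h) = arr ?C 0"
      using ob ar by (simp add: Act_Comp[symmetric] rotate_simps[OF mc] merge_simps[OF c order_refl] hom_chains_wrap[OF c])
    finally show ?thesis
      by (simp add: set_arr_arr C(4))
  qed
  have "rotated (Suc n) (rotated (Suc n) (\<lambda>m c. F m (merge D 0 c))) m c =
      tensor_lift (\<lambda>a x. tensor_lift (\<lambda>b y. ?F (T b) (T a) y) (coact M x)) (coact M m)"
    by (simp add: rotated_def)
  also have "\<dots> = tensor_lift (\<lambda>a x. tensor_lift (\<lambda>a1 a2. ?F (T a2) (T a1) x) (\<Delta> a)) (coact M m)"
    by (rule coact_coassoc_lift[symmetric]) (intro clin lin)+
  also have "\<dots> = tensor_lift (\<lambda>a x. tensor_lift (\<lambda>b1 b2. ?F b1 b2 x) (\<Delta> (T a))) (coact M m)"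
    by (subst tensor_lift_comult_T, (intro clin lin)+) (rule refl)
  also have "\<dots> = rotated n F m (merge D n c)"
    by (simp add: merge rotated_def)
  finally show ?thesis .
qed

end

section \<open>Quotient spaces and total complexes\<close>

lemma vect_hom_closed: "f \<in> vect_hom (subsp V) (subsp W) \<Longrightarrow> x \<in> V \<Longrightarrow> f x \<in> W"
  and vect_hom_add: "f \<in> vect_hom (subsp V) (subsp W) \<Longrightarrow> x \<in> V \<Longrightarrow> y \<in> V \<Longrightarrow> f (x + y) = f x + f y"
  and vect_hom_scale: "f \<in> vect_hom (subsp V) (subsp W) \<Longrightarrow> x \<in> V \<Longrightarrow> f (a *\<^sub>C x) = a *\<^sub>C f x"
  by (simp_all add: vect_hom_subsp)

lemma vect_hom_0: "f \<in> vect_hom (subsp V) (subsp W) \<Longrightarrow> cvec.subspace V \<Longrightarrow> f 0 = 0"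
  using vect_hom_scale[of f V W 0 0] cvec.subspace_0[of V] by simp

lemma vect_hom_diff:
  assumes f: "f \<in> vect_hom (subsp V) (subsp W)" and V: "cvec.subspace V" and xy: "x \<in> V" "y \<in> V"
  shows "f (x - y) = f x - f y"
  using vect_hom_add[OF f cvec.subspace_diff[OF V xy] xy(2)] by (simp add: eq_diff_eq)

lemma vect_hom_minus:
  assumes f: "f \<in> vect_hom (subsp V) (subsp W)" and V: "cvec.subspace V" and x: "x \<in> V"
  shows "f (- x) = - f x"
  using vect_hom_diff[OF f V cvec.subspace_0[OF V] x] vect_hom_0[OF f V] by simp

lemma vect_hom_sum:
  assumes f: "f \<in> vect_hom (subsp V) (subsp W)" and V: "cvec.subspace V" and x: "\<And>i. i \<in> I \<Longrightarrow> x i \<in> V"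
  shows "f (\<Sum>i\<in>I. x i) = (\<Sum>i\<in>I. f (x i))"
  using x
  by (induction I rule: infinite_finite_induct)
    (simp_all add: vect_hom_0[OF f V] vect_hom_add[OF f] cvec.subspace_sum[OF V])

lemma vect_hom_lincomb:
  assumes f: "f \<in> vect_hom (subsp V) (subsp W)" and V: "cvec.subspace V" and x: "\<And>i. i \<in> I \<Longrightarrow> x i \<in> V"
  shows "f (\<Sum>i\<in>I. a i *\<^sub>C x i) = (\<Sum>i\<in>I. a i *\<^sub>C f (x i))"
  using x by (simp add: vect_hom_sum[OF f V] cvec.subspace_scale[OF V] vect_hom_scale[OF f])

lemma vect_homI:
  assumes "\<And>x. x \<in> V \<Longrightarrow> f x \<in> W" "\<And>x y. x \<in> V \<Longrightarrow> y \<in> V \<Longrightarrow> f (x + y) = f x + f y"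
    "\<And>a x. x \<in> V \<Longrightarrow> f (a *\<^sub>C x) = a *\<^sub>C f x"
  shows "f \<in> vect_hom (subsp V) (subsp W)"
  using assms by (simp add: vect_hom_subsp)

lemma vect_hom_lincomb_fun:
  assumes W: "cvec.subspace W" and f: "\<And>i. i \<in> I \<Longrightarrow> f i \<in> vect_hom (subsp V) (subsp W)"
  shows "(\<lambda>x. \<Sum>i\<in>I. a i *\<^sub>C f i x) \<in> vect_hom (subsp V) (subsp W)"
  using f
  by (intro vect_homI cvec.subspace_sum[OF W] cvec.subspace_scale[OF W])
    (auto simp: vect_hom_subsp scaleC_add_right sum.distrib cvec.scale_sum_right scaleC_scaleC mult.commute
      intro!: sum.cong)

section \<open>Quotients as complex vector spaces\<close>

lemma complex_field_ring: "cring complex_field"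
proof (rule cringI)
  show "abelian_group complex_field"
  proof (rule abelian_groupI)
    fix x assume "x \<in> carrier complex_field"
    show "\<exists>y\<in>carrier complex_field. y \<oplus>\<^bsub>complex_field\<^esub> x = \<zero>\<^bsub>complex_field\<^esub>"
      by (rule bexI[of _ "- x"]) (simp_all add: complex_field_def)
  qed (simp_all add: complex_field_def)
  show "comm_monoid complex_field"
    by (rule comm_monoidI) (simp_all add: complex_field_def)
qed (simp add: complex_field_def distrib_right)

lemma module_quotient_space:
  assumes V: "cvec.subspace V" and W: "cvec.subspace W"
  shows "module complex_field (quotient_space V W)"
proof (rule moduleI)
  have ops: "carrier (quotient_space V W) = (\<lambda>x. x +o W) ` V"
    "(x +o W) \<oplus>\<^bsub>quotient_space V W\<^esub> (y +o W) = (x + y) +o W"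
    "a \<odot>\<^bsub>quotient_space V W\<^esub> (x +o W) = (a *\<^sub>C x) +o W"
    "\<zero>\<^bsub>quotient_space V W\<^esub> = 0 +o W" for x y a
    by (simp_all add: quotient_space_def coset_add[OF W] coset_scale[OF W])
  show "cring complex_field"
    by (rule complex_field_ring)
  show "abelian_group (quotient_space V W)"
  proof (rule abelian_groupI)
    fix A assume "A \<in> carrier (quotient_space V W)"
    then obtain x where "x \<in> V" "A = x +o W" by (auto simp: ops)
    then show "\<exists>B\<in>carrier (quotient_space V W). B \<oplus>\<^bsub>quotient_space V W\<^esub> A = \<zero>\<^bsub>quotient_space V W\<^esub>"
      using cvec.subspace_neg[OF V]
      by (intro bexI[of _ "(- x) +o W"]) (auto simp: ops simp del: set_zero_plus)
  qed (auto simp: ops add_ac cvec.subspace_add[OF V] cvec.subspace_0[OF V] simp del: set_zero_plus)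
  fix a b A B
  assume "A \<in> carrier (quotient_space V W)" "B \<in> carrier (quotient_space V W)"
  then obtain x y where xy: "x \<in> V" "A = x +o W" "y \<in> V" "B = y +o W" by (auto simp: ops)
  show "a \<odot>\<^bsub>quotient_space V W\<^esub> A \<in> carrier (quotient_space V W)"
    using xy by (simp add: ops cvec.subspace_scale[OF V])
  show "a \<odot>\<^bsub>quotient_space V W\<^esub> (A \<oplus>\<^bsub>quotient_space V W\<^esub> B) =
      a \<odot>\<^bsub>quotient_space V W\<^esub> A \<oplus>\<^bsub>quotient_space V W\<^esub> a \<odot>\<^bsub>quotient_space V W\<^esub> B"
    using xy by (simp add: ops scaleC_add_right)
  show "(a \<oplus>\<^bsub>complex_field\<^esub> b) \<odot>\<^bsub>quotient_space V W\<^esub> A =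
      a \<odot>\<^bsub>quotient_space V W\<^esub> A \<oplus>\<^bsub>quotient_space V W\<^esub> b \<odot>\<^bsub>quotient_space V W\<^esub> A"
    using xy by (simp add: ops complex_field_def scaleC_add_left)
  show "(a \<otimes>\<^bsub>complex_field\<^esub> b) \<odot>\<^bsub>quotient_space V W\<^esub> A =
      a \<odot>\<^bsub>quotient_space V W\<^esub> (b \<odot>\<^bsub>quotient_space V W\<^esub> A)"
    using xy by (simp add: ops complex_field_def scaleC_scaleC)
  show "\<one>\<^bsub>complex_field\<^esub> \<odot>\<^bsub>quotient_space V W\<^esub> A = A"
    using xy by (simp add: ops complex_field_def scaleC_one)
qed

text \<open>The image of a coset of \<open>W\<close> may be only a part of a coset of
  \<open>W'\<close>; adding \<open>W'\<close> fills it up.\<close>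

lemma coset_image:
  assumes V: "cvec.subspace V" and W: "cvec.subspace W" and W': "cvec.subspace W'" and "W \<subseteq> V"
    and f: "f \<in> vect_hom (subsp V) (subsp V')" and fW: "f ` W \<subseteq> W'" and x: "x \<in> V"
  shows "f ` (x +o W) + W' = f x +o W'"
proof (intro equalityI subsetI)
  fix z assume "z \<in> f ` (x +o W) + W'"
  then obtain w w' where w: "w \<in> W" "w' \<in> W'" "z = f (x + w) + w'"
    by (auto simp: set_plus_def elt_set_plus_def)
  then have z: "z = f x + (f w + w')"
    using vect_hom_add[OF f x, of w] \<open>W \<subseteq> V\<close> by (auto simp: add.assoc)
  have "f w + w' \<in> W'"
    using w fW by (intro cvec.subspace_add[OF W']) auto
  then show "z \<in> f x +o W'"
    unfolding z elt_set_plus_def by blast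
next
  fix z assume "z \<in> f x +o W'"
  then show "z \<in> f ` (x +o W) + W'"
    using coset_mem[OF W, of x] by (auto simp: set_plus_def elt_set_plus_def)
qed

definition tot_map :: "(nat \<Rightarrow> nat \<Rightarrow> 'v::complex_vector \<Rightarrow> 'w::complex_vector) \<Rightarrow> nat \<Rightarrow> (nat \<Rightarrow> 'v) \<Rightarrow> nat \<Rightarrow> 'w"
  where "tot_map F n x = (\<lambda>p. if p \<le> n then F p (n - p) (x p) else 0)"

lemma tot_map_eq: "tot_cohomology_map E' F n A = tot_map F n ` A + tot_coboundaries E' n"
  by (simp add: tot_cohomology_map_def tot_map_def[abs_def])

section \<open>The total complex\<close>

locale dcomplex =
  fixes E :: "('v::complex_vector) bicomplex"
  assumes double_complex: "double_complex E"
begin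

lemma subspace_entry: "cvec.subspace (entry E p q)"
  and vert_hom: "vert E p q \<in> vect_hom (subsp (entry E p q)) (subsp (entry E p (Suc q)))"
  and horiz_hom: "horiz E p q \<in> vect_hom (subsp (entry E p q)) (subsp (entry E (Suc p) q))"
  and vert_vert: "x \<in> entry E p q \<Longrightarrow> vert E p (Suc q) (vert E p q x) = 0"
  and horiz_horiz: "x \<in> entry E p q \<Longrightarrow> horiz E (Suc p) q (horiz E p q x) = 0"
  and vert_horiz: "x \<in> entry E p q \<Longrightarrow> vert E (Suc p) q (horiz E p q x) = - horiz E p (Suc q) (vert E p q x)"
  using double_complex by (simp_all add: double_complex_def eq_neg_iff_add_eq_0)

lemma tot_entry: "x \<in> tot E n \<Longrightarrow> p \<le> n \<Longrightarrow> x p \<in> entry E p (n - p)"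
  and tot_beyond: "x \<in> tot E n \<Longrightarrow> n < p \<Longrightarrow> x p = 0"
  by (simp_all add: tot_def)

lemma subspace_tot: "cvec.subspace (tot E n)"
  unfolding cvec.subspace_def tot_def
  using subspace_entry by (auto simp: cvec.subspace_def scaleC_fun_def)

lemma tot_diff_0: "tot_diff E n x 0 = vert E 0 n (x 0)"
  and tot_diff_Suc: "tot_diff E n x (Suc p) =
    (if p < n then vert E (Suc p) (n - Suc p) (x (Suc p)) else 0) + (if p \<le> n then horiz E p (n - p) (x p) else 0)"
  by (simp_all add: tot_diff_def)

lemma tot_diff_hom: "tot_diff E n \<in> vect_hom (subsp (tot E n)) (subsp (tot E (Suc n)))"
proof (rule vect_homI)
  fix x assume x: "x \<in> tot E n"
  have "tot_diff E n x p \<in> entry E p (Suc n - p)" if p: "p \<le> Suc n" for p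
  proof (cases p)
    case 0
    then show ?thesis
      using vect_hom_closed[OF vert_hom[of 0 n] tot_entry[OF x, of 0, simplified]] by (simp add: tot_diff_0)
  next
    case (Suc r)
    have h: "horiz E r (n - r) (x r) \<in> entry E p (Suc n - p)"
      using vect_hom_closed[OF horiz_hom tot_entry[OF x, of r]] Suc p by simp
    show ?thesis
    proof (cases "r < n")
      case True
      then have "vert E p (n - p) (x p) \<in> entry E p (Suc (n - p))"
        using Suc by (intro vect_hom_closed[OF vert_hom tot_entry[OF x]]) simp
      moreover have "Suc (n - p) = Suc n - p" using True Suc by simp
      ultimately show ?thesis
        using Suc True h by (simp add: tot_diff_Suc cvec.subspace_add[OF subspace_entry])
    next
      case False
      then show ?thesis
        using Suc p h by (simp add: tot_diff_Suc)
    qed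
  qed
  then show "tot_diff E n x \<in> tot E (Suc n)"
    by (simp add: tot_def) (simp add: tot_diff_def)
next
  fix x y assume xy: "x \<in> tot E n" "y \<in> tot E n"
  show "tot_diff E n (x + y) = tot_diff E n x + tot_diff E n y"
  proof
    fix p
    show "tot_diff E n (x + y) p = (tot_diff E n x + tot_diff E n y) p"
      using vect_hom_add[OF vert_hom tot_entry[OF xy(1), of 0] tot_entry[OF xy(2), of 0]]
      by (cases p) (simp_all add: tot_diff_0 tot_diff_Suc vect_hom_add[OF vert_hom tot_entry[OF xy(1)] tot_entry[OF xy(2)]]
          vect_hom_add[OF horiz_hom tot_entry[OF xy(1)] tot_entry[OF xy(2)]])
  qed
next
  fix a x assume x: "x \<in> tot E n"
  show "tot_diff E n (a *\<^sub>C x) = a *\<^sub>C tot_diff E n x"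
  proof
    fix p
    show "tot_diff E n (a *\<^sub>C x) p = (a *\<^sub>C tot_diff E n x) p"
      using vect_hom_scale[OF vert_hom tot_entry[OF x, of 0]]
      by (cases p) (simp_all add: tot_diff_0 tot_diff_Suc scaleC_fun_def scaleC_add_right
          vect_hom_scale[OF vert_hom tot_entry[OF x]] vect_hom_scale[OF horiz_hom tot_entry[OF x]])
  qed
qed

lemma tot_diff_tot_diff:
  assumes x: "x \<in> tot E n"
  shows "tot_diff E (Suc n) (tot_diff E n x) = 0"
proof
  fix p
  show "tot_diff E (Suc n) (tot_diff E n x) p = 0 p"
  proof (cases p)
    case 0
    then show ?thesis
      using tot_entry[OF x, of 0] by (simp add: tot_diff_0 vert_vert)
  next
    case (Suc r)
    have z: "vert E p q 0 = 0" "horiz E p q 0 = 0" for p q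
      by (simp_all add: vect_hom_0[OF vert_hom subspace_entry] vect_hom_0[OF horiz_hom subspace_entry])
    have v: "vert E r (n - r) (x r) \<in> entry E r (Suc n - r)" if "r \<le> n"
      using vect_hom_closed[OF vert_hom tot_entry[OF x that]] that by (simp add: Suc_diff_le)
    have v': "vert E (Suc r) (n - Suc r) (x (Suc r)) \<in> entry E (Suc r) (n - r)" if "r < n"
      using vect_hom_closed[OF vert_hom tot_entry[OF x, of "Suc r"]] that by (simp add: Suc_diff_Suc)
    have h: "horiz E r (n - r) (x r) \<in> entry E (Suc r) (n - r)" if "r \<le> n"
      using vect_hom_closed[OF horiz_hom tot_entry[OF x that]] .
    \<comment> \<open>\<open>A\<close> and \<open>B\<close> evaluate the two summands of the
      component in column \<open>Suc r\<close>: each reduces to the same mixed term, with opposite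
      signs because the squares anticommute.\<close>
    have A: "vert E (Suc r) (n - r) (tot_diff E n x (Suc r)) = - horiz E r (Suc n - r) (vert E r (n - r) (x r))"
      if r: "r \<le> n"
    proof (cases "r < n")
      case True
      then have "vert E (Suc r) (n - r) (vert E (Suc r) (n - Suc r) (x (Suc r))) = 0"
        using vert_vert[OF tot_entry[OF x, of "Suc r"]] by (simp add: Suc_diff_Suc)
      then show ?thesis
        using True r vect_hom_add[OF vert_hom v' h] vert_horiz[OF tot_entry[OF x r]]
        by (simp add: tot_diff_Suc Suc_diff_le)
    next
      case False
      then show ?thesis
        using r vert_horiz[OF tot_entry[OF x r]] by (simp add: tot_diff_Suc Suc_diff_le)
    qed
    have B: "horiz E r (Suc n - r) (tot_diff E n x r) = horiz E r (Suc n - r) (vert E r (n - r) (x r))"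
      if r: "r \<le> n"
    proof (cases r)
      case 0
      then show ?thesis by (simp add: tot_diff_0)
    next
      case (Suc s)
      have hs: "horiz E s (n - s) (x s) \<in> entry E r (Suc n - r)"
        using vect_hom_closed[OF horiz_hom tot_entry[OF x, of s]] Suc r by simp
      have "horiz E r (Suc n - r) (horiz E s (n - s) (x s)) = 0"
        using horiz_horiz[OF tot_entry[OF x, of s]] Suc r by simp
      then show ?thesis
        using Suc r vect_hom_add[OF horiz_hom v[OF r] hs] by (simp add: tot_diff_Suc)
    qed
    show ?thesis
    proof (cases "r \<le> n")
      case True
      then show ?thesis
        using A B Suc by (simp add: tot_diff_Suc[of "Suc n"] less_Suc_eq_le)
    next
      case False
      show ?thesis
      proof (cases "r = Suc n")
        case True
        have "horiz E (Suc n) 0 (horiz E n 0 (x n)) = 0"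
          using horiz_horiz[OF tot_entry[OF x, of n]] by simp
        then show ?thesis using True Suc by (simp add: tot_diff_Suc)
      next
        case r: False
        then show ?thesis using False Suc by (simp add: tot_diff_Suc)
      qed
    qed
  qed
qed

lemma subspace_cocycles: "cvec.subspace (tot_cocycles E n)"
  unfolding cvec.subspace_def tot_cocycles_def
  using subspace_tot[of n] vect_hom_add[OF tot_diff_hom[of n]] vect_hom_scale[OF tot_diff_hom[of n]]
    vect_hom_0[OF tot_diff_hom[of n] subspace_tot]
  by (auto simp: cvec.subspace_def)

lemma subspace_coboundaries: "cvec.subspace (tot_coboundaries E n)"
proof (cases n)
  case (Suc k)
  have "cvec.subspace (tot_diff E k ` tot E k)"
    unfolding cvec.subspace_def
  proof (intro conjI ballI allI)
    show "0 \<in> tot_diff E k ` tot E k"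
      using vect_hom_0[OF tot_diff_hom[of k] subspace_tot] cvec.subspace_0[OF subspace_tot[of k]] by force
    show "u + v \<in> tot_diff E k ` tot E k" if uv: "u \<in> tot_diff E k ` tot E k" "v \<in> tot_diff E k ` tot E k" for u v
    proof -
      from uv obtain x y where "x \<in> tot E k" "y \<in> tot E k" "u = tot_diff E k x" "v = tot_diff E k y" by blast
      then show ?thesis
        using vect_hom_add[OF tot_diff_hom[of k], of x y, symmetric] cvec.subspace_add[OF subspace_tot[of k], of x y] by simp
    qed
    show "a *\<^sub>C u \<in> tot_diff E k ` tot E k" if "u \<in> tot_diff E k ` tot E k" for a u
    proof -
      from that obtain x where "x \<in> tot E k" "u = tot_diff E k x" by blast
      then show ?thesis
        using vect_hom_scale[OF tot_diff_hom[of k], of x, symmetric] cvec.subspace_scale[OF subspace_tot[of k], of x] by simp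
    qed
  qed
  then show ?thesis using Suc by (simp add: tot_coboundaries_def)
qed (simp add: tot_coboundaries_def)

lemma coboundaries_subset: "tot_coboundaries E n \<subseteq> tot_cocycles E n"
proof (cases n)
  case 0
  then show ?thesis
    using cvec.subspace_0[OF subspace_cocycles[of 0]] by (simp add: tot_coboundaries_def)
next
  case (Suc k)
  then show ?thesis
    using tot_diff_tot_diff vect_hom_closed[OF tot_diff_hom[of k]]
    by (auto simp: tot_coboundaries_def tot_cocycles_def)
qed

lemma module_tot_cohomology: "module complex_field (tot_cohomology E n)"
  unfolding tot_cohomology_def by (rule module_quotient_space[OF subspace_cocycles subspace_coboundaries])

lemma tot_diff_eq:
  assumes "p \<le> n"
  shows "tot_diff E n x p = vert E p (n - p) (x p) + (if p = 0 then 0 else horiz E (p - 1) (n - (p - 1)) (x (p - 1)))"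
  using assms by (simp add: tot_diff_def)

text \<open>
  Exact columns make the total complex exact: a primitive is built column by column, the
  next component killing what is left of the cocycle in that column.
\<close>

lemma cocycles_exact:
  assumes exact: "\<And>p q x. x \<in> entry E p q \<Longrightarrow> vert E p q x = 0 \<Longrightarrow>
      (if q = 0 then x = 0 else \<exists>y\<in>entry E p (q - 1). x = vert E p (q - 1) y)"
  shows "tot_cocycles E n \<subseteq> tot_coboundaries E n"
proof
  fix z assume "z \<in> tot_cocycles E n"
  then have z: "z \<in> tot E n" and "tot_diff E n z = 0" by (simp_all add: tot_cocycles_def)
  then have dz: "vert E p (n - p) (z p) = - (if p = 0 then 0 else horiz E (p - 1) (n - (p - 1)) (z (p - 1)))"
    if "p \<le> n" for p
    using tot_diff_eq[OF that, of z] by (simp add: eq_neg_iff_add_eq_0)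
  \<comment> \<open>The contribution of column \<open>p - 1\<close> to column \<open>p\<close>. A
    primitive \<open>y\<close> has total degree \<open>n - 1\<close>, so \<open>y (p - 1)\<close>
    sits in row \<open>n - p\<close>.\<close>
  define R where "R y p = (if p = 0 then 0 else horiz E (p - 1) (n - p) (y (p - 1)))" for y p
  \<comment> \<open>What the earlier columns leave of \<open>z\<close> in column \<open>k\<close> is
    a vertical cocycle: the cocycle equation for \<open>z\<close> expresses its vertical
    differential through \<open>z\<close> in column \<open>k - 1\<close>, and there \<open>z\<close>
    is already resolved.\<close>
  have rest: "R y k \<in> entry E k (n - k) \<and> vert E k (n - k) (R y k) = vert E k (n - k) (z k)"
    if k: "k \<le> n" and y: "\<And>p. p < k \<Longrightarrow> y p \<in> entry E p (n - Suc p)"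
      "\<And>p. p < k \<Longrightarrow> vert E p (n - Suc p) (y p) + R y p = z p" for y k
  proof (cases k)
    case 0
    then show ?thesis
      using cvec.subspace_0[OF subspace_entry] dz[of 0] vect_hom_0[OF vert_hom subspace_entry]
      by (simp add: R_def)
  next
    case (Suc r)
    then have n: "n - r = Suc (n - k)" "n - Suc r = n - k" "r < k" using k by auto
    note yr = y(1)[OF n(3), unfolded n(2)] and zr = y(2)[OF n(3), unfolded n(2)]
    have Rr: "R y r \<in> entry E r (n - r) \<and> horiz E r (n - r) (R y r) = 0"
    proof (cases r)
      case 0
      then show ?thesis
        using cvec.subspace_0[OF subspace_entry] vect_hom_0[OF horiz_hom subspace_entry] by (simp add: R_def)
    next
      case (Suc s)
      then have "y s \<in> entry E s (n - r)" using y(1)[of s] n(3) by simp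
      then show ?thesis
        using Suc vect_hom_closed[OF horiz_hom] horiz_horiz by (simp add: R_def)
    qed
    have vy: "vert E r (n - k) (y r) \<in> entry E r (n - r)"
      using vect_hom_closed[OF vert_hom yr] n(1) by simp
    have "horiz E r (n - r) (z r) = horiz E r (n - r) (vert E r (n - k) (y r))"
      unfolding zr[symmetric] using vect_hom_add[OF horiz_hom vy] Rr by simp
    moreover have "vert E k (n - k) (horiz E r (n - k) (y r)) = - horiz E r (n - r) (vert E r (n - k) (y r))"
      using vert_horiz[OF yr] Suc n(1) by simp
    moreover have "vert E k (n - k) (z k) = - horiz E r (n - r) (z r)"
      using dz[of k] Suc k by simp
    moreover have "R y k = horiz E r (n - k) (y r)" "R y k \<in> entry E k (n - k)"
      using Suc vect_hom_closed[OF horiz_hom yr] by (simp_all add: R_def)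
    ultimately show ?thesis by simp
  qed
  have vert_rest: "z k - R y k \<in> entry E k (n - k) \<and> vert E k (n - k) (z k - R y k) = 0"
    if "k \<le> n" "\<And>p. p < k \<Longrightarrow> y p \<in> entry E p (n - Suc p)"
      "\<And>p. p < k \<Longrightarrow> vert E p (n - Suc p) (y p) + R y p = z p" for y k
    using rest[OF that] tot_entry[OF z that(1)]
    by (simp add: vect_hom_diff[OF vert_hom subspace_entry] cvec.subspace_diff[OF subspace_entry])
  have "\<exists>y. (\<forall>p<k. y p \<in> entry E p (n - Suc p) \<and> vert E p (n - Suc p) (y p) + R y p = z p)" if "k \<le> n" for k
    using that
  proof (induction k)
    case 0
    show ?case by simp
  next
    case (Suc k)
    then obtain y where y: "\<And>p. p < k \<Longrightarrow> y p \<in> entry E p (n - Suc p)"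
      "\<And>p. p < k \<Longrightarrow> vert E p (n - Suc p) (y p) + R y p = z p" by auto
    have "\<exists>u\<in>entry E k (n - Suc k). z k - R y k = vert E k (n - Suc k) u"
      using vert_rest[OF _ y, of k] exact[of "z k - R y k" k "n - k"] Suc.prems by simp
    then obtain u where u: "u \<in> entry E k (n - Suc k)" "z k = vert E k (n - Suc k) u + R y k"
      by (auto simp: diff_eq_eq)
    define y' where "y' p = (if p = k then u else y p)" for p
    have "R y' p = R y p" if "p \<le> k" for p
      using that by (auto simp: R_def y'_def)
    moreover have "y' k = u" "\<And>p. p < k \<Longrightarrow> y' p = y p"
      by (simp_all add: y'_def)
    ultimately show ?case
      using y u by (intro exI[of _ y']) (auto simp: less_Suc_eq)
  qed
  from this[OF order_refl] obtain y where y: "\<And>p. p < n \<Longrightarrow> y p \<in> entry E p (n - Suc p)"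
    "\<And>p. p < n \<Longrightarrow> vert E p (n - Suc p) (y p) + R y p = z p" by auto
  \<comment> \<open>The last column is met in row 0, where exactness means injectivity: the
    remainder is zero and no further component has to be chosen.\<close>
  have last: "z n = R y n"
    using vert_rest[OF order_refl y] exact[of "z n - R y n" n 0] by simp
  show "z \<in> tot_coboundaries E n"
  proof (cases n)
    case 0
    have "z p = 0" for p
      using last tot_beyond[OF z] 0 by (cases p) (simp_all add: R_def)
    then show ?thesis using 0 by (auto simp: tot_coboundaries_def)
  next
    case (Suc k)
    define w where "w p = (if p < n then y p else 0)" for p
    have w: "w \<in> tot E k"
      using y(1) Suc by (auto simp: tot_def w_def)
    have "tot_diff E k w p = z p" for p
    proof -
      consider "p < n" | "p = n" | "n < p" by linarith
      then show ?thesis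
      proof cases
        case 1
        then show ?thesis
          using y(2)[OF 1] Suc by (cases p) (simp_all add: tot_diff_0 tot_diff_Suc w_def R_def)
      next
        case 2
        then show ?thesis
          using last Suc by (simp add: tot_diff_Suc w_def R_def)
      next
        case 3
        then show ?thesis
          using Suc tot_beyond[OF z] by (simp add: tot_diff_def)
      qed
    qed
    then have "z = tot_diff E k w" by auto
    then show ?thesis using w Suc by (simp add: tot_coboundaries_def)
  qed
qed

end

section \<open>Morphisms of double complexes and their effect on cohomology\<close>

locale dcomplex_morphism =
  E: dcomplex E + E': dcomplex E' for E :: "('v::complex_vector) bicomplex" and E' :: "('w::complex_vector) bicomplex" +
  fixes F :: "nat \<Rightarrow> nat \<Rightarrow> 'v \<Rightarrow> 'w"
  assumes F_hom: "F p q \<in> vect_hom (subsp (entry E p q)) (subsp (entry E' p q))"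
    and F_vert: "x \<in> entry E p q \<Longrightarrow> F p (Suc q) (vert E p q x) = vert E' p q (F p q x)"
    and F_horiz: "x \<in> entry E p q \<Longrightarrow> F (Suc p) q (horiz E p q x) = horiz E' p q (F p q x)"
begin

lemma morphism: "double_complex_morphism E E' F"
  unfolding double_complex_morphism_def
  using E.double_complex E'.double_complex F_hom F_vert F_horiz by simp

lemma tot_map_hom: "tot_map F n \<in> vect_hom (subsp (tot E n)) (subsp (tot E' n))"
proof (rule vect_homI)
  show "tot_map F n x \<in> tot E' n" if "x \<in> tot E n" for x
    using that vect_hom_closed[OF F_hom E.tot_entry] by (simp add: tot_def tot_map_def)
  show "tot_map F n (x + y) = tot_map F n x + tot_map F n y" if "x \<in> tot E n" "y \<in> tot E n" for x y
    using that vect_hom_add[OF F_hom E.tot_entry E.tot_entry] by (auto simp: tot_map_def fun_eq_iff)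
  show "tot_map F n (a *\<^sub>C x) = a *\<^sub>C tot_map F n x" if "x \<in> tot E n" for a x
    using that vect_hom_scale[OF F_hom E.tot_entry] by (auto simp: tot_map_def fun_eq_iff scaleC_fun_def)
qed

lemma tot_map_diff:
  assumes x: "x \<in> tot E n"
  shows "tot_map F (Suc n) (tot_diff E n x) = tot_diff E' n (tot_map F n x)"
proof
  fix p
  show "tot_map F (Suc n) (tot_diff E n x) p = tot_diff E' n (tot_map F n x) p"
  proof (cases p)
    case 0
    then show ?thesis
      using F_vert[OF E.tot_entry[OF x, of 0]] by (simp add: E.tot_diff_0 E'.tot_diff_0 tot_map_def)
  next
    case (Suc r)
    show ?thesis
    proof (cases "r \<le> n")
      case True
      have h: "horiz E r (n - r) (x r) \<in> entry E (Suc r) (n - r)"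
        by (rule vect_hom_closed[OF E.horiz_hom E.tot_entry[OF x True]])
      have v: "vert E (Suc r) (n - Suc r) (x (Suc r)) \<in> entry E (Suc r) (n - r)" if "r < n"
        using vect_hom_closed[OF E.vert_hom E.tot_entry[OF x, of "Suc r"]] that by (simp add: Suc_diff_Suc)
      have Fv: "F (Suc r) (n - r) (vert E (Suc r) (n - Suc r) (x (Suc r))) =
          vert E' (Suc r) (n - Suc r) (F (Suc r) (n - Suc r) (x (Suc r)))" if "r < n"
        using F_vert[OF E.tot_entry[OF x, of "Suc r"]] that by (simp add: Suc_diff_Suc)
      show ?thesis
        using Suc True vect_hom_add[OF F_hom v h] Fv F_horiz[OF E.tot_entry[OF x True]]
        by (cases "r < n") (simp_all add: E.tot_diff_Suc E'.tot_diff_Suc tot_map_def)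
    next
      case False
      then show ?thesis using Suc by (simp add: tot_diff_def tot_map_def)
    qed
  qed
qed

lemma tot_map_cocycles: "x \<in> tot_cocycles E n \<Longrightarrow> tot_map F n x \<in> tot_cocycles E' n"
proof -
  assume "x \<in> tot_cocycles E n"
  then have x: "x \<in> tot E n" "tot_diff E n x = 0" by (simp_all add: tot_cocycles_def)
  then show ?thesis
    using tot_map_diff[OF x(1)] vect_hom_closed[OF tot_map_hom x(1)] vect_hom_0[OF tot_map_hom E.subspace_tot]
    by (simp add: tot_cocycles_def)
qed

lemma tot_map_coboundaries: "tot_map F n ` tot_coboundaries E n \<subseteq> tot_coboundaries E' n"
proof (cases n)
  case 0
  then show ?thesis
    using vect_hom_0[OF tot_map_hom E.subspace_tot, of 0] by (simp add: tot_coboundaries_def)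
next
  case (Suc k)
  then show ?thesis
    using tot_map_diff vect_hom_closed[OF tot_map_hom[of k]] by (auto simp: tot_coboundaries_def)
qed

lemma tot_map_cocycles_hom: "tot_map F n \<in> vect_hom (subsp (tot_cocycles E n)) (subsp (tot_cocycles E' n))"
  using tot_map_hom[of n] tot_map_cocycles by (simp add: vect_hom_subsp tot_cocycles_def)

lemma tot_cohomology_map_coset:
  assumes "x \<in> tot_cocycles E n"
  shows "tot_cohomology_map E' F n (x +o tot_coboundaries E n) = tot_map F n x +o tot_coboundaries E' n"
  unfolding tot_map_eq
  by (rule coset_image[OF E.subspace_cocycles E.subspace_coboundaries E'.subspace_coboundaries
        E.coboundaries_subset tot_map_cocycles_hom tot_map_coboundaries assms])

lemma tot_cohomology_map_hom: "tot_cohomology_map E' F n \<in> vect_hom (tot_cohomology E n) (tot_cohomology E' n)"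
proof -
  have ops: "carrier (quotient_space V W) = (\<lambda>x. x +o W) ` V"
    "(x +o W) \<oplus>\<^bsub>quotient_space V W\<^esub> (y +o W) = (x + y) +o W"
    "a \<odot>\<^bsub>quotient_space V W\<^esub> (x +o W) = (a *\<^sub>C x) +o W"
    if "cvec.subspace W" for a and V W :: "'d::complex_vector set" and x y
    using that by (simp_all add: quotient_space_def coset_add coset_scale)
  note s = ops[OF E.subspace_coboundaries] ops[OF E'.subspace_coboundaries] tot_cohomology_map_coset
  show ?thesis
    unfolding tot_cohomology_def vect_hom_def
    using tot_map_cocycles vect_hom_add[OF tot_map_cocycles_hom] vect_hom_scale[OF tot_map_cocycles_hom]
      cvec.subspace_add[OF E.subspace_cocycles] cvec.subspace_scale[OF E.subspace_cocycles]
    by (auto simp: s)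
qed

end

section \<open>Cocyclic modules\<close>

definition alt :: "nat \<Rightarrow> 'v::complex_vector \<Rightarrow> 'v"
  where "alt i x = (-1) ^ i *\<^sub>C x"

lemma alt_0 [simp]: "alt 0 x = x"
  and alt_Suc: "alt (Suc i) x = - alt i x"
  and alt_alt: "alt i (alt j x) = alt (i + j) x"
  and alt_zero [simp]: "alt i 0 = 0"
  and alt_minus: "alt i (- x) = - alt i x"
  by (simp_all add: alt_def scaleC_one power_add)

lemma alt_even: "even k \<Longrightarrow> alt k x = x"
  by (simp add: alt_def scaleC_one)

lemma alt_sum: "alt k (\<Sum>i\<in>I. f i) = (\<Sum>i\<in>I. alt k (f i))"
  by (simp add: alt_def cvec.scale_sum_right)

lemma sum_apply: "(\<Sum>i\<in>I. f i) A = (\<Sum>i\<in>I. f i A)"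
  for f :: "'i \<Rightarrow> 'x \<Rightarrow> 'v::comm_monoid_add"
  by (induction I rule: infinite_finite_induct) simp_all

lemma alt_apply: "alt i \<phi> A = alt i (\<phi> A)"
  by (simp add: alt_def scaleC_fun_def)

lemma vect_hom_alt_sum:
  assumes "f \<in> vect_hom (subsp V) (subsp W)" "cvec.subspace V" "\<And>i. i \<in> I \<Longrightarrow> x i \<in> V"
  shows "f (\<Sum>i\<in>I. alt (k i) (x i)) = (\<Sum>i\<in>I. alt (k i) (f (x i)))"
  unfolding alt_def by (rule vect_hom_lincomb[OF assms])

text \<open>The terms with i < j and those with j \<le> i cancel in pairs under (j, i) -> (i, j -
  1), which changes the parity of the sum of the indices. The bound \<open>N\<close> is
  \<open>n + 1\<close> for \<open>b\<close> and \<open>n\<close> for \<open>b'\<close>.\<close>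

lemma alternating_double_sum:
  fixes A :: "nat \<Rightarrow> nat \<Rightarrow> 'v::complex_vector"
  assumes A: "\<And>i j. i \<le> j \<Longrightarrow> j \<le> N \<Longrightarrow> A (Suc j) i = A i j"
  shows "(\<Sum>j\<le>Suc N. \<Sum>i\<le>N. alt (j + i) (A j i)) = 0"
proof -
  let ?P = "{(j, i). j \<le> Suc N \<and> i \<le> N \<and> i < j}" and ?Q = "{(j, i). j \<le> Suc N \<and> i \<le> N \<and> j \<le> i}"
  let ?f = "\<lambda>(j, i). alt (j + i) (A j i)"
  have fin: "finite ?P" "finite ?Q"
    by (rule finite_subset[of _ "{..Suc N} \<times> {..N}"]; auto)+
  have "(\<Sum>j\<le>Suc N. \<Sum>i\<le>N. alt (j + i) (A j i)) = sum ?f ({..Suc N} \<times> {..N})"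
    by (simp only: sum.cartesian_product)
  also have "{..Suc N} \<times> {..N} = ?P \<union> ?Q" by auto
  also have "sum ?f (?P \<union> ?Q) = sum ?f ?P + sum ?f ?Q"
    by (rule sum.union_disjoint[OF fin]) auto
  also have "sum ?f ?P = (\<Sum>p\<in>?Q. - ?f p)"
  proof (rule sum.reindex_bij_witness[where i = "\<lambda>(i, j). (Suc j, i)" and j = "\<lambda>(j, i). (i, j - 1)"])
    fix p assume p: "p \<in> ?P"
    then obtain j i where ji: "p = (Suc j, i)" "i \<le> j" "j \<le> N"
      by (cases p; cases "fst p") auto
    then show "- ?f ((\<lambda>(j, i). (i, j - 1)) p) = ?f p"
      by (simp add: A alt_Suc add.commute)
    show "(\<lambda>(i, j). (Suc j, i)) ((\<lambda>(j, i). (i, j - 1)) p) = p" using ji by simp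
    show "(\<lambda>(j, i). (i, j - 1)) p \<in> ?Q" using ji by simp
  qed auto
  also have "\<dots> + sum ?f ?Q = 0"
    by (simp add: sum_negf)
  finally show ?thesis .
qed

text \<open>The bookkeeping of a simplicial homotopy. \<open>A j i\<close> stands for the
  \<open>j\<close>-th coface evaluated on the \<open>i\<close>-th insertion, \<open>B i j\<close>
  for the \<open>j\<close>-th coface of the \<open>i\<close>-th homotopy operator. Away from the
  diagonals j = i and j = i + 1 the two cancel; along them the sum telescopes and leaves its two
  ends.\<close>

lemma homotopy_double_sum:
  fixes A B :: "nat \<Rightarrow> nat \<Rightarrow> 'v::complex_vector"
  assumes less: "\<And>i j. j \<le> i \<Longrightarrow> i < n \<Longrightarrow> A j (Suc i) = B i j"
    and greater: "\<And>i j. i < j \<Longrightarrow> j \<le> n \<Longrightarrow> A (Suc j) i = B i j"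
    and diag: "\<And>i. i < n \<Longrightarrow> A (Suc i) i = A (Suc i) (Suc i)"
  shows "(\<Sum>i\<le>n. \<Sum>j\<le>Suc n. alt (i + j) (A j i)) + (\<Sum>j\<le>n. \<Sum>i<n. alt (i + j) (B i j)) = A 0 0 - A (Suc n) n"
proof -
  let ?f = "\<lambda>(i, j). alt (i + j) (A j i)" and ?g = "\<lambda>(i, j). alt (i + j) (B i j)"
  let ?L = "{(i, j). i \<le> n \<and> j < i}" and ?G = "{(i, j). j \<le> Suc n \<and> Suc i < j}"
  let ?D = "{(i, j). i \<le> n \<and> (j = i \<or> j = Suc i)}"
  let ?L' = "{(i, j). i < n \<and> j \<le> i}" and ?G' = "{(i, j). j \<le> n \<and> i < j}"
  have fin: "finite ?L" "finite ?G" "finite ?D" "finite ?L'" "finite ?G'"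
    by (rule finite_subset[of _ "{..Suc n} \<times> {..Suc n}"]; auto)+
  have *: "(\<Sum>i\<le>n. \<Sum>j\<le>Suc n. alt (i + j) (A j i)) =
      (\<Sum>p\<in>?L'. - ?g p) + (\<Sum>p\<in>?G'. - ?g p) + (A 0 0 - A (Suc n) n)"
  proof -
    have "(\<Sum>i\<le>n. \<Sum>j\<le>Suc n. alt (i + j) (A j i)) = sum ?f ({..n} \<times> {..Suc n})"
      by (simp only: sum.cartesian_product)
    also have "{..n} \<times> {..Suc n} = (?L \<union> ?G) \<union> ?D" by auto
    also have "sum ?f ((?L \<union> ?G) \<union> ?D) = sum ?f (?L \<union> ?G) + sum ?f ?D"
      using fin by (intro sum.union_disjoint) auto
    also have "sum ?f (?L \<union> ?G) = sum ?f ?L + sum ?f ?G"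
      using fin by (intro sum.union_disjoint) auto
    also have "sum ?f ?L = (\<Sum>p\<in>?L'. - ?g p)"
      by (rule sum.reindex_bij_witness[where i = "\<lambda>(i, j). (Suc i, j)" and j = "\<lambda>(i, j). (i - 1, j)"])
        (auto simp: less[symmetric] alt_Suc gr0_conv_Suc dest!: less_imp_Suc_add)
    also have "sum ?f ?G = (\<Sum>p\<in>?G'. - ?g p)"
      by (rule sum.reindex_bij_witness[where i = "\<lambda>(i, j). (i, Suc j)" and j = "\<lambda>(i, j). (i, j - 1)"])
        (auto simp: greater[symmetric] alt_Suc gr0_conv_Suc dest!: less_imp_Suc_add)
    also have "sum ?f ?D = A 0 0 - A (Suc n) n"
    proof -
      have "sum ?f ?D = (\<Sum>i\<le>n. A i i) - (\<Sum>i\<le>n. A (Suc i) i)"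
      proof -
        have D: "?D = (\<lambda>i. (i, i)) ` {..n} \<union> (\<lambda>i. (i, Suc i)) ` {..n}" by auto
        have "sum ?f ?D = sum ?f ((\<lambda>i. (i, i)) ` {..n}) + sum ?f ((\<lambda>i. (i, Suc i)) ` {..n})"
          unfolding D by (rule sum.union_disjoint) auto
        then show ?thesis
          by (simp add: sum.reindex inj_on_def alt_Suc alt_even sum_negf)
      qed
      also have "(\<Sum>i\<le>n. A (Suc i) i) = (\<Sum>i<n. A (Suc i) (Suc i)) + A (Suc n) n"
        by (simp add: diag atMost_Suc lessThan_Suc_atMost[symmetric])
      also have "(\<Sum>i\<le>n. A i i) = A 0 0 + (\<Sum>i<n. A (Suc i) (Suc i))"
        by (simp only: lessThan_Suc_atMost[symmetric] sum.lessThan_Suc_shift)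
      finally show ?thesis by simp
    qed
    finally show ?thesis .
  qed
  have "(\<Sum>j\<le>n. \<Sum>i<n. alt (i + j) (B i j)) = (\<Sum>i<n. \<Sum>j\<le>n. alt (i + j) (B i j))"
    by (rule sum.swap)
  also have "\<dots> = sum ?g ({..<n} \<times> {..n})"
    by (simp only: sum.cartesian_product)
  also have "{..<n} \<times> {..n} = ?L' \<union> ?G'" by auto
  also have "sum ?g (?L' \<union> ?G') = sum ?g ?L' + sum ?g ?G'"
    using fin by (intro sum.union_disjoint) auto
  finally show ?thesis unfolding * by (simp add: sum_negf)
qed

text \<open>Semifunctors respect cofaces and cyclic operators, and the bicomplex is made of these.
  The last coface is determined by \<open>d_last\<close>, so the relations required concern
  compositions inside a chain, and those with the last coface are derived below.\<close>

locale cocyclic =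
  fixes E :: "nat \<Rightarrow> 'v::complex_vector set" and d :: "nat \<Rightarrow> nat \<Rightarrow> 'v \<Rightarrow> 'v" and t :: "nat \<Rightarrow> 'v \<Rightarrow> 'v"
  assumes subspace_E: "cvec.subspace (E n)"
    and d_hom: "i \<le> Suc n \<Longrightarrow> d n i \<in> vect_hom (subsp (E n)) (subsp (E (Suc n)))"
    and t_hom: "t n \<in> vect_hom (subsp (E n)) (subsp (E n))"
    and d_d_inner: "i \<le> j \<Longrightarrow> j \<le> n \<Longrightarrow> x \<in> E n \<Longrightarrow> d (Suc n) (Suc j) (d n i x) = d (Suc n) i (d n j x)"
    and t_d_inner: "i < n \<Longrightarrow> x \<in> E n \<Longrightarrow> t (Suc n) (d n (Suc i) x) = d n i (t n x)"
    and t_t_d: "x \<in> E n \<Longrightarrow> t (Suc n) (t (Suc n) (d n 0 x)) = d n n (t n x)"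
    and d_last: "x \<in> E n \<Longrightarrow> d n (Suc n) x = t (Suc n) (d n 0 x)"
    and t_cyclic: "x \<in> E n \<Longrightarrow> (t n ^^ Suc n) x = x"
begin

lemma d_closed: "i \<le> Suc n \<Longrightarrow> x \<in> E n \<Longrightarrow> d n i x \<in> E (Suc n)"
  by (rule vect_hom_closed[OF d_hom])

lemma t_closed: "x \<in> E n \<Longrightarrow> t n x \<in> E n"
  by (rule vect_hom_closed[OF t_hom])

lemma alt_closed: "x \<in> E n \<Longrightarrow> alt k x \<in> E n"
  unfolding alt_def by (rule cvec.subspace_scale[OF subspace_E])

lemma t_d: "i \<le> n \<Longrightarrow> x \<in> E n \<Longrightarrow> t (Suc n) (d n (Suc i) x) = d n i (t n x)"
  by (cases "i = n") (simp_all add: t_d_inner d_last t_t_d)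

text \<open>The new case is \<open>j = n + 1\<close>: writing the last coface as t d_0, the inner
  relations move d_0 past d_i and \<open>t_d\<close> brings \<open>t\<close> inside. For
  \<open>i = n + 1\<close> the inner coface is itself t d_0, and \<open>t_t_d\<close>
  finishes.\<close>

lemma d_d:
  assumes ij: "i \<le> j" "j \<le> Suc n" and x: "x \<in> E n"
  shows "d (Suc n) (Suc j) (d n i x) = d (Suc n) i (d n j x)"
proof (cases "j \<le> n")
  case True
  then show ?thesis using ij x by (simp add: d_d_inner)
next
  case False
  then have j: "j = Suc n" using ij by simp
  have "d (Suc n) (Suc (Suc n)) (d n i x) = t (Suc (Suc n)) (d (Suc n) 0 (d n i x))"
    using ij j x by (intro d_last d_closed) simp_all
  also have "\<dots> = d (Suc n) i (t (Suc n) (d n 0 x))"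
  proof (cases "i \<le> n")
    case True
    then have "d (Suc n) 0 (d n i x) = d (Suc n) (Suc i) (d n 0 x)"
      using x by (simp add: d_d_inner)
    then show ?thesis using True x by (simp add: t_d d_closed)
  next
    case False
    then have i: "i = Suc n" using ij j by simp
    have "d (Suc n) 0 (d n i x) = t (Suc (Suc n)) (d (Suc n) (Suc 0) (d n 0 x))"
      using x i by (simp add: d_last t_d d_closed)
    also have "d (Suc n) (Suc 0) (d n 0 x) = d (Suc n) 0 (d n 0 x)"
      using x by (simp add: d_d_inner)
    finally show ?thesis using i x by (simp add: t_t_d d_closed)
  qed
  finally show ?thesis using j x by (simp add: d_last)
qed

definition b :: "nat \<Rightarrow> 'v \<Rightarrow> 'v" where "b n x = (\<Sum>i\<le>n + 1. (-1) ^ i *\<^sub>C d n i x)"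
definition b' :: "nat \<Rightarrow> 'v \<Rightarrow> 'v" where "b' n x = (\<Sum>i\<le>n. (-1) ^ i *\<^sub>C d n i x)"
definition lam :: "nat \<Rightarrow> 'v \<Rightarrow> 'v" where "lam n x = (-1) ^ n *\<^sub>C t n x"
definition N :: "nat \<Rightarrow> 'v \<Rightarrow> 'v" where "N n x = (\<Sum>j\<le>n. (lam n ^^ j) x)"

lemma b_eq: "b n x = (\<Sum>i\<le>Suc n. alt i (d n i x))"
  and b'_eq: "b' n x = (\<Sum>i\<le>n. alt i (d n i x))"
  and lam_eq: "lam n x = alt n (t n x)"
  by (simp_all add: b_def b'_def lam_def alt_def)

lemma b_hom: "b n \<in> vect_hom (subsp (E n)) (subsp (E (Suc n)))"
  unfolding b_def by (rule vect_hom_lincomb_fun[OF subspace_E d_hom]) simp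

lemma b'_hom: "b' n \<in> vect_hom (subsp (E n)) (subsp (E (Suc n)))"
  unfolding b'_def by (rule vect_hom_lincomb_fun[OF subspace_E d_hom]) simp

lemma lam_hom: "lam n \<in> vect_hom (subsp (E n)) (subsp (E n))"
  using vect_hom_lincomb_fun[OF subspace_E[of n], of "{()}" "\<lambda>_. t n" "E n" "\<lambda>_. (-1) ^ n"] t_hom[of n]
  by (simp add: lam_def[abs_def])

lemma lam_closed: "x \<in> E n \<Longrightarrow> lam n x \<in> E n"
  by (rule vect_hom_closed[OF lam_hom])

lemma lam_funpow_hom: "(lam n ^^ k) \<in> vect_hom (subsp (E n)) (subsp (E n))"
  by (induction k) (use lam_hom[of n] in \<open>simp_all add: vect_hom_subsp\<close>)

lemma lam_funpow_closed: "x \<in> E n \<Longrightarrow> (lam n ^^ k) x \<in> E n"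
  by (rule vect_hom_closed[OF lam_funpow_hom])

lemma N_hom: "N n \<in> vect_hom (subsp (E n)) (subsp (E n))"
  using vect_hom_lincomb_fun[where f = "\<lambda>j. lam n ^^ j", OF subspace_E[of n] lam_funpow_hom,
      where I = "{..n}" and a = "\<lambda>_. 1"]
  by (simp add: N_def[abs_def] scaleC_one)

lemma b_b: "x \<in> E n \<Longrightarrow> b (Suc n) (b n x) = 0"
proof -
  assume x: "x \<in> E n"
  have "b (Suc n) (b n x) = (\<Sum>j\<le>Suc (Suc n). alt j (\<Sum>i\<le>Suc n. alt i (d (Suc n) j (d n i x))))"
    unfolding b_eq
    by (intro sum.cong refl, subst vect_hom_alt_sum[OF d_hom subspace_E])
      (use x in \<open>auto intro: d_closed\<close>)
  then show ?thesis
    using alternating_double_sum[of "Suc n" "\<lambda>j i. d (Suc n) j (d n i x)"] x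
    by (simp only: alt_sum alt_alt) (simp add: d_d)
qed

lemma b'_b': "x \<in> E n \<Longrightarrow> b' (Suc n) (b' n x) = 0"
proof -
  assume x: "x \<in> E n"
  have "b' (Suc n) (b' n x) = (\<Sum>j\<le>Suc n. alt j (\<Sum>i\<le>n. alt i (d (Suc n) j (d n i x))))"
    unfolding b'_eq
    by (intro sum.cong refl, subst vect_hom_alt_sum[OF d_hom subspace_E])
      (use x in \<open>auto intro: d_closed\<close>)
  then show ?thesis
    using alternating_double_sum[of n "\<lambda>j i. d (Suc n) j (d n i x)"] x
    by (simp only: alt_sum alt_alt) (simp add: d_d)
qed

text \<open>With the sign absorbed, the relation with \<open>lam\<close> is free of signs:
  \<open>lam\<close> carries \<open>D n (Suc i)\<close> to \<open>D n i\<close> composed with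
  \<open>lam\<close>, for every \<open>i \<le> n\<close>.\<close>

definition D :: "nat \<Rightarrow> nat \<Rightarrow> 'v \<Rightarrow> 'v" where "D n i x = alt i (d n i x)"

lemma D_hom: "i \<le> Suc n \<Longrightarrow> D n i \<in> vect_hom (subsp (E n)) (subsp (E (Suc n)))"
  using vect_hom_lincomb_fun[OF subspace_E[of "Suc n"], of "{()}" "\<lambda>_. d n i" "E n" "\<lambda>_. (-1) ^ i"] d_hom[of i n]
  by (simp add: D_def[abs_def] alt_def)

lemma D_closed: "i \<le> Suc n \<Longrightarrow> x \<in> E n \<Longrightarrow> D n i x \<in> E (Suc n)"
  by (rule vect_hom_closed[OF D_hom])

lemma b_D: "b n x = (\<Sum>i\<le>Suc n. D n i x)"
  and b'_D: "b' n x = (\<Sum>i\<le>n. D n i x)"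
  by (simp_all add: b_eq b'_eq D_def)

lemma lam_alt: "x \<in> E n \<Longrightarrow> lam n (alt k x) = alt k (lam n x)"
  by (simp add: alt_def vect_hom_scale[OF lam_hom])

lemma lam_D: "i \<le> n \<Longrightarrow> x \<in> E n \<Longrightarrow> lam (Suc n) (D n (Suc i) x) = D n i (lam n x)"
proof -
  assume i: "i \<le> n" and x: "x \<in> E n"
  have "lam (Suc n) (D n (Suc i) x) = alt (Suc i) (alt (Suc n) (t (Suc n) (d n (Suc i) x)))"
    unfolding D_def using i x by (subst lam_alt) (simp_all add: d_closed lam_eq)
  also have "\<dots> = alt i (alt n (d n i (t n x)))"
    using i x by (simp add: t_d alt_Suc alt_minus)
  also have "alt n (d n i (t n x)) = d n i (lam n x)"
    using i x by (simp add: alt_def lam_def vect_hom_scale[OF d_hom] t_closed)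
  finally show ?thesis by (simp add: D_def)
qed

text \<open>The accumulated sign has exponent n (n + 1), which is even.\<close>

lemma lam_cyclic: "x \<in> E n \<Longrightarrow> (lam n ^^ Suc n) x = x"
proof -
  assume x: "x \<in> E n"
  have t_pow: "(t n ^^ k) x \<in> E n" for k
    by (induction k) (simp_all add: x t_closed)
  have "(lam n ^^ k) x = alt (k * n) ((t n ^^ k) x)" for k
  proof (induction k)
    case (Suc k)
    then show ?case
      by (simp add: lam_alt t_pow) (simp add: lam_eq alt_alt add.commute)
  qed simp
  then have "(lam n ^^ Suc n) x = alt (Suc n * n) x"
    by (simp only: t_cyclic[OF x])
  also have "\<dots> = x" by (rule alt_even) simp
  finally show ?thesis .
qed

lemma lam_N: "x \<in> E n \<Longrightarrow> lam n (N n x) = N n x"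
proof -
  assume x: "x \<in> E n"
  have "lam n (N n x) = (\<Sum>j\<le>n. (lam n ^^ Suc j) x)"
    unfolding N_def by (subst vect_hom_sum[OF lam_hom subspace_E]) (simp_all add: x lam_funpow_closed)
  then have "lam n (N n x) + x = (\<Sum>j\<le>n. (lam n ^^ Suc j) x) + (lam n ^^ 0) x"
    by simp
  also have "\<dots> = (\<Sum>j\<le>Suc n. (lam n ^^ j) x)"
    unfolding sum.atMost_Suc_shift by simp
  also have "\<dots> = N n x + x"
    using lam_cyclic[OF x] by (simp add: N_def)
  finally show ?thesis by simp
qed

lemma N_lam: "x \<in> E n \<Longrightarrow> N n (lam n x) = N n x"
proof -
  assume x: "x \<in> E n"
  have "N n (lam n x) = lam n (N n x)"
    unfolding N_def
    by (subst vect_hom_sum[OF lam_hom subspace_E]) (simp_all add: x lam_funpow_closed funpow_swap1)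
  then show ?thesis by (simp add: lam_N x)
qed

lemma N_lam_funpow: "x \<in> E n \<Longrightarrow> N n ((lam n ^^ k) x) = N n x"
  by (induction k) (simp_all add: N_lam lam_funpow_closed)

lemma N_closed: "x \<in> E n \<Longrightarrow> N n x \<in> E n"
  by (rule vect_hom_closed[OF N_hom])

lemma lam_funpow_N: "x \<in> E n \<Longrightarrow> (lam n ^^ k) (N n x) = N n x"
  by (induction k) (simp_all add: lam_N)

text \<open>Applying \<open>lam\<close> lowers the index of every \<open>D n (Suc i)\<close> and
  turns \<open>D n 0\<close> into \<open>D n (Suc n)\<close>. Hence \<open>lam\<close> after
  \<open>b\<close> is \<open>D n (Suc n)\<close> plus \<open>b'\<close> after \<open>lam\<close>,
  and the first term is the one by which \<open>b\<close> exceeds \<open>b'\<close>.\<close>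

lemma b_lam: "x \<in> E n \<Longrightarrow> b n x - lam (Suc n) (b n x) = b' n (x - lam n x)"
proof -
  assume x: "x \<in> E n"
  have "lam (Suc n) (b n x) = (\<Sum>i\<le>Suc n. lam (Suc n) (D n i x))"
    unfolding b_D by (rule vect_hom_sum[OF lam_hom subspace_E]) (simp add: D_closed x)
  also have "\<dots> = lam (Suc n) (D n 0 x) + b' n (lam n x)"
    unfolding sum.atMost_Suc_shift b'_D by (simp add: lam_D x)
  also have "lam (Suc n) (D n 0 x) = D n (Suc n) x"
    using x by (simp add: D_def lam_eq d_last)
  finally show ?thesis
    using x by (simp add: b_D b'_D[of n x] vect_hom_diff[OF b'_hom subspace_E] lam_closed)
qed

text \<open>Every \<open>D n i\<close> is a conjugate of \<open>D n 0\<close>, whence both sides of \<open>b N = N b'\<close> equal \<open>N D\<^sub>0 N\<close>.\<close>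

lemma D_conj:
  assumes i: "i \<le> Suc n" and x: "x \<in> E n"
  shows "D n i x = (lam (Suc n) ^^ (Suc (Suc n) - i)) (D n 0 ((lam n ^^ i) x))"
proof -
  have "(lam (Suc n) ^^ i) (D n i x) = D n 0 ((lam n ^^ i) x)" if "x \<in> E n" "i \<le> Suc n" for i x
    using that
  proof (induction i arbitrary: x)
    case (Suc i)
    then have "(lam (Suc n) ^^ Suc i) (D n (Suc i) x) = (lam (Suc n) ^^ i) (D n i (lam n x))"
      by (simp add: lam_D funpow_swap1)
    also have "\<dots> = D n 0 ((lam n ^^ i) (lam n x))"
      using Suc by (simp add: lam_closed)
    finally show ?case by (simp add: funpow_swap1)
  qed simp
  \<comment> \<open>In degree \<open>n + 1\<close> the operator \<open>lam\<close> has order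
    \<open>n + 2\<close>, so the remaining \<open>n + 2 - i\<close> applications invert the first
    \<open>i\<close>.\<close>
  from this[OF x i] have "(lam (Suc n) ^^ (Suc (Suc n) - i)) (D n 0 ((lam n ^^ i) x)) =
      (lam (Suc n) ^^ (Suc (Suc n) - i)) ((lam (Suc n) ^^ i) (D n i x))"
    by simp
  also have "\<dots> = (lam (Suc n) ^^ Suc (Suc n)) (D n i x)"
    using i by (simp add: funpow_add[symmetric, THEN fun_cong, unfolded o_apply] del: funpow.simps)
  also have "\<dots> = D n i x"
    by (rule lam_cyclic[OF D_closed[OF i x]])
  finally show ?thesis by simp
qed

lemma b_N: "x \<in> E n \<Longrightarrow> b n (N n x) = N (Suc n) (b' n x)"
proof -
  assume x: "x \<in> E n"
  define y where "y = D n 0 (N n x)"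
  have y: "y \<in> E (Suc n)" unfolding y_def by (intro D_closed N_closed x) simp
  have "b n (N n x) = (\<Sum>i\<le>Suc n. (lam (Suc n) ^^ (Suc (Suc n) - i)) y)"
    unfolding b_D
  proof (rule sum.cong)
    fix i assume "i \<in> {..Suc n}"
    then show "D n i (N n x) = (lam (Suc n) ^^ (Suc (Suc n) - i)) y"
      unfolding y_def by (subst D_conj[OF _ N_closed[OF x]]) (simp_all only: atMost_iff lam_funpow_N[OF x])
  qed simp
  \<comment> \<open>The exponents \<open>n + 2 - i\<close> run through 1, ..., n + 2 rather than 0,
    ..., n + 1; the shift is one factor \<open>lam\<close>, which \<open>N\<close> absorbs.\<close>
  also have "\<dots> = (\<Sum>k\<le>Suc n. (lam (Suc n) ^^ Suc k) y)"
    by (rule sum.reindex_bij_witness[where i = "\<lambda>k. Suc n - k" and j = "\<lambda>i. Suc n - i"])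
      (auto simp: Suc_diff_le simp del: funpow.simps)
  also have "\<dots> = N (Suc n) (lam (Suc n) y)"
    by (simp add: N_def funpow_swap1)
  also have "\<dots> = N (Suc n) y" by (rule N_lam[OF y])
  also have "y = (\<Sum>i\<le>n. D n 0 ((lam n ^^ i) x))"
    unfolding y_def N_def by (rule vect_hom_sum[OF D_hom subspace_E]) (simp_all add: x lam_funpow_closed)
  also have "N (Suc n) \<dots> = (\<Sum>i\<le>n. N (Suc n) (D n 0 ((lam n ^^ i) x)))"
    by (rule vect_hom_sum[OF N_hom subspace_E]) (simp add: x lam_funpow_closed D_closed)
  also have "\<dots> = (\<Sum>i\<le>n. N (Suc n) (D n i x))"
  proof (rule sum.cong)
    fix i assume "i \<in> {..n}"
    then have "D n i x = (lam (Suc n) ^^ (Suc (Suc n) - i)) (D n 0 ((lam n ^^ i) x))"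
      by (intro D_conj x) simp
    then show "N (Suc n) (D n 0 ((lam n ^^ i) x)) = N (Suc n) (D n i x)"
      using N_lam_funpow[OF D_closed[OF le0 lam_funpow_closed[OF x]]] by (simp only:)
  qed simp
  also have "\<dots> = N (Suc n) (b' n x)"
    unfolding b'_D by (rule vect_hom_sum[OF N_hom subspace_E, symmetric]) (simp add: D_closed x)
  finally show ?thesis .
qed

definition bicomplex :: "'v bicomplex"
  where "bicomplex = \<lparr>entry = (\<lambda>p q. E q),
     vert = (\<lambda>p q x. if even p then b q x else - b' q x),
     horiz = (\<lambda>p q x. if even p then x - lam q x else N q x)\<rparr>"

lemma double_complex_bicomplex: "double_complex bicomplex"
proof -
  have minus_b': "(\<lambda>x. - b' n x) \<in> vect_hom (subsp (E n)) (subsp (E (Suc n)))" for n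
    using b'_hom[of n] cvec.subspace_neg[OF subspace_E] by (simp add: vect_hom_subsp)
  have one_lam: "(\<lambda>x. x - lam n x) \<in> vect_hom (subsp (E n)) (subsp (E n))" for n
    using lam_hom[of n] cvec.subspace_diff[OF subspace_E]
    by (simp add: vect_hom_subsp cvec.scale_right_diff_distrib)
  have b'_closed: "b' n x \<in> E (Suc n)" if "x \<in> E n" for n x
    by (rule vect_hom_closed[OF b'_hom that])
  show ?thesis
    unfolding double_complex_def
  proof (intro allI, goal_cases)
    case (1 p q)
    show ?case
      using subspace_E b_hom minus_b' one_lam N_hom b'_closed
      by (cases "even p") (auto simp: bicomplex_def b_b b'_b' vect_hom_minus[OF b'_hom subspace_E] lam_N N_lam
        vect_hom_diff[OF N_hom subspace_E] lam_closed b_N vect_hom_minus[OF N_hom subspace_E]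
        b_lam[symmetric])
  qed
qed

end

section \<open>Morphisms of cocyclic modules\<close>

locale cocyclic_morphism = E: cocyclic E d t + E': cocyclic E' d' t'
  for E :: "nat \<Rightarrow> 'v::complex_vector set" and d t and E' :: "nat \<Rightarrow> 'w::complex_vector set" and d' t' +
  fixes f :: "nat \<Rightarrow> 'v \<Rightarrow> 'w"
  assumes f_hom: "f n \<in> vect_hom (subsp (E n)) (subsp (E' n))"
    and f_d: "i \<le> n \<Longrightarrow> x \<in> E n \<Longrightarrow> f (Suc n) (d n i x) = d' n i (f n x)"
    and f_t: "x \<in> E n \<Longrightarrow> f n (t n x) = t' n (f n x)"
begin

lemma f_closed: "x \<in> E n \<Longrightarrow> f n x \<in> E' n"
  by (rule vect_hom_closed[OF f_hom])

lemma f_d_all: "i \<le> Suc n \<Longrightarrow> x \<in> E n \<Longrightarrow> f (Suc n) (d n i x) = d' n i (f n x)"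
  by (cases "i = Suc n") (simp_all add: f_d E.d_last E'.d_last f_t E.d_closed f_closed)

lemma f_b: "x \<in> E n \<Longrightarrow> f (Suc n) (E.b n x) = E'.b n (f n x)"
  unfolding E.b_def E'.b_def
  by (subst vect_hom_lincomb[OF f_hom E.subspace_E]) (simp_all add: E.d_closed f_d_all)

lemma f_b': "x \<in> E n \<Longrightarrow> f (Suc n) (E.b' n x) = E'.b' n (f n x)"
  unfolding E.b'_def E'.b'_def
  by (subst vect_hom_lincomb[OF f_hom E.subspace_E]) (simp_all add: E.d_closed f_d_all)

lemma f_lam: "x \<in> E n \<Longrightarrow> f n (E.lam n x) = E'.lam n (f n x)"
  by (simp add: E.lam_def E'.lam_def vect_hom_scale[OF f_hom] E.t_closed f_t)

lemma f_N: "x \<in> E n \<Longrightarrow> f n (E.N n x) = E'.N n (f n x)"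
proof -
  assume x: "x \<in> E n"
  have "f n ((E.lam n ^^ k) x) = (E'.lam n ^^ k) (f n x)" for k
    by (induction k) (simp_all add: f_lam E.lam_funpow_closed x)
  then show ?thesis
    unfolding E.N_def E'.N_def
    by (subst vect_hom_sum[OF f_hom E.subspace_E]) (simp_all add: E.lam_funpow_closed x)
qed

sublocale dcomplex_morphism E.bicomplex E'.bicomplex "\<lambda>p q. f q"
proof
  show "double_complex E.bicomplex" "double_complex E'.bicomplex"
    by (rule E.double_complex_bicomplex E'.double_complex_bicomplex)+
  fix p q x assume "x \<in> entry E.bicomplex p q"
  then have x: "x \<in> E q" by (simp add: E.bicomplex_def)
  show "f (Suc q) (vert E.bicomplex p q x) = vert E'.bicomplex p q (f q x)"
    using x vect_hom_closed[OF E.b'_hom x]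
    by (simp add: E.bicomplex_def E'.bicomplex_def f_b f_b' vect_hom_minus[OF f_hom E.subspace_E])
  show "f q (horiz E.bicomplex p q x) = horiz E'.bicomplex p q (f q x)"
    using x by (simp add: E.bicomplex_def E'.bicomplex_def f_N f_lam E.lam_closed vect_hom_diff[OF f_hom E.subspace_E])
qed (simp add: E.bicomplex_def E'.bicomplex_def f_hom)

end

section \<open>The cocyclic module of a left H-category\<close>

text \<open>One construction for the inner cofaces, the maps induced by semifunctors and the
  insertion of identities: each is an operation on chains that is linear slot by slot and compatible
  with the action.\<close>

definition pullback :: "('o, 'f::complex_vector, 'h) hcat \<Rightarrow> nat \<Rightarrow> ('p, 'g::complex_vector, 'h) hcat \<Rightarrow> nat \<Rightarrow>
    (('o, 'f) chain \<Rightarrow> ('p, 'g) chain) \<Rightarrow> ('m::complex_vector, 'p, 'g) cochain \<Rightarrow> ('m, 'o, 'f) cochain"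
  where "pullback D n D' n' u \<phi> = extend_linearly D n (\<lambda>m c. \<phi> (elementary D' n' m (u c)))"

lemma fun_vector_apply:
  fixes \<phi> \<psi> :: "'x \<Rightarrow> 'v::complex_vector"
  shows "(\<phi> + \<psi>) A = \<phi> A + \<psi> A" "(a *\<^sub>C \<phi>) A = a *\<^sub>C \<phi> A"
  by (simp_all add: scaleC_fun_def)

lemma clinear_apply: "clinear (\<lambda>\<phi>. \<phi> A)"
  by (rule clinearI) (simp_all add: scaleC_fun_def)

context cyclic_module
begin

lemma pullback_cochain:
  assumes D': "cyclic_module H M D'" and u: "multi D n D' n' u" "equivariant H D n D' n' u"
    and \<phi>: "\<phi> \<in> cochains H M D' n'"
  shows "pullback D n D' n' u \<phi> \<in> C n"
    and "c \<in> hom_chains D n \<Longrightarrow> pullback D n D' n' u \<phi> (elementary D n m c) = \<phi> (elementary D' n' m (u c))"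
proof -
  interpret D': cyclic_module H M D' by (rule D')
  let ?F = "\<lambda>m c. \<phi> (elementary D' n' m (u c))"
  have ml: "multilinear D n ?F"
    by (rule multilinear_comp[OF D'.cochain_multilinear[OF \<phi>] u(1)])
  have "balanced n ?F"
    unfolding balanced_def
  proof (intro allI ballI)
    fix m h c assume c: "c \<in> hom_chains D n"
    have "\<phi> (elementary D' n' (ract M m h) (u c)) =
        sweedler H (Suc n') h (\<lambda>hs. \<phi> (elementary D' n' m (act_chain D' hs (u c))))"
      by (rule D'.balancedD[OF D'.cochain_balanced[OF \<phi>] multi_hom[OF u(1) c]])
    then show "\<phi> (elementary D' n' (ract M m h) (u c)) =
        sweedler H (Suc n) h (\<lambda>hs. \<phi> (elementary D' n' m (u (act_chain D hs c))))"
      using u(2)[unfolded equivariant_def, rule_format, OF c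
          D'.multilinear_chain_linear[OF D'.cochain_multilinear[OF \<phi>]], of h m] by simp
  qed
  with ml show "pullback D n D' n' u \<phi> \<in> C n"
    unfolding pullback_def by (rule extend_linearly_cochain)
  show "c \<in> hom_chains D n \<Longrightarrow> pullback D n D' n' u \<phi> (elementary D n m c) = \<phi> (elementary D' n' m (u c))"
    unfolding pullback_def by (rule extend_linearly_elementary[OF ml])
qed

lemma cochain_homI:
  assumes D': "cyclic_module H M D'" and closed: "\<And>\<phi>. \<phi> \<in> cochains H M D' n' \<Longrightarrow> f \<phi> \<in> C n"
    and val: "\<And>\<phi> m c. \<phi> \<in> cochains H M D' n' \<Longrightarrow> c \<in> hom_chains D n \<Longrightarrow> f \<phi> (elementary D n m c) = L m c \<phi>"
    and L: "\<And>m c. clinear (L m c)"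
  shows "f \<in> vect_hom (subsp (cochains H M D' n')) (subsp (C n))"
proof -
  interpret D': cyclic_module H M D' by (rule D')
  note sub = cvec.subspace_add[OF D'.subspace_cochains] cvec.subspace_scale[OF D'.subspace_cochains]
    cvec.subspace_add[OF subspace_cochains] cvec.subspace_scale[OF subspace_cochains]
  show ?thesis
  proof (rule vect_homI)
    show "f (\<phi> + \<psi>) = f \<phi> + f \<psi>" if "\<phi> \<in> cochains H M D' n'" "\<psi> \<in> cochains H M D' n'" for \<phi> \<psi>
      using that by (intro cochain_eqI[where n = n]) (simp_all add: sub closed val clinear_addD[OF L])
    show "f (a *\<^sub>C \<phi>) = a *\<^sub>C f \<phi>" if "\<phi> \<in> cochains H M D' n'" for a \<phi>
      using that by (intro cochain_eqI[where n = n]) (simp_all add: sub closed val clinear_scaleD[OF L] fun_vector_apply)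
  qed (rule closed)
qed

lemma pullback_hom:
  assumes D': "cyclic_module H M D'" and u: "multi D n D' n' u" "equivariant H D n D' n' u"
  shows "pullback D n D' n' u \<in> vect_hom (subsp (cochains H M D' n')) (subsp (C n))"
  by (rule cochain_homI[OF D' pullback_cochain[OF D' u]]) (simp_all add: clinear_apply)

lemma cyclic_module: "cyclic_module H M D"
  by (rule cyclic_module_axioms)

lemma coface_pullback: "i \<le> n \<Longrightarrow> coface H M D n i \<phi> = pullback D (Suc n) D n (merge D i) \<phi>"
  by (simp add: coface_def pullback_def)

lemma coface_cochain: "i \<le> n \<Longrightarrow> \<phi> \<in> C n \<Longrightarrow> coface H M D n i \<phi> \<in> C (Suc n)"
  and coface_elementary: "i \<le> n \<Longrightarrow> \<phi> \<in> C n \<Longrightarrow> c \<in> hom_chains D (Suc n) \<Longrightarrow>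
    coface H M D n i \<phi> (elementary D (Suc n) m c) = \<phi> (elementary D n m (merge D i c))"
  by (simp_all add: coface_pullback pullback_cochain[OF cyclic_module multi_merge equivariant_merge])

lemma cyclic_op_eq: "cyclic_op H M D n \<phi> = extend_linearly D n (rotated n (\<lambda>m c. \<phi> (elementary D n m c)))"
  by (simp add: cyclic_op_def rotated_def[abs_def])

lemma cyclic_op_cochain: "\<phi> \<in> C n \<Longrightarrow> cyclic_op H M D n \<phi> \<in> C n"
  unfolding cyclic_op_eq
  by (intro extend_linearly_cochain multilinear_rotated balanced_rotated cochain_multilinear cochain_balanced)

lemma cyclic_op_elementary:
  "\<phi> \<in> C n \<Longrightarrow> c \<in> hom_chains D n \<Longrightarrow>
    cyclic_op H M D n \<phi> (elementary D n m c) = rotated n (\<lambda>m c. \<phi> (elementary D n m c)) m c"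
  unfolding cyclic_op_eq by (intro extend_linearly_elementary multilinear_rotated cochain_multilinear)

lemma rotated_cong:
  assumes "\<And>m c. c \<in> hom_chains D n \<Longrightarrow> F m c = G m c" and "c \<in> hom_chains D n"
  shows "rotated n F m c = rotated n G m c"
  using assms by (simp add: rotated_def rotate_hom)

text \<open>The definition of the last coface composes directly, without an intermediate rotation;
  identifying it with \<tau> \<delta>_0 also shows that it yields a cochain.\<close>

lemma coface_last:
  assumes \<phi>: "\<phi> \<in> C n"
  shows "coface H M D n (Suc n) \<phi> = cyclic_op H M D (Suc n) (coface H M D n 0 \<phi>)"
proof -
  let ?F = "rotated (Suc n) (\<lambda>m c. \<phi> (elementary D n m (merge D 0 c)))"
    and ?G = "\<lambda>m c. tensor_lift (\<lambda>a x. \<phi> (elementary D n x (merge_last D (T a) c))) (coact M m)"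
  have FG: "?F m c = ?G m c" if "c \<in> hom_chains D (Suc n)" for m c
    using that by (simp add: rotated_def merge_0_rotate)
  have F: "multilinear D (Suc n) ?F"
    by (intro multilinear_rotated multilinear_comp[OF cochain_multilinear[OF \<phi>] multi_merge]) simp
  \<comment> \<open>\<open>?F\<close> and \<open>?G\<close> are known to agree on chains of
    \<open>D\<close> only, so multilinearity is transferred slot by slot.\<close>
  have G: "multilinear D (Suc n) ?G"
    unfolding multilinear_def chain_linear_def
  proof (intro conjI ballI allI impI)
    fix c assume c: "c \<in> hom_chains D (Suc n)"
    show "clinear (\<lambda>m. ?G m c)"
      using multilinear_clinear[OF F c] by (simp only: FG[OF c])
    fix m i a f f'
    assume i: "i \<le> Suc n" and f: "f \<in> Hom D (obj c (Suc i)) (obj c i)" and f': "f' \<in> Hom D (obj c (Suc i)) (obj c i)"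
    have "a *\<^sub>C f + f' \<in> Hom D (obj c (Suc i)) (obj c i)"
      using f f' chain_subspace[OF c i] by (simp add: cvec.subspace_def)
    note af = this
    show "?G m (set_arr c i (a *\<^sub>C f + f')) = a *\<^sub>C ?G m (set_arr c i f) + ?G m (set_arr c i f')"
      unfolding FG[OF set_arr_hom[OF c i af], symmetric] FG[OF set_arr_hom[OF c i f], symmetric]
        FG[OF set_arr_hom[OF c i f'], symmetric]
      by (rule chain_linearD[OF multilinear_chain_linear[OF F] c i f f'])
  qed
  have eq: "coface H M D n (Suc n) \<phi> = extend_linearly D (Suc n) ?G"
    by (simp add: coface_def)
  show ?thesis
  proof (rule nerve_functional_eqI)
    show "coface H M D n (Suc n) \<phi> \<in> vect_hom (nerve_tensor D (Suc n)) (subsp UNIV)"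
      unfolding eq by (rule extend_linearly_vect_hom[OF G])
    have cy: "cyclic_op H M D (Suc n) (coface H M D n 0 \<phi>) \<in> C (Suc n)"
      by (intro cyclic_op_cochain coface_cochain \<phi>) simp
    then show "cyclic_op H M D (Suc n) (coface H M D n 0 \<phi>) \<in> vect_hom (nerve_tensor D (Suc n)) (subsp UNIV)"
      "\<And>A. A \<notin> carrier (nerve_tensor D (Suc n)) \<Longrightarrow> cyclic_op H M D (Suc n) (coface H M D n 0 \<phi>) A = 0"
      by (simp_all add: cochains_iff)
    show "\<And>A. A \<notin> carrier (nerve_tensor D (Suc n)) \<Longrightarrow> coface H M D n (Suc n) \<phi> A = 0"
      unfolding eq by (rule extend_linearly_outside)
    fix m c assume c: "c \<in> hom_chains D (Suc n)"
    have "cyclic_op H M D (Suc n) (coface H M D n 0 \<phi>) (elementary D (Suc n) m c) = ?F m c"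
      using c by (simp add: cyclic_op_elementary coface_cochain \<phi> coface_elementary cong: rotated_cong)
    then show "coface H M D n (Suc n) \<phi> (elementary D (Suc n) m c) =
        cyclic_op H M D (Suc n) (coface H M D n 0 \<phi>) (elementary D (Suc n) m c)"
      unfolding eq by (simp add: extend_linearly_elementary[OF G c] FG[OF c])
  qed
qed

lemma cyclic_op_hom: "cyclic_op H M D n \<in> vect_hom (subsp (C n)) (subsp (C n))"
  by (rule cochain_homI[OF cyclic_module cyclic_op_cochain,
        where L = "\<lambda>m c \<phi>. rotated n (\<lambda>m c. \<phi> (elementary D n m c)) m c"])
    (auto simp: cyclic_op_elementary rotated_def intro: clin clinear_apply)

lemma coface_hom: "i \<le> n \<Longrightarrow> coface H M D n i \<in> vect_hom (subsp (C n)) (subsp (C (Suc n)))"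
proof -
  assume i: "i \<le> n"
  then have "coface H M D n i = pullback D (Suc n) D n (merge D i)"
    by (intro ext) (simp add: coface_pullback)
  then show ?thesis
    by (simp add: pullback_hom[OF cyclic_module multi_merge[OF i] equivariant_merge[OF i]])
qed

lemma cyclic_op_funpow:
  assumes \<phi>: "\<phi> \<in> C n"
  shows "(cyclic_op H M D n ^^ k) \<phi> \<in> C n"
    and "c \<in> hom_chains D n \<Longrightarrow> (cyclic_op H M D n ^^ k) \<phi> (elementary D n m c) =
      (rotated n ^^ k) (\<lambda>m c. \<phi> (elementary D n m c)) m c"
proof -
  show closed: "(cyclic_op H M D n ^^ k) \<phi> \<in> C n" for k
    by (induction k) (simp_all add: \<phi> cyclic_op_cochain)
  show "c \<in> hom_chains D n \<Longrightarrow> (cyclic_op H M D n ^^ k) \<phi> (elementary D n m c) =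
      (rotated n ^^ k) (\<lambda>m c. \<phi> (elementary D n m c)) m c"
    by (induction k arbitrary: m c) (simp_all add: cyclic_op_elementary closed cong: rotated_cong)
qed

sublocale cc: cocyclic C "coface H M D" "cyclic_op H M D"
proof
  show "cvec.subspace (C n)" for n
    by (rule subspace_cochains)
  show cyclic_hom: "cyclic_op H M D n \<in> vect_hom (subsp (C n)) (subsp (C n))" for n
    by (rule cyclic_op_hom)
  show last: "coface H M D n (Suc n) \<phi> = cyclic_op H M D (Suc n) (coface H M D n 0 \<phi>)" if "\<phi> \<in> C n" for n \<phi>
    by (rule coface_last[OF that])
  show "coface H M D n i \<in> vect_hom (subsp (C n)) (subsp (C (Suc n)))" if i: "i \<le> Suc n" for i n
  proof (cases "i = Suc n")
    case True
    then show ?thesis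
      using coface_hom[of 0 n] cyclic_hom[of "Suc n"] by (auto simp: vect_hom_subsp last
          cvec.subspace_add[OF subspace_cochains] cvec.subspace_scale[OF subspace_cochains])
  qed (use i in \<open>simp add: coface_hom\<close>)
  show "coface H M D (Suc n) (Suc j) (coface H M D n i \<phi>) = coface H M D (Suc n) i (coface H M D n j \<phi>)"
    if "i \<le> j" "j \<le> n" "\<phi> \<in> C n" for i j n \<phi>
    using that
    by (intro cochain_eqI[of _ "Suc (Suc n)"])
      (simp_all add: coface_cochain coface_elementary merge_hom merge_merge)
  show "cyclic_op H M D (Suc n) (coface H M D n (Suc i) \<phi>) = coface H M D n i (cyclic_op H M D n \<phi>)"
    if "i < n" "\<phi> \<in> C n" for i n \<phi>
    using that
    by (intro cochain_eqI[of _ "Suc n"])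
      (simp_all add: coface_cochain coface_elementary merge_hom cyclic_op_cochain cyclic_op_elementary
        rotated_merge_Suc[symmetric] cong: rotated_cong)
  show "cyclic_op H M D (Suc n) (cyclic_op H M D (Suc n) (coface H M D n 0 \<phi>)) = coface H M D n n (cyclic_op H M D n \<phi>)"
    if "\<phi> \<in> C n" for n \<phi>
    using that
    by (intro cochain_eqI[of _ "Suc n"])
      (simp_all add: coface_cochain coface_elementary merge_hom cyclic_op_cochain cyclic_op_elementary
        rotated_rotated_merge[OF cochain_multilinear, symmetric] cong: rotated_cong)
  show "(cyclic_op H M D n ^^ Suc n) \<phi> = \<phi>" if \<phi>: "\<phi> \<in> C n" for n \<phi>
    by (rule cochain_eqI[OF cyclic_op_funpow(1)[OF \<phi>] \<phi>])
      (simp only: cyclic_op_funpow(2)[OF \<phi>] rotated_cyclic[OF cochain_multilinear[OF \<phi>] cochain_balanced[OF \<phi>]])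
qed

lemma cyclic_bicomplex_eq: "cyclic_bicomplex H M D = cc.bicomplex"
  unfolding cyclic_bicomplex_def cc.bicomplex_def hochschild_b_def[abs_def] hochschild_b'_def[abs_def]
    norm_op_def[abs_def] lambda_op_def[abs_def] cc.b_def cc.b'_def cc.N_def cc.lam_def[abs_def] ..

sublocale dc: dcomplex "cyclic_bicomplex H M D"
  by unfold_locales (simp add: cyclic_bicomplex_eq cc.double_complex_bicomplex)

lemma module_HC: "module complex_field (HC H M D n)"
  unfolding HC_def by (rule dc.module_tot_cohomology)

lemma carrier_HC:
  "carrier (HC H M D n) = (\<lambda>x. x +o tot_coboundaries (cyclic_bicomplex H M D) n) ` tot_cocycles (cyclic_bicomplex H M D) n"
  by (simp add: HC_def tot_cohomology_def quotient_space_def)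

end

section \<open>Maps induced by semifunctors\<close>

lemma H_semifunctorD:
  assumes "H_semifunctor D D' \<alpha>"
  shows semifunctor_Ob: "X \<in> Ob D \<Longrightarrow> obj_map \<alpha> X \<in> Ob D'"
    and semifunctor_hom: "X \<in> Ob D \<Longrightarrow> Y \<in> Ob D \<Longrightarrow>
      arr_map \<alpha> X Y \<in> vect_hom (subsp (Hom D X Y)) (subsp (Hom D' (obj_map \<alpha> X) (obj_map \<alpha> Y)))"
    and semifunctor_closed: "X \<in> Ob D \<Longrightarrow> Y \<in> Ob D \<Longrightarrow> f \<in> Hom D X Y \<Longrightarrow>
      arr_map \<alpha> X Y f \<in> Hom D' (obj_map \<alpha> X) (obj_map \<alpha> Y)"
    and semifunctor_Act: "X \<in> Ob D \<Longrightarrow> Y \<in> Ob D \<Longrightarrow> f \<in> Hom D X Y \<Longrightarrow>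
      arr_map \<alpha> X Y (Act D X Y h f) = Act D' (obj_map \<alpha> X) (obj_map \<alpha> Y) h (arr_map \<alpha> X Y f)"
    and semifunctor_Comp: "X \<in> Ob D \<Longrightarrow> Y \<in> Ob D \<Longrightarrow> Z \<in> Ob D \<Longrightarrow> f \<in> Hom D X Y \<Longrightarrow> g \<in> Hom D Y Z \<Longrightarrow>
      arr_map \<alpha> X Z (Comp D X Y Z g f) =
        Comp D' (obj_map \<alpha> X) (obj_map \<alpha> Y) (obj_map \<alpha> Z) (arr_map \<alpha> Y Z g) (arr_map \<alpha> X Y f)"
  using assms unfolding H_semifunctor_def vect_hom_subsp by blast+

lemma semifunctor_on_simps [simp]:
  "X \<in> Ob D \<Longrightarrow> obj_map (semifunctor_on D F G) X = F X"
  "X \<in> Ob D \<Longrightarrow> Y \<in> Ob D \<Longrightarrow> f \<in> Hom D X Y \<Longrightarrow> arr_map (semifunctor_on D F G) X Y f = G X Y f"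
  by (simp_all add: semifunctor_on_def)

lemma semifunctor_on_idem:
  "semifunctor_on D (obj_map (semifunctor_on D F G)) (arr_map (semifunctor_on D F G)) = semifunctor_on D F G"
  by (simp add: semifunctor_on_def fun_eq_iff)

section \<open>Chains under semifunctors\<close>

lemma map_chain_simps:
  assumes c: "c \<in> hom_chains D n"
  shows "length (map_chain \<alpha> c) = Suc n"
    and "k \<le> Suc n \<Longrightarrow> obj (map_chain \<alpha> c) k = obj_map \<alpha> (obj c k)"
    and "k \<le> n \<Longrightarrow> arr (map_chain \<alpha> c) k = arr_map \<alpha> (obj c (Suc k)) (obj c k) (arr c k)"
  by (simp_all add: map_chain_eq[OF hom_chains_length[OF c]] obj_mk_chain_cyclic hom_chains_wrap[OF c])

lemma map_chain_hom:
  assumes \<alpha>: "H_semifunctor D D' \<alpha>" and c: "c \<in> hom_chains D n"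
  shows "map_chain \<alpha> c \<in> hom_chains D' n"
  by (rule hom_chainsI)
    (simp_all add: map_chain_simps[OF c] semifunctor_Ob[OF \<alpha>] semifunctor_closed[OF \<alpha>] hom_chainsD[OF c])

lemma map_chain_id:
  assumes c: "c \<in> hom_chains D n"
  shows "map_chain (id_semifunctor D) c = c"
  by (rule chain_eqI[of _ n]) (simp_all add: map_chain_simps[OF c] id_semifunctor_def hom_chainsD[OF c])

lemma map_chain_comp:
  assumes \<alpha>: "H_semifunctor D D' \<alpha>" and c: "c \<in> hom_chains D n"
  shows "map_chain (comp_semifunctor D \<beta> \<alpha>) c = map_chain \<beta> (map_chain \<alpha> c)"
  by (rule chain_eqI[of _ n])
    (simp_all add: map_chain_simps[OF c] map_chain_simps[OF map_chain_hom[OF \<alpha> c]] comp_semifunctor_def hom_chainsD[OF c])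

lemma id_H_semifunctor:
  assumes "left_H_category H D"
  shows "H_semifunctor D D (id_semifunctor D)"
proof -
  interpret left_H_category H D by (rule assms)
  show ?thesis
    unfolding H_semifunctor_def id_semifunctor_def semifunctor_on_idem
    by (auto simp: vect_hom_subsp Act_closed Comp_closed cvec.subspace_add[OF Hom_subspace] cvec.subspace_scale[OF Hom_subspace])
qed

lemma comp_H_semifunctor:
  assumes D: "left_H_category H D" and \<alpha>: "H_semifunctor D D' \<alpha>" and \<beta>: "H_semifunctor D' D'' \<beta>"
  shows "H_semifunctor D D'' (comp_semifunctor D \<beta> \<alpha>)"
proof -
  interpret left_H_category H D by (rule D)
  note hom = vect_hom_add[OF semifunctor_hom[OF \<alpha>]] vect_hom_scale[OF semifunctor_hom[OF \<alpha>]]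
    vect_hom_add[OF semifunctor_hom[OF \<beta>]] vect_hom_scale[OF semifunctor_hom[OF \<beta>]]
  note s = semifunctor_Ob[OF \<alpha>] semifunctor_Ob[OF \<beta>] semifunctor_closed[OF \<alpha>] semifunctor_closed[OF \<beta>]
  show ?thesis
    unfolding H_semifunctor_def comp_semifunctor_def semifunctor_on_idem
    by (auto simp: vect_hom_subsp Act_closed Comp_closed cvec.subspace_add[OF Hom_subspace]
        cvec.subspace_scale[OF Hom_subspace] s hom semifunctor_Act[OF \<alpha>] semifunctor_Act[OF \<beta>]
        semifunctor_Comp[OF \<alpha>] semifunctor_Comp[OF \<beta>])
qed

lemma multi_map_chain:
  assumes \<alpha>: "H_semifunctor D D' \<alpha>"
  shows "multi D n D' n (map_chain \<alpha>)"
  unfolding multi_def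
proof (intro ballI conjI allI impI)
  fix c assume c: "c \<in> hom_chains D n"
  show "map_chain \<alpha> c \<in> hom_chains D' n" by (rule map_chain_hom[OF \<alpha> c])
  fix j assume j: "j \<le> n"
  have "map_chain \<alpha> (set_arr c j f) = set_arr (map_chain \<alpha> c) j (arr_map \<alpha> (obj c (Suc j)) (obj c j) f)"
    if "f \<in> Hom D (obj c (Suc j)) (obj c j)" for f
    by (rule chain_eqI[of _ n])
      (use j that in \<open>simp_all add: map_chain_simps[OF c] map_chain_simps[OF set_arr_hom[OF c j]] hom_chains_length[OF c]\<close>)
  moreover have "arr_map \<alpha> (obj c (Suc j)) (obj c j) \<in> vect_hom (subsp (Hom D (obj c (Suc j)) (obj c j)))
      (subsp (Hom D' (obj (map_chain \<alpha> c) (Suc j)) (obj (map_chain \<alpha> c) j)))"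
    using semifunctor_hom[OF \<alpha>] j by (simp add: map_chain_simps[OF c] hom_chainsD[OF c])
  ultimately show "\<exists>k\<le>n. \<exists>l\<in>vect_hom (subsp (Hom D (obj c (Suc j)) (obj c j)))
        (subsp (Hom D' (obj (map_chain \<alpha> c) (Suc k)) (obj (map_chain \<alpha> c) k))).
      \<forall>f\<in>Hom D (obj c (Suc j)) (obj c j). map_chain \<alpha> (set_arr c j f) = set_arr (map_chain \<alpha> c) k (l f)"
    using j by (intro exI[of _ j] conjI bexI[of _ "arr_map \<alpha> (obj c (Suc j)) (obj c j)"] ballI)
qed

locale cyclic_module_morphism =
  A: cyclic_module H M D + B: cyclic_module H M D'
  for H :: "('h::complex_algebra) hopf"
    and M :: "('h, 'm::complex_vector) hopf_module"
    and D :: "('o, 'f::complex_vector, 'h) hcat"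
    and D' :: "('p, 'g::complex_vector, 'h) hcat" +
  fixes \<alpha> :: "('o, 'f, 'p, 'g) semifunctor"
  assumes semifunctor: "H_semifunctor D D' \<alpha>"
begin

lemma equivariant_map_chain: "equivariant H D n D' n (map_chain \<alpha>)"
proof -
  have "act_chain D' hs (map_chain \<alpha> c) = map_chain \<alpha> (act_chain D hs c)" if c: "c \<in> hom_chains D n" for hs c
    by (rule chain_eqI[of _ n])
      (simp_all add: map_chain_simps[OF c] map_chain_simps[OF A.act_chain_hom[OF c]] A.act_chain_simps[OF c]
        B.act_chain_simps[OF map_chain_hom[OF semifunctor c]] semifunctor_Act[OF semifunctor] hom_chainsD[OF c])
  then show ?thesis by (simp add: equivariant_def)
qed

text \<open>Only compatibility with composition is used, which is why a semifunctor induces a map of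
  cofaces.\<close>

lemma map_chain_merge:
  assumes c: "c \<in> hom_chains D (Suc n)" and i: "i \<le> n"
  shows "map_chain \<alpha> (merge D i c) = merge D' i (map_chain \<alpha> c)"
proof (rule chain_eqI[of _ n])
  note s = map_chain_simps[OF c] map_chain_simps[OF A.merge_hom[OF c i]] A.merge_simps[OF c i]
    B.merge_simps[OF map_chain_hom[OF semifunctor c] i]
  fix k assume k: "k \<le> n"
  show "obj (map_chain \<alpha> (merge D i c)) k = obj (merge D' i (map_chain \<alpha> c)) k"
    using k by (simp add: s)
  consider "k < i" | "k = i" | "i < k" by linarith
  then show "arr (map_chain \<alpha> (merge D i c)) k = arr (merge D' i (map_chain \<alpha> c)) k"
    by cases (use k i in \<open>simp_all add: s semifunctor_Comp[OF semifunctor] hom_chainsD[OF c]\<close>)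
qed (simp_all add: map_chain_simps[OF A.merge_hom[OF c i]] B.merge_simps[OF map_chain_hom[OF semifunctor c] i])

lemma map_chain_rotate:
  assumes c: "c \<in> hom_chains D n"
  shows "map_chain \<alpha> (rotate_chain D h c) = rotate_chain D' h (map_chain \<alpha> c)"
proof (rule chain_eqI[of _ n])
  note s = map_chain_simps[OF c] map_chain_simps[OF A.rotate_hom[OF c]] A.rotate_simps[OF c]
    B.rotate_simps[OF map_chain_hom[OF semifunctor c]]
  have last: "arr c n \<in> Hom D (obj c 0) (obj c n)"
    using hom_chains_arr[OF c, of n] by (simp add: hom_chains_wrap[OF c])
  fix k assume k: "k \<le> n"
  show "obj (map_chain \<alpha> (rotate_chain D h c)) k = obj (rotate_chain D' h (map_chain \<alpha> c)) k"
    using k by (cases k) (simp_all add: s)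
  show "arr (map_chain \<alpha> (rotate_chain D h c)) k = arr (rotate_chain D' h (map_chain \<alpha> c)) k"
    using k last by (cases k) (simp_all add: s semifunctor_Act[OF semifunctor] hom_chainsD[OF c])
qed (simp_all add: map_chain_simps[OF A.rotate_hom[OF c]] B.rotate_simps[OF map_chain_hom[OF semifunctor c]])

lemma cochain_map_pullback: "cochain_map D D' \<alpha> n \<phi> = pullback D n D' n (map_chain \<alpha>) \<phi>"
  by (simp add: cochain_map_def pullback_def)

lemma cochain_map_cochain: "\<phi> \<in> cochains H M D' n \<Longrightarrow> cochain_map D D' \<alpha> n \<phi> \<in> cochains H M D n"
  and cochain_map_elementary: "\<phi> \<in> cochains H M D' n \<Longrightarrow> c \<in> hom_chains D n \<Longrightarrow>
    cochain_map D D' \<alpha> n \<phi> (elementary D n m c) = \<phi> (elementary D' n m (map_chain \<alpha> c))"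
  by (simp_all add: cochain_map_pullback
      A.pullback_cochain[OF B.cyclic_module multi_map_chain[OF semifunctor] equivariant_map_chain])

lemma cochain_map_hom:
  "cochain_map D D' \<alpha> n \<in> vect_hom (subsp (cochains H M D' n)) (subsp (cochains H M D n))"
  using A.pullback_hom[OF B.cyclic_module multi_map_chain[OF semifunctor] equivariant_map_chain]
  by (simp add: cochain_map_pullback[abs_def])

sublocale cm: cocyclic_morphism "cochains H M D'" "coface H M D'" "cyclic_op H M D'"
  "cochains H M D" "coface H M D" "cyclic_op H M D" "cochain_map D D' \<alpha>"
proof
  show "cochain_map D D' \<alpha> n \<in> vect_hom (subsp (cochains H M D' n)) (subsp (cochains H M D n))" for n
    by (rule cochain_map_hom)
  show "cochain_map D D' \<alpha> (Suc n) (coface H M D' n i \<phi>) = coface H M D n i (cochain_map D D' \<alpha> n \<phi>)"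
    if "i \<le> n" "\<phi> \<in> cochains H M D' n" for i n \<phi>
    using that
    by (intro A.cochain_eqI[of _ "Suc n"])
      (simp_all add: cochain_map_cochain cochain_map_elementary A.coface_cochain B.coface_cochain
        A.coface_elementary B.coface_elementary map_chain_hom[OF semifunctor] A.merge_hom map_chain_merge)
  show "cochain_map D D' \<alpha> n (cyclic_op H M D' n \<phi>) = cyclic_op H M D n (cochain_map D D' \<alpha> n \<phi>)"
    if "\<phi> \<in> cochains H M D' n" for n \<phi>
    using that
    by (intro A.cochain_eqI[of _ n])
      (simp_all add: cochain_map_cochain cochain_map_elementary A.cyclic_op_cochain B.cyclic_op_cochain
        A.cyclic_op_elementary B.cyclic_op_elementary map_chain_hom[OF semifunctor] A.rotated_def B.rotated_def
        A.rotate_hom map_chain_rotate)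
qed

sublocale bm: dcomplex_morphism "cyclic_bicomplex H M D'" "cyclic_bicomplex H M D" "bicomplex_map D D' \<alpha>"
  using cm.dcomplex_morphism_axioms
  by (simp add: A.cyclic_bicomplex_eq B.cyclic_bicomplex_eq bicomplex_map_def[abs_def])

lemma HC_map_hom: "HC_map H M D D' \<alpha> n \<in> vect_hom (HC H M D' n) (HC H M D n)"
  unfolding HC_def HC_map_def by (rule bm.tot_cohomology_map_hom)

lemma HC_map_coset:
  "x \<in> tot_cocycles (cyclic_bicomplex H M D') n \<Longrightarrow>
    HC_map H M D D' \<alpha> n (x +o tot_coboundaries (cyclic_bicomplex H M D') n) =
      tot_map (bicomplex_map D D' \<alpha>) n x +o tot_coboundaries (cyclic_bicomplex H M D) n"
  unfolding HC_map_def by (rule bm.tot_cohomology_map_coset)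

lemma cochain_map_eqI:
  assumes "\<phi> \<in> cochains H M D' n" "\<psi> \<in> cochains H M D n"
    and "\<And>m c. c \<in> hom_chains D n \<Longrightarrow> \<psi> (elementary D n m c) = \<phi> (elementary D' n m (map_chain \<alpha> c))"
  shows "cochain_map D D' \<alpha> n \<phi> = \<psi>"
  using assms by (intro A.cochain_eqI[of _ n]) (simp_all add: cochain_map_cochain cochain_map_elementary)

end

lemma (in cyclic_module) morphismI:
  "cyclic_module H M D' \<Longrightarrow> H_semifunctor D D' \<alpha> \<Longrightarrow> cyclic_module_morphism H M D D' \<alpha>"
  using cyclic_module by (simp add: cyclic_module_morphism_def cyclic_module_morphism_axioms_def)

lemma cochain_map_comp:
  assumes "cyclic_module H M D" "cyclic_module H M D'" "cyclic_module H M D''"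
    and \<alpha>: "H_semifunctor D D' \<alpha>" and \<beta>: "H_semifunctor D' D'' \<beta>" and \<phi>: "\<phi> \<in> cochains H M D'' n"
  shows "cochain_map D D'' (comp_semifunctor D \<beta> \<alpha>) n \<phi> = cochain_map D D' \<alpha> n (cochain_map D' D'' \<beta> n \<phi>)"
proof -
  interpret A: cyclic_module H M D by fact
  interpret B: cyclic_module H M D' by fact
  interpret C: cyclic_module H M D'' by fact
  interpret a: cyclic_module_morphism H M D D' \<alpha> by (intro A.morphismI B.cyclic_module \<alpha>)
  interpret b: cyclic_module_morphism H M D' D'' \<beta> by (intro B.morphismI C.cyclic_module \<beta>)
  interpret c: cyclic_module_morphism H M D D'' "comp_semifunctor D \<beta> \<alpha>"
    by (intro A.morphismI C.cyclic_module comp_H_semifunctor[OF A.left_H_category_axioms \<alpha> \<beta>])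
  show ?thesis
    by (rule c.cochain_map_eqI[OF \<phi>])
      (simp_all add: a.cochain_map_cochain b.cochain_map_cochain \<phi> a.cochain_map_elementary
        b.cochain_map_elementary map_chain_hom[OF \<alpha>] map_chain_comp[OF \<alpha>])
qed

lemma (in cyclic_module) cochain_map_id: "\<phi> \<in> C n \<Longrightarrow> cochain_map D D (id_semifunctor D) n \<phi> = \<phi>"
proof -
  assume \<phi>: "\<phi> \<in> C n"
  interpret i: cyclic_module_morphism H M D D "id_semifunctor D"
    by (intro morphismI cyclic_module id_H_semifunctor[OF left_H_category_axioms])
  show ?thesis
    by (rule i.cochain_map_eqI[OF \<phi> \<phi>]) (simp add: map_chain_id)
qed

section \<open>The kernel of a morphism of double complexes\<close>

context dcomplex_morphism
begin

definition kernel :: "'v bicomplex"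
  where "kernel = \<lparr>entry = \<lambda>p q. {x \<in> entry E p q. F p q x = 0}, vert = vert E, horiz = horiz E\<rparr>"

lemma double_complex_kernel: "double_complex kernel"
proof -
  have "cvec.subspace {x \<in> entry E p q. F p q x = 0}" for p q
    using E.subspace_entry[of p q] vect_hom_0[OF F_hom E.subspace_entry] vect_hom_add[OF F_hom] vect_hom_scale[OF F_hom]
    by (auto simp: cvec.subspace_def)
  moreover have "F p (Suc q) (vert E p q x) = 0" "F (Suc p) q (horiz E p q x) = 0"
    if "x \<in> entry E p q" "F p q x = 0" for p q x
    using that by (simp_all add: F_vert F_horiz vect_hom_0[OF E'.vert_hom E'.subspace_entry]
        vect_hom_0[OF E'.horiz_hom E'.subspace_entry])
  ultimately show ?thesis
    unfolding double_complex_def kernel_def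
    using E.vert_hom E.horiz_hom by (auto simp: vect_hom_subsp E.vert_vert E.horiz_horiz E.vert_horiz)
qed

text \<open>The image of \<open>x\<close> vanishes as a cochain, so \<open>x\<close> is a cocycle of
  the kernel complex, whose columns are exact by hypothesis; a primitive found there is in
  particular one in \<open>E\<close>.\<close>

lemma kernel_coboundaries:
  assumes exact: "\<And>p q x. x \<in> entry E p q \<Longrightarrow> F p q x = 0 \<Longrightarrow> vert E p q x = 0 \<Longrightarrow>
      (if q = 0 then x = 0 else \<exists>y\<in>entry E p (q - 1). F p (q - 1) y = 0 \<and> x = vert E p (q - 1) y)"
    and x: "x \<in> tot_cocycles E n" "tot_map F n x = 0"
  shows "x \<in> tot_coboundaries E n"
proof -
  interpret K: dcomplex kernel by unfold_locales (rule double_complex_kernel)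
  have vh: "vert kernel = vert E" "horiz kernel = horiz E"
    by (simp_all add: kernel_def)
  have diff: "tot_diff kernel k = tot_diff E k" for k
    unfolding tot_diff_def[abs_def] vh ..
  have F0: "F p (n - p) (x p) = 0" if "p \<le> n" for p
    using fun_cong[OF x(2), of p] that by (simp add: tot_map_def)
  have "x \<in> tot_cocycles kernel n"
    using x(1) F0 unfolding tot_cocycles_def diff by (simp add: tot_def kernel_def)
  moreover have "tot_cocycles kernel n \<subseteq> tot_coboundaries kernel n"
  proof (rule K.cocycles_exact)
    fix p q x assume "x \<in> entry kernel p q" "vert kernel p q x = 0"
    then show "if q = 0 then x = 0 else \<exists>y\<in>entry kernel p (q - 1). x = vert kernel p (q - 1) y"
      using exact[of x p q] by (auto simp: kernel_def split: if_splits)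
  qed
  moreover have "tot_coboundaries kernel n \<subseteq> tot_coboundaries E n"
    unfolding tot_coboundaries_def diff by (auto simp: tot_def kernel_def)
  ultimately show ?thesis by blast
qed

end

section \<open>Inner automorphisms\<close>

text \<open>
  \<open>dbl D\<close> is the tensor product of \<open>D\<close> with the contractible groupoid on two objects: every
  object of \<open>D\<close> occurs twice, and the two copies are isomorphic through identities of \<open>D\<close>.
\<close>

definition dbl :: "('o, 'f, 'h) hcat \<Rightarrow> ('o \<times> bool, 'f, 'h) hcat"
  where "dbl D = \<lparr>Ob = Ob D \<times> UNIV, Hom = (\<lambda>X Y. Hom D (fst X) (fst Y)),
    Comp = (\<lambda>X Y Z. Comp D (fst X) (fst Y) (fst Z)), Id = (\<lambda>X. Id D (fst X)),
    Act = (\<lambda>X Y. Act D (fst X) (fst Y))\<rparr>"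

lemma dbl_simps [simp]:
  "Ob (dbl D) = Ob D \<times> UNIV" "Hom (dbl D) X Y = Hom D (fst X) (fst Y)"
  "Comp (dbl D) X Y Z = Comp D (fst X) (fst Y) (fst Z)" "Id (dbl D) X = Id D (fst X)"
  "Act (dbl D) X Y = Act D (fst X) (fst Y)"
  by (simp_all add: dbl_def)

definition incl :: "('o, 'f, 'h) hcat \<Rightarrow> bool \<Rightarrow> ('o, 'f, 'o \<times> bool, 'f) semifunctor"
  where "incl D s = semifunctor_on D (\<lambda>X. (X, s)) (\<lambda>X Y f. f)"

text \<open>\<open>untwist D \<eta>\<close> is the identity on the first copy of \<open>D\<close> and conjugation by \<open>\<eta>\<close> on the second.\<close>

definition twist :: "('o, 'f, 'h) hcat \<Rightarrow> ('o \<Rightarrow> 'f) \<Rightarrow> 'o \<times> bool \<Rightarrow> 'f"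
  where "twist D \<eta> X = (if snd X then \<eta> (fst X) else Id D (fst X))"

definition untwist :: "('o, 'f, 'h) hcat \<Rightarrow> ('o \<Rightarrow> 'f) \<Rightarrow> ('o \<times> bool, 'f, 'o, 'f) semifunctor"
  where "untwist D \<eta> = semifunctor_on (dbl D) fst (\<lambda>X Y f.
    Comp D (fst X) (fst X) (fst Y) (Comp D (fst X) (fst Y) (fst Y) (twist D \<eta> Y) f)
      (inv_arr D (fst X) (twist D \<eta> X)))"

text \<open>
  \<open>ins D r i c\<close> inserts the identity of \<open>X\<^sub>i\<^sub>+\<^sub>1\<close> after \<open>f\<^sup>i\<close> and relabels by \<open>r\<close> the objects
  \<open>X\<^sub>0\<close> and all those after the inserted arrow. With \<open>r\<close> the projection to the first copy these
  are the terms of a homotopy, and with \<open>r\<close> the identity and \<open>i = n\<close> one obtains a contraction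
  for \<open>b'\<close>.
\<close>

definition ins :: "('o, 'f, 'h) hcat \<Rightarrow> ('o \<times> bool \<Rightarrow> 'o \<times> bool) \<Rightarrow> nat \<Rightarrow> ('o \<times> bool, 'f) chain \<Rightarrow> ('o \<times> bool, 'f) chain"
  where "ins D r i c = mk_chain (length c)
    (\<lambda>k. if k = 0 then r (obj c 0) else if k \<le> Suc i then obj c k else r (obj c (k - 1)))
    (\<lambda>k. if k \<le> i then arr c k else if k = Suc i then Id D (fst (obj c k)) else arr c (k - 1))"

context left_H_category
begin

text \<open>On an invariant factor the leg of the coproduct acts by its counit, so the whole of
  \<open>h\<close> falls on the other factor.\<close>

lemma Act_Comp_right:
  assumes ob: "X \<in> Ob D" "Y \<in> Ob D" "Z \<in> Ob D" and fg: "f \<in> Hom D X Y" "g \<in> Hom D Y Z"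
    and f: "\<And>h. Act D X Y h f = \<epsilon> h *\<^sub>C f"
  shows "Act D X Z h (Comp D X Y Z g f) = Comp D X Y Z (Act D Y Z h g) f"
proof -
  have "Act D X Z h (Comp D X Y Z g f) = tensor_lift (\<lambda>a b. \<epsilon> b *\<^sub>C Comp D X Y Z (Act D Y Z a g) f) (\<Delta> h)"
    using Comp_linear_right[OF ob Act_closed[OF ob(2,3) fg(2)]] fg
    by (simp add: Act_Comp[OF ob fg] f vect_hom_subsp)
  also have "\<dots> = Comp D X Y Z (Act D Y Z h g) f"
    by (rule comult_counit_right, rule clinearI)
      (use Comp_linear_left[OF ob fg(1)] Act_linear_left[OF ob(2,3) fg(2)] in \<open>simp_all add: vect_hom_subsp\<close>)
  finally show ?thesis .
qed

lemma Act_Comp_left: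
  assumes ob: "X \<in> Ob D" "Y \<in> Ob D" "Z \<in> Ob D" and fg: "f \<in> Hom D X Y" "g \<in> Hom D Y Z"
    and g: "\<And>h. Act D Y Z h g = \<epsilon> h *\<^sub>C g"
  shows "Act D X Z h (Comp D X Y Z g f) = Comp D X Y Z g (Act D X Y h f)"
proof -
  have "Act D X Z h (Comp D X Y Z g f) = tensor_lift (\<lambda>a b. \<epsilon> a *\<^sub>C Comp D X Y Z g (Act D X Y b f)) (\<Delta> h)"
    using Comp_linear_left[OF ob Act_closed[OF ob(1,2) fg(1)]] fg
    by (simp add: Act_Comp[OF ob fg] g vect_hom_subsp)
  also have "\<dots> = Comp D X Y Z g (Act D X Y h f)"
    by (rule comult_counit_left, rule clinearI)
      (use Comp_linear_right[OF ob fg(2)] Act_linear_left[OF ob(1,2) fg(1)] in \<open>simp_all add: vect_hom_subsp\<close>)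
  finally show ?thesis .
qed

lemma inverse_in_unique:
  assumes X: "X \<in> Ob D" and f: "f \<in> Hom D X X" and "inverse_in D X f g" "inverse_in D X f g'"
  shows "g = g'"
proof -
  have g: "g \<in> Hom D X X" "Comp D X X X g f = Id D X" and g': "g' \<in> Hom D X X" "Comp D X X X f g' = Id D X"
    using assms(3,4) by (simp_all add: inverse_in_def)
  have "g = Comp D X X X g (Comp D X X X f g')"
    using X g g' by (simp add: Id_right)
  also have "\<dots> = Comp D X X X (Comp D X X X g f) g'"
    by (rule Comp_assoc[symmetric]) (use X f g g' in auto)
  also have "\<dots> = g'" using X g g' by (simp add: Id_left)
  finally show ?thesis .
qed

section \<open>Invariant units and conjugation\<close>

lemma inv_arr_eq: "X \<in> Ob D \<Longrightarrow> f \<in> Hom D X X \<Longrightarrow> inverse_in D X f g \<Longrightarrow> inv_arr D X f = g"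
  unfolding inv_arr_def by (rule the_equality) (auto intro: inverse_in_unique)

lemma inv_arr_Id: "X \<in> Ob D \<Longrightarrow> inv_arr D X (Id D X) = Id D X"
  by (rule inv_arr_eq) (simp_all add: inverse_in_def Id_closed Id_left)

lemma Id_invariant_unit: "(\<lambda>X. Id D X) \<in> invariant_units H D"
proof -
  have "inverse_in D X (Id D X) (Id D X)" if "X \<in> Ob D" for X
    using that by (simp add: inverse_in_def Id_closed Id_left)
  then show ?thesis
    by (auto simp: invariant_units_def Aut_def Id_closed Act_Id)
qed

text \<open>The inverse \<open>g\<close> of an invariant unit \<open>u\<close> is invariant too: h g
  = (h g)(u g) = ((h g) u) g = (h (g u)) g = \<epsilon>(h) g, where the third equality is
  \<open>Act_Comp_right\<close> for the invariant factor \<open>u\<close>.\<close>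

lemma unit_facts:
  assumes \<eta>: "\<eta> \<in> invariant_units H D" and X: "X \<in> Ob D"
  shows "\<eta> X \<in> Hom D X X" "inv_arr D X (\<eta> X) \<in> Hom D X X"
    and "Comp D X X X (\<eta> X) (inv_arr D X (\<eta> X)) = Id D X" "Comp D X X X (inv_arr D X (\<eta> X)) (\<eta> X) = Id D X"
    and "Act D X X h (\<eta> X) = \<epsilon> h *\<^sub>C \<eta> X" "Act D X X h (inv_arr D X (\<eta> X)) = \<epsilon> h *\<^sub>C inv_arr D X (\<eta> X)"
proof -
  from \<eta> X obtain g where u: "\<eta> X \<in> Hom D X X" and g: "inverse_in D X (\<eta> X) g"
    and inv: "\<And>h. Act D X X h (\<eta> X) = \<epsilon> h *\<^sub>C \<eta> X"
    unfolding invariant_units_def Aut_def by blast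
  have ig: "inv_arr D X (\<eta> X) = g" by (rule inv_arr_eq[OF X u g])
  have g': "g \<in> Hom D X X" "Comp D X X X (\<eta> X) g = Id D X" "Comp D X X X g (\<eta> X) = Id D X"
    using g by (simp_all add: inverse_in_def)
  have "Act D X X h g = Comp D X X X (Act D X X h g) (Comp D X X X (\<eta> X) g)"
    using X g' by (simp add: Id_right Act_closed)
  also have "\<dots> = Comp D X X X (Comp D X X X (Act D X X h g) (\<eta> X)) g"
    using X g' u by (simp add: Comp_assoc Act_closed)
  also have "Comp D X X X (Act D X X h g) (\<eta> X) = \<epsilon> h *\<^sub>C Id D X"
    using Act_Comp_right[OF X X X u g'(1) inv, of h, symmetric] by (simp add: g' Act_Id X)
  also have "Comp D X X X (\<epsilon> h *\<^sub>C Id D X) g = \<epsilon> h *\<^sub>C g"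
    using Comp_linear_left[OF X X X g'(1)] by (simp add: vect_hom_subsp Id_closed X Id_left g'(1))
  finally have act: "Act D X X h g = \<epsilon> h *\<^sub>C g" .
  show "\<eta> X \<in> Hom D X X" "inv_arr D X (\<eta> X) \<in> Hom D X X"
    "Comp D X X X (\<eta> X) (inv_arr D X (\<eta> X)) = Id D X" "Comp D X X X (inv_arr D X (\<eta> X)) (\<eta> X) = Id D X"
    "Act D X X h (\<eta> X) = \<epsilon> h *\<^sub>C \<eta> X" "Act D X X h (inv_arr D X (\<eta> X)) = \<epsilon> h *\<^sub>C inv_arr D X (\<eta> X)"
    by (simp_all add: ig u g' inv act)
qed

lemma left_H_category_dbl: "left_H_category H (dbl D)"
  by unfold_locales
    (auto simp: Hom_subspace Id_closed Comp_linear_left Comp_linear_right Comp_assoc Id_left Id_right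
      Act_linear_left Act_linear_right Act_one Act_mult Act_Id Act_Comp)

lemma incl_H_semifunctor: "H_semifunctor D (dbl D) (incl D s)"
  unfolding H_semifunctor_def incl_def semifunctor_on_idem
  by (auto simp: vect_hom_subsp Act_closed Comp_closed cvec.subspace_add[OF Hom_subspace] cvec.subspace_scale[OF Hom_subspace])

lemma twist_facts:
  assumes \<eta>: "\<eta> \<in> invariant_units H D" and X: "fst X \<in> Ob D"
  shows "twist D \<eta> X \<in> Hom D (fst X) (fst X)" "inv_arr D (fst X) (twist D \<eta> X) \<in> Hom D (fst X) (fst X)"
    and "Comp D (fst X) (fst X) (fst X) (inv_arr D (fst X) (twist D \<eta> X)) (twist D \<eta> X) = Id D (fst X)"
    and "Act D (fst X) (fst X) h (twist D \<eta> X) = \<epsilon> h *\<^sub>C twist D \<eta> X"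
    and "Act D (fst X) (fst X) h (inv_arr D (fst X) (twist D \<eta> X)) = \<epsilon> h *\<^sub>C inv_arr D (fst X) (twist D \<eta> X)"
  using unit_facts[OF \<eta> X] X
  by (simp_all add: twist_def inv_arr_Id Id_closed Id_left Act_Id)

lemma conj_hom:
  assumes ob: "X \<in> Ob D" "Y \<in> Ob D" and u: "u \<in> Hom D Y Y" "v \<in> Hom D X X"
  shows "(\<lambda>f. Comp D X X Y (Comp D X Y Y u f) v) \<in> vect_hom (subsp (Hom D X Y)) (subsp (Hom D X Y))"
  using Comp_linear_left[OF ob(1,1,2) u(2)] Comp_linear_right[OF ob(1,2,2) u(1)]
  by (simp add: vect_hom_subsp)

text \<open>In a composite the unit at the middle object meets its inverse and cancels.
  Compatibility with the action holds because the units and their inverses are invariant and so pass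
  through it.\<close>

lemma untwist_H_semifunctor:
  assumes \<eta>: "\<eta> \<in> invariant_units H D"
  shows "H_semifunctor (dbl D) D (untwist D \<eta>)"
proof -
  note t = twist_facts[OF \<eta>]
  interpret E: left_H_category H "dbl D" by (rule left_H_category_dbl)
  let ?cj = "\<lambda>X Y f. Comp D (fst X) (fst X) (fst Y) (Comp D (fst X) (fst Y) (fst Y) (twist D \<eta> Y) f)
      (inv_arr D (fst X) (twist D \<eta> X))"
  have hom: "?cj X Y \<in> vect_hom (subsp (Hom D (fst X) (fst Y))) (subsp (Hom D (fst X) (fst Y)))"
    if "fst X \<in> Ob D" "fst Y \<in> Ob D" for X Y
    using that by (intro conj_hom t)
  have act: "?cj X Y (Act D (fst X) (fst Y) h f) = Act D (fst X) (fst Y) h (?cj X Y f)"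
    if "fst X \<in> Ob D" "fst Y \<in> Ob D" "f \<in> Hom D (fst X) (fst Y)" for X Y f h
    using that by (simp add: Act_Comp_right Act_Comp_left t Comp_closed)
  have comp: "?cj X Z (Comp D (fst X) (fst Y) (fst Z) g f) = Comp D (fst X) (fst Y) (fst Z) (?cj Y Z g) (?cj X Y f)"
    if ob: "fst X \<in> Ob D" "fst Y \<in> Ob D" "fst Z \<in> Ob D"
      and fg: "f \<in> Hom D (fst X) (fst Y)" "g \<in> Hom D (fst Y) (fst Z)" for X Y Z f g
  proof -
    let ?X = "fst X" and ?Y = "fst Y" and ?Z = "fst Z"
    let ?v = "inv_arr D ?Y (twist D \<eta> Y)" and ?w = "inv_arr D ?X (twist D \<eta> X)"
    have "Comp D ?X ?Y ?Z (?cj Y Z g) (?cj X Y f) =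
        Comp D ?X ?Y ?Z (Comp D ?Y ?Z ?Z (twist D \<eta> Z) g) (Comp D ?X ?Y ?Y ?v (?cj X Y f))"
      using ob fg by (simp add: Comp_assoc t Comp_closed)
    also have "Comp D ?X ?Y ?Y ?v (?cj X Y f) = Comp D ?X ?X ?Y (Comp D ?X ?Y ?Y ?v (Comp D ?X ?Y ?Y (twist D \<eta> Y) f)) ?w"
      using ob fg by (simp add: Comp_assoc t Comp_closed)
    also have "Comp D ?X ?Y ?Y ?v (Comp D ?X ?Y ?Y (twist D \<eta> Y) f) = Comp D ?X ?Y ?Y (Comp D ?Y ?Y ?Y ?v (twist D \<eta> Y)) f"
      by (rule Comp_assoc[symmetric]) (use ob fg t in auto)
    also have "\<dots> = f"
      using ob fg by (simp only: t(3) Id_left)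
    finally show ?thesis
      using ob fg by (simp add: Comp_assoc t Comp_closed)
  qed
  show ?thesis
    unfolding H_semifunctor_def untwist_def semifunctor_on_idem
    using hom act[of "(X, s)" "(Y, s')" for X Y s s', simplified]
      comp[of "(X, s)" "(Y, s')" "(Z, s'')" for X Y Z s s' s'', simplified]
    by (auto simp: vect_hom_subsp Act_closed Comp_closed cvec.subspace_add[OF Hom_subspace]
        cvec.subspace_scale[OF Hom_subspace])
qed

lemma inner_automorphism_eq: "inner_automorphism D \<eta> = comp_semifunctor D (untwist D \<eta>) (incl D True)"
  unfolding inner_automorphism_def comp_semifunctor_def untwist_def incl_def
  by (auto simp: semifunctor_on_def fun_eq_iff twist_def)

lemma id_semifunctor_eq: "id_semifunctor D = comp_semifunctor D (untwist D \<eta>) (incl D False)"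
  unfolding id_semifunctor_def comp_semifunctor_def untwist_def incl_def
  by (auto simp: semifunctor_on_def fun_eq_iff twist_def inv_arr_Id Id_left Id_right)

lemma id_semifunctor_eq_Id: "id_semifunctor D = comp_semifunctor D (untwist D (Id D)) (incl D s)"
  unfolding id_semifunctor_def comp_semifunctor_def untwist_def incl_def
  by (auto simp: semifunctor_on_def fun_eq_iff twist_def inv_arr_Id Id_left Id_right)

lemma inner_H_automorphism:
  assumes \<eta>: "\<eta> \<in> invariant_units H D"
  shows "H_automorphism D (inner_automorphism D \<eta>)"
proof -
  note u = unit_facts[OF \<eta>]
  have "H_semifunctor D D (inner_automorphism D \<eta>)"
    unfolding inner_automorphism_eq
    by (rule comp_H_semifunctor[OF left_H_category_axioms incl_H_semifunctor untwist_H_semifunctor[OF \<eta>]])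
  moreover have "arr_map (inner_automorphism D \<eta>) X X (Id D X) = Id D (obj_map (inner_automorphism D \<eta>) X)"
    if "X \<in> Ob D" for X
    using that by (simp add: inner_automorphism_def Id_closed Id_right u)
  moreover have "bij_betw (obj_map (inner_automorphism D \<eta>)) (Ob D) (Ob D)"
    by (rule bij_betw_cong[THEN iffD2, OF _ bij_betw_id]) (simp add: inner_automorphism_def)
  moreover have "bij_betw (arr_map (inner_automorphism D \<eta>) X Y) (Hom D X Y)
      (Hom D (obj_map (inner_automorphism D \<eta>) X) (obj_map (inner_automorphism D \<eta>) Y))"
    if ob: "X \<in> Ob D" "Y \<in> Ob D" for X Y
  proof (rule bij_betw_byWitness[where f' = "\<lambda>f. Comp D X X Y (Comp D X Y Y (inv_arr D Y (\<eta> Y)) f) (\<eta> X)"])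
    let ?v = "inv_arr D Y (\<eta> Y)" and ?w = "inv_arr D X (\<eta> X)"
    \<comment> \<open>The inverse of conjugation by \<open>\<eta>\<close> is conjugation by the
      inverses. Stated for arbitrary pairs \<open>p\<close>, \<open>q\<close> and \<open>r\<close>,
      \<open>s\<close>, the cancellation serves both composites, with the roles of unit and inverse
      exchanged.\<close>
    have cancel: "Comp D X X Y (Comp D X Y Y p (Comp D X X Y (Comp D X Y Y q f) r)) s = f"
      if "p \<in> Hom D Y Y" "q \<in> Hom D Y Y" "r \<in> Hom D X X" "s \<in> Hom D X X" "f \<in> Hom D X Y"
        and pq: "Comp D Y Y Y p q = Id D Y" and rs: "Comp D X X X r s = Id D X" for p q r s f
    proof -
      have assoc: "Comp D X X Y (Comp D X Y Y p (Comp D X X Y g r)) s = Comp D X Y Y p (Comp D X X Y g (Comp D X X X r s))"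
        if "g \<in> Hom D X Y" for g
        using ob that \<open>p \<in> _\<close> \<open>r \<in> _\<close> \<open>s \<in> _\<close> by (simp add: Comp_assoc Comp_closed)
      have "Comp D X X Y (Comp D X Y Y p (Comp D X X Y (Comp D X Y Y q f) r)) s =
          Comp D X Y Y p (Comp D X X Y (Comp D X Y Y q f) (Comp D X X X r s))"
        by (rule assoc, rule Comp_closed) (use ob that in auto)
      also have "Comp D X X Y (Comp D X Y Y q f) (Comp D X X X r s) = Comp D X Y Y q f"
        unfolding rs by (rule Id_right) (use ob that in \<open>auto intro: Comp_closed\<close>)
      also have "Comp D X Y Y p (Comp D X Y Y q f) = Comp D X Y Y (Comp D Y Y Y p q) f"
        by (rule Comp_assoc[symmetric]) (use ob that in auto)
      finally show ?thesis using ob that(5) by (simp add: pq Id_left)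
    qed
    show "\<forall>f\<in>Hom D X Y. Comp D X X Y (Comp D X Y Y ?v (arr_map (inner_automorphism D \<eta>) X Y f)) (\<eta> X) = f"
      using ob u[OF ob(1)] u[OF ob(2)] by (auto simp: inner_automorphism_def intro!: cancel)
    have closed: "Comp D X X Y (Comp D X Y Y ?v f) (\<eta> X) \<in> Hom D X Y" if "f \<in> Hom D X Y" for f
      using ob that u[OF ob(1)] u[OF ob(2)] by (intro Comp_closed)
    show "\<forall>f\<in>Hom D (obj_map (inner_automorphism D \<eta>) X) (obj_map (inner_automorphism D \<eta>) Y).
        arr_map (inner_automorphism D \<eta>) X Y (Comp D X X Y (Comp D X Y Y ?v f) (\<eta> X)) = f"
      using ob u[OF ob(1)] u[OF ob(2)] closed by (auto simp: inner_automorphism_def intro!: cancel)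
    show "arr_map (inner_automorphism D \<eta>) X Y ` Hom D X Y \<subseteq>
        Hom D (obj_map (inner_automorphism D \<eta>) X) (obj_map (inner_automorphism D \<eta>) Y)"
      using ob u[OF ob(1)] u[OF ob(2)] by (auto simp: inner_automorphism_def intro!: Comp_closed)
    show "(\<lambda>f. Comp D X X Y (Comp D X Y Y ?v f) (\<eta> X)) `
        Hom D (obj_map (inner_automorphism D \<eta>) X) (obj_map (inner_automorphism D \<eta>) Y) \<subseteq> Hom D X Y"
      using ob closed by (auto simp: inner_automorphism_def)
  qed
  ultimately show ?thesis by (simp add: H_automorphism_def)
qed

lemma merge_last_simps:
  assumes c: "c \<in> hom_chains D (Suc n)"
  shows "length (merge_last D h c) = Suc n"
    and "k \<le> Suc n \<Longrightarrow> obj (merge_last D h c) k = (if k = 0 then obj c (Suc n) else obj c k)"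
    and "k \<le> n \<Longrightarrow> arr (merge_last D h c) k =
      (if k = 0 then Comp D (obj c 1) (obj c 0) (obj c (Suc n)) (Act D (obj c 0) (obj c (Suc n)) h (arr c (Suc n))) (arr c 0)
       else arr c k)"
  by (simp_all add: merge_last_eq[OF hom_chains_length[OF c]] obj_mk_chain_cyclic)

lemma merge_last_hom: "c \<in> hom_chains D (Suc n) \<Longrightarrow> merge_last D h c \<in> hom_chains D n"
  unfolding merge_0_rotate[symmetric] by (intro merge_hom rotate_hom) simp_all

subsection \<open>Inserting identities\<close>

context
  fixes r :: "'o \<times> bool \<Rightarrow> 'o \<times> bool"
  assumes r: "\<And>X. fst (r X) = fst X"
begin

interpretation E: left_H_category H "dbl D" by (rule left_H_category_dbl)

lemma ins_simps:
  assumes c: "c \<in> hom_chains (dbl D) n" and i: "i \<le> n"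
  shows "length (ins D r i c) = Suc (Suc n)"
    and "k \<le> Suc (Suc n) \<Longrightarrow> obj (ins D r i c) k =
      (if k = 0 then r (obj c 0) else if k \<le> Suc i then obj c k else r (obj c (k - 1)))"
    and "k \<le> Suc n \<Longrightarrow> arr (ins D r i c) k =
      (if k \<le> i then arr c k else if k = Suc i then Id D (fst (obj c k)) else arr c (k - 1))"
  using i by (simp_all add: ins_def hom_chains_length[OF c] obj_mk_chain_cyclic hom_chains_wrap[OF c])

text \<open>The inserted identity is the isomorphism from the relabelled copy of
  \<open>X_(i+1)\<close> to the original one. Hom spaces of \<open>dbl D\<close> depend on the first
  components alone, so any \<open>r\<close> preserving these yields a chain.\<close>

lemma ins_hom:
  assumes c: "c \<in> hom_chains (dbl D) n" and i: "i \<le> n"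
  shows "ins D r i c \<in> hom_chains (dbl D) (Suc n)"
proof (rule hom_chainsI)
  have ob: "fst (obj c k) \<in> Ob D" if "k \<le> Suc n" for k
    using hom_chains_obj[OF c that] by auto
  fix k assume k: "k \<le> Suc n"
  show "obj (ins D r i c) k \<in> Ob (dbl D)"
    using k ob by (auto simp: ins_simps[OF c i] mem_Times_iff r)
  consider "k \<le> i" | "k = Suc i" | "Suc i < k" by linarith
  then show "arr (ins D r i c) k \<in> Hom (dbl D) (obj (ins D r i c) (Suc k)) (obj (ins D r i c) k)"
  proof cases
    case 1
    then show ?thesis
      using k i hom_chains_arr[OF c, of k] by (cases k) (simp_all add: ins_simps[OF c i] r)
  next
    case 2
    then show ?thesis
      using k i ob[of k] by (simp add: ins_simps[OF c i] r Id_closed)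
  next
    case 3
    then show ?thesis
      using k i hom_chains_arr[OF c, of "k - 1"] by (simp add: ins_simps[OF c i] r)
  qed
qed (rule ins_simps(1)[OF c i])

lemma multi_ins:
  assumes i: "i \<le> n"
  shows "multi (dbl D) n (dbl D) (Suc n) (ins D r i)"
  unfolding multi_def
proof (intro ballI conjI allI impI)
  fix c assume c: "c \<in> hom_chains (dbl D) n"
  show "ins D r i c \<in> hom_chains (dbl D) (Suc n)" by (rule ins_hom[OF c i])
  fix j assume j: "j \<le> n"
  note s = ins_simps[OF c i] ins_simps[OF set_arr_hom[OF c j] i] hom_chains_length[OF c]
  define k where "k = (if j \<le> i then j else Suc j)"
  have k: "k \<le> Suc n" using i j by (simp add: k_def)
  have "ins D r i (set_arr c j f) = set_arr (ins D r i c) k f" if "f \<in> Hom (dbl D) (obj c (Suc j)) (obj c j)" for f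
    by (rule chain_eqI[of _ "Suc n"]) (use i j k that in \<open>auto simp: s k_def\<close>)
  moreover have "Hom (dbl D) (obj (ins D r i c) (Suc k)) (obj (ins D r i c) k) = Hom (dbl D) (obj c (Suc j)) (obj c j)"
    using i j by (auto simp: s k_def r)
  ultimately show "\<exists>k\<le>Suc n. \<exists>l\<in>vect_hom (subsp (Hom (dbl D) (obj c (Suc j)) (obj c j)))
        (subsp (Hom (dbl D) (obj (ins D r i c) (Suc k)) (obj (ins D r i c) k))).
      \<forall>f\<in>Hom (dbl D) (obj c (Suc j)) (obj c j). ins D r i (set_arr c j f) = set_arr (ins D r i c) k (l f)"
    using k by (intro exI[of _ k] conjI bexI[of _ "\<lambda>f. f"]) (simp_all only: vect_hom_ident, blast)
qed

text \<open>The leg that falls on the inserted identity contributes only its counit. Thus the legs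
  of \<open>f^i\<close> and of the identity together have the effect of a single leg on
  \<open>f^i\<close>, which is \<open>sweedler_insert\<close> at \<open>p = i\<close>.\<close>

lemma equivariant_ins:
  assumes i: "i \<le> n"
  shows "equivariant H (dbl D) n (dbl D) (Suc n) (ins D r i)"
  unfolding equivariant_def
proof (intro allI ballI impI)
  fix K :: "('o \<times> bool, 'f) chain \<Rightarrow> complex" and h c
  assume c: "c \<in> hom_chains (dbl D) n" and K: "chain_linear (dbl D) (Suc n) K"
  define q where "q = n - i"
  have n: "n = i + q" using i by (simp add: q_def)
  have ic: "ins D r i c \<in> hom_chains (dbl D) (Suc n)" by (rule ins_hom[OF c i])
  have mlin: "mlin (Suc n) (\<lambda>hs. K (ins D r i (act_chain (dbl D) hs c)))"
    by (rule E.mlin_act_chain[OF chain_linear_comp[OF K multi_ins[OF i] E.Hom_subspace] c])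
  have "sweedler H (i + Suc (Suc q)) h (\<lambda>hs. K (act_chain (dbl D) hs (ins D r i c))) =
      sweedler H (i + Suc q) h (\<lambda>hs. K (ins D r i (act_chain (dbl D) hs c)))"
  proof (rule sweedler_insert)
    show "mlin (i + Suc (Suc q)) (\<lambda>hs. K (act_chain (dbl D) hs (ins D r i c)))"
      using E.mlin_act_chain[OF K ic] by (simp add: n)
    show "mlin (i + Suc q) (\<lambda>hs. K (ins D r i (act_chain (dbl D) hs c)))"
      using mlin by (simp add: n)
    fix xs ys :: "'h list" and d :: 'h
    assume len: "length xs = i" "length ys = q"
    have "K (act_chain (dbl D) (xs @ a # b # ys) (ins D r i c)) =
        \<epsilon> b *\<^sub>C K (ins D r i (act_chain (dbl D) (xs @ a # ys) c))" for a b
    proof -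
      let ?c = "act_chain (dbl D) (xs @ a # ys) c"
      let ?C = "ins D r i ?c"
      have c': "?c \<in> hom_chains (dbl D) n" by (rule E.act_chain_hom[OF c])
      have C: "?C \<in> hom_chains (dbl D) (Suc n)" by (rule ins_hom[OF c' i])
      note s = ins_simps[OF c i] ins_simps[OF c' i] E.act_chain_simps[OF c] E.act_chain_simps[OF ic]
      let ?I = "Id D (fst (obj c (Suc i)))"
      have I: "arr ?C (Suc i) = ?I" using i by (simp add: s)
      have ob: "fst (obj c k) \<in> Ob D" if "k \<le> Suc n" for k
        using hom_chains_obj[OF c that] by auto
      have "act_chain (dbl D) (xs @ a # b # ys) (ins D r i c) = set_arr ?C (Suc i) (\<epsilon> b *\<^sub>C ?I)"
      proof (rule chain_eqI[of _ "Suc n"])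
        fix k assume k: "k \<le> Suc n"
        show "obj (act_chain (dbl D) (xs @ a # b # ys) (ins D r i c)) k = obj (set_arr ?C (Suc i) (\<epsilon> b *\<^sub>C ?I)) k"
          using k i by (simp add: s)
        consider "k < i" | "k = i" | "k = Suc i" | l where "k = Suc (Suc (i + l))"
          by (metis less_imp_Suc_add linorder_neqE_nat add_Suc_right Suc_lessI)
        then show "arr (act_chain (dbl D) (xs @ a # b # ys) (ins D r i c)) k = arr (set_arr ?C (Suc i) (\<epsilon> b *\<^sub>C ?I)) k"
          by cases (use k i len ob[of "Suc i"] in \<open>simp_all add: s r nth_append Act_Id\<close>)
      qed (simp_all add: s)
      moreover have "?I \<in> Hom (dbl D) (obj ?C (Suc (Suc i))) (obj ?C (Suc i))"
        using i ob[of "Suc i"] by (simp add: s r Id_closed)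
      ultimately have "K (act_chain (dbl D) (xs @ a # b # ys) (ins D r i c)) = \<epsilon> b *\<^sub>C K (set_arr ?C (Suc i) ?I)"
        using chain_linear_vect_hom[OF K C, of "Suc i"] E.chain_subspace[OF C, of "Suc i"] i
        by (simp add: vect_hom_subsp)
      then show ?thesis
        unfolding I[symmetric] using i by (subst (asm) set_arr_arr) (simp_all add: s)
    qed
    moreover have "clinear (\<lambda>a. K (ins D r i (act_chain (dbl D) (xs @ a # ys) c)))"
      by (rule mlinD[OF mlin]) (simp add: len n)
    ultimately show "K (ins D r i (act_chain (dbl D) (xs @ d # ys) c)) =
        tensor_lift (\<lambda>a b. K (act_chain (dbl D) (xs @ a # b # ys) (ins D r i c))) (\<Delta> d)"
      by (simp add: comult_counit_right)
  qed
  then show "sweedler H (Suc (Suc n)) h (\<lambda>hs. K (act_chain (dbl D) hs (ins D r i c))) =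
      sweedler H (Suc n) h (\<lambda>hs. K (ins D r i (act_chain (dbl D) hs c)))"
    by (simp add: n)
qed

text \<open>This and the next five lemmas supply the input of \<open>homotopy_double_sum\<close>:
  commutation below and above the inserted arrow, equality across the diagonal, and the two ends,
  the last coface being treated through \<open>merge_last\<close>.\<close>

lemma merge_ins_below:
  assumes c: "c \<in> hom_chains (dbl D) (Suc n)" and ij: "j \<le> i" "i \<le> n"
  shows "merge (dbl D) j (ins D r (Suc i) c) = ins D r i (merge (dbl D) j c)"
proof -
  have i: "Suc i \<le> Suc n" and j: "j \<le> n" "j \<le> Suc n" using ij by auto
  note s = E.merge_simps[OF ins_hom[OF c i] j(2)] ins_simps[OF c i]
    ins_simps[OF E.merge_hom[OF c j(1)] ij(2)] E.merge_simps[OF c j(1)]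
  show ?thesis
  proof (rule chain_eqI[of _ "Suc n"])
    fix k assume k: "k \<le> Suc n"
    consider "k = 0" | "0 < k" "k \<le> j" | "j < k" "k \<le> Suc i" | "Suc i < k"
      by linarith
    then show "obj (merge (dbl D) j (ins D r (Suc i) c)) k = obj (ins D r i (merge (dbl D) j c)) k"
      by cases (use k ij in \<open>auto simp: s\<close>)
    consider "k < j" | "k = j" | "j < k" "k \<le> i" | "j < k" "k = Suc i" | "j < k" "Suc i < k"
      by linarith
    then show "arr (merge (dbl D) j (ins D r (Suc i) c)) k = arr (ins D r i (merge (dbl D) j c)) k"
      by cases (use k ij in \<open>auto simp: s r\<close>)
  qed (simp_all add: s)
qed

lemma merge_ins_above:
  assumes c: "c \<in> hom_chains (dbl D) (Suc n)" and ij: "i < j" "j \<le> n"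
  shows "merge (dbl D) (Suc j) (ins D r i c) = ins D r i (merge (dbl D) j c)"
proof -
  have i: "i \<le> n" "i \<le> Suc n" and j: "Suc j \<le> Suc n" using ij by auto
  note s = E.merge_simps[OF ins_hom[OF c i(2)] j] ins_simps[OF c i(2)]
    ins_simps[OF E.merge_hom[OF c ij(2)] i(1)] E.merge_simps[OF c ij(2)]
  show ?thesis
  proof (rule chain_eqI[of _ "Suc n"])
    fix k assume k: "k \<le> Suc n"
    show "obj (merge (dbl D) (Suc j) (ins D r i c)) k = obj (ins D r i (merge (dbl D) j c)) k"
      by (cases k) (use k ij in \<open>auto simp: s\<close>)
    consider "k \<le> i" | "k = Suc i" | "Suc i < k" "k \<le> j" | "k = Suc j" | "Suc j < k"
      by linarith
    then show "arr (merge (dbl D) (Suc j) (ins D r i c)) k = arr (ins D r i (merge (dbl D) j c)) k"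
      by cases (use k ij in \<open>auto simp: s r\<close>)
  qed (simp_all add: s)
qed

lemma merge_ins_diag:
  assumes c: "c \<in> hom_chains (dbl D) n" and i: "i < n"
  shows "merge (dbl D) (Suc i) (ins D r i c) = merge (dbl D) (Suc i) (ins D r (Suc i) c)"
proof -
  have i': "i \<le> n" "Suc i \<le> n" using i by auto
  note s = E.merge_simps[OF ins_hom[OF c i'(1)] i'(2)] E.merge_simps[OF ins_hom[OF c i'(2)] i'(2)]
    ins_simps[OF c i'(1)] ins_simps[OF c i'(2)]
  have f: "arr c (Suc i) \<in> Hom D (fst (obj c (Suc (Suc i)))) (fst (obj c (Suc i)))"
    "fst (obj c (Suc i)) \<in> Ob D" "fst (obj c (Suc (Suc i))) \<in> Ob D"
    using hom_chains_arr[OF c i'(2)] hom_chains_obj[OF c, of "Suc i"] hom_chains_obj[OF c, of "Suc (Suc i)"] i'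
    by (auto simp: mem_Times_iff)
  show ?thesis
  proof (rule chain_eqI[of _ n])
    fix k assume k: "k \<le> n"
    show "obj (merge (dbl D) (Suc i) (ins D r i c)) k = obj (merge (dbl D) (Suc i) (ins D r (Suc i) c)) k"
      using k i by (auto simp: s)
    consider "k \<le> i" | "k = Suc i" | "Suc i < k" by linarith
    then show "arr (merge (dbl D) (Suc i) (ins D r i c)) k = arr (merge (dbl D) (Suc i) (ins D r (Suc i) c)) k"
      by cases (use k i f in \<open>simp_all add: s r Id_left Id_right\<close>)
  qed (simp_all add: s)
qed

text \<open>One end of the homotopy: the only object left in its original copy by insertion at 0 is
  \<open>X_1\<close>, and the composition removes it. With \<open>r\<close> the projection the
  result lies wholly in the first copy.\<close>

lemma merge_0_ins_0:
  assumes c: "c \<in> hom_chains (dbl D) n"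
  shows "merge (dbl D) 0 (ins D r 0 c) = mk_chain n (\<lambda>k. r (obj c k)) (arr c)"
proof -
  note s = E.merge_simps[OF ins_hom[OF c le0] le0] ins_simps[OF c le0]
  have f: "arr c 0 \<in> Hom D (fst (obj c (Suc 0))) (fst (obj c 0))"
    "fst (obj c 0) \<in> Ob D" "fst (obj c (Suc 0)) \<in> Ob D"
    using hom_chains_arr[OF c le0] hom_chains_obj[OF c, of 0] hom_chains_obj[OF c, of "Suc 0"]
    by (auto simp: mem_Times_iff)
  show ?thesis
    by (rule chain_eqI[of _ n]) (use f in \<open>auto simp: s r Id_right\<close>)
qed

text \<open>The length of \<open>c\<close> is \<open>n + 2\<close> while \<open>i \<le> n\<close>,
  so the insertion is not behind the last arrow and that arrow is still the one moved.\<close>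

lemma merge_last_ins:
  assumes c: "c \<in> hom_chains (dbl D) (Suc n)" and i: "i \<le> n"
  shows "merge_last (dbl D) h (ins D r i c) = ins D r i (merge_last (dbl D) h c)"
proof -
  have i': "i \<le> Suc n" using i by simp
  note s = E.merge_last_simps[OF ins_hom[OF c i']] ins_simps[OF c i'] ins_simps[OF E.merge_last_hom[OF c] i]
    E.merge_last_simps[OF c]
  show ?thesis
  proof (rule chain_eqI[of _ "Suc n"])
    fix k assume k: "k \<le> Suc n"
    show "obj (merge_last (dbl D) h (ins D r i c)) k = obj (ins D r i (merge_last (dbl D) h c)) k"
      using k i by (auto simp: s)
    show "arr (merge_last (dbl D) h (ins D r i c)) k = arr (ins D r i (merge_last (dbl D) h c)) k"
      using k i by (auto simp: s r)
  qed (simp_all add: s)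
qed

text \<open>The other end: only the front object has been relabelled, and moving the inserted
  identity to the front and composing it with \<open>f^0\<close> restores that object. The identity
  is invariant, whence the factor \<open>\<epsilon> h\<close>.\<close>

lemma merge_last_ins_last:
  assumes c: "c \<in> hom_chains (dbl D) n"
  shows "merge_last (dbl D) h (ins D r n c) = set_arr c 0 (\<epsilon> h *\<^sub>C arr c 0)"
proof -
  note s = E.merge_last_simps[OF ins_hom[OF c order_refl]] ins_simps[OF c order_refl] hom_chains_length[OF c]
  have f: "arr c 0 \<in> Hom D (fst (obj c (Suc 0))) (fst (obj c 0))"
    "fst (obj c 0) \<in> Ob D" "fst (obj c (Suc 0)) \<in> Ob D"
    using hom_chains_arr[OF c le0] hom_chains_obj[OF c, of 0] hom_chains_obj[OF c, of "Suc 0"]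
    by (auto simp: mem_Times_iff)
  have "Comp D (fst (obj c (Suc 0))) (fst (obj c 0)) (fst (obj c 0)) (Act D (fst (obj c 0)) (fst (obj c 0)) h (Id D (fst (obj c 0)))) (arr c 0)
      = \<epsilon> h *\<^sub>C arr c 0"
    using Comp_linear_left[OF f(3,2,2,1)] f by (simp add: Act_Id vect_hom_subsp Id_closed Id_left)
  then show ?thesis
    by (intro chain_eqI[of _ n]) (auto simp: s r hom_chains_wrap[OF c])
qed

end

text \<open>Without relabelling, composing \<open>f^n\<close> with the identity behind it undoes the
  insertion; this is the extra degeneracy that contracts \<open>b'\<close>.\<close>

lemma merge_ins_last_ident:
  assumes c: "c \<in> hom_chains (dbl D) n"
  shows "merge (dbl D) n (ins D (\<lambda>X. X) n c) = c"
proof -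
  interpret E: left_H_category H "dbl D" by (rule left_H_category_dbl)
  note s = E.merge_simps[OF ins_hom[OF refl c order_refl] order_refl] ins_simps[OF refl c order_refl]
  have f: "arr c n \<in> Hom D (fst (obj c (Suc n))) (fst (obj c n))"
    "fst (obj c n) \<in> Ob D" "fst (obj c (Suc n)) \<in> Ob D"
    using hom_chains_arr[OF c order_refl] hom_chains_obj[OF c, of n] hom_chains_obj[OF c, of "Suc n"]
    by (auto simp: mem_Times_iff)
  show ?thesis
    by (rule chain_eqI[of _ n]) (use f in \<open>auto simp: s Id_right hom_chains_length[OF c]\<close>)
qed

end

section \<open>Exactness of the kernel of restriction to the first copy\<close>

context cyclic_module
begin

lemma cyclic_module_dbl: "cyclic_module H M (dbl D)"
  by (intro cyclic_module.intro sayd_module_axioms left_H_category_dbl)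

interpretation E: cyclic_module H M "dbl D" by (rule cyclic_module_dbl)

interpretation i: cyclic_module_morphism H M D "dbl D" "incl D s" for s
  by (intro morphismI cyclic_module_dbl incl_H_semifunctor)

abbreviation CE :: "nat \<Rightarrow> ('m, 'o \<times> bool, 'f) cochain set"
  where "CE n \<equiv> cochains H M (dbl D) n"

definition flat :: "nat \<Rightarrow> ('o \<times> bool, 'f) chain \<Rightarrow> bool"
  where "flat n c \<longleftrightarrow> (\<forall>k\<le>n. \<not> snd (obj c k))"

text \<open>A chain of \<open>dbl D\<close> with all objects in the first copy is the image of a
  unique chain of \<open>D\<close>, so restricting a cochain to \<open>D\<close> means evaluating it
  on such chains.\<close>

lemma incl_kernel_iff:
  assumes \<phi>: "\<phi> \<in> CE n"
  shows "cochain_map D (dbl D) (incl D False) n \<phi> = 0 \<longleftrightarrow>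
    (\<forall>m. \<forall>c\<in>hom_chains (dbl D) n. flat n c \<longrightarrow> \<phi> (elementary (dbl D) n m c) = 0)"
proof
  assume 0: "cochain_map D (dbl D) (incl D False) n \<phi> = 0"
  show "\<forall>m. \<forall>c\<in>hom_chains (dbl D) n. flat n c \<longrightarrow> \<phi> (elementary (dbl D) n m c) = 0"
  proof (intro allI ballI impI)
    fix m c assume c: "c \<in> hom_chains (dbl D) n" and flat: "flat n c"
    let ?c = "mk_chain n (\<lambda>k. fst (obj c k)) (arr c)"
    have ob: "fst (obj c k) \<in> Ob D" if "k \<le> Suc n" for k
      using hom_chains_obj[OF c that] by auto
    have c': "?c \<in> hom_chains D n"
      using hom_chains_arr[OF c] by (intro mk_chain_hom) (simp_all add: ob hom_chains_wrap[OF c])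
    have "map_chain (incl D False) ?c = c"
    proof (rule chain_eqI[of _ n])
      fix k assume k: "k \<le> n"
      have obj': "obj ?c j = fst (obj c j)" if "j \<le> Suc n" for j
        using that by (intro obj_mk_chain_cyclic) (simp_all add: hom_chains_wrap[OF c])
      show "obj (map_chain (incl D False) ?c) k = obj c k"
        using k flat ob[of k] by (simp add: map_chain_simps[OF c'] incl_def flat_def prod_eq_iff)
      show "arr (map_chain (incl D False) ?c) k = arr c k"
        using k ob[of k] ob[of "Suc k"] hom_chains_arr[OF c, of k]
        by (simp add: map_chain_simps[OF c'] incl_def obj')
    qed (simp_all add: map_chain_simps[OF c'] hom_chains_length[OF c])
    then show "\<phi> (elementary (dbl D) n m c) = 0"
      using i.cochain_map_elementary[OF \<phi> c', of False m] 0 by simp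
  qed
next
  assume 0: "\<forall>m. \<forall>c\<in>hom_chains (dbl D) n. flat n c \<longrightarrow> \<phi> (elementary (dbl D) n m c) = 0"
  show "cochain_map D (dbl D) (incl D False) n \<phi> = 0"
  proof (rule i.cochain_map_eqI[OF \<phi>])
    show "0 \<in> C n" by (rule cvec.subspace_0[OF subspace_cochains])
    fix m c assume c: "c \<in> hom_chains D n"
    have "flat n (map_chain (incl D False) c)"
      using hom_chains_obj[OF c] by (simp add: flat_def map_chain_simps[OF c] incl_def)
    then show "0 (elementary D n m c) = \<phi> (elementary (dbl D) n m (map_chain (incl D False) c))"
      using 0 map_chain_hom[OF incl_H_semifunctor c] by simp
  qed
qed

text \<open>Insertion operators therefore preserve the kernel, both for the projection and for the
  identity in place of \<open>r\<close>.\<close>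

lemma flat_ins:
  assumes "c \<in> hom_chains (dbl D) n" "i \<le> n" "flat n c"
    and r: "\<And>X. fst (r X) = fst X" "\<And>X. \<not> snd X \<Longrightarrow> \<not> snd (r X)"
  shows "flat (Suc n) (ins D r i c)"
proof -
  have "\<not> snd (obj c k)" if "k \<le> Suc n" for k
    using that assms(3) hom_chains_wrap[OF assms(1)] by (cases "k = Suc n") (simp_all add: flat_def)
  then show ?thesis
    unfolding flat_def using assms by (simp add: ins_simps[OF r(1) assms(1,2)])
qed

definition ins_op :: "('o \<times> bool \<Rightarrow> 'o \<times> bool) \<Rightarrow> nat \<Rightarrow> nat \<Rightarrow>
    ('m, 'o \<times> bool, 'f) cochain \<Rightarrow> ('m, 'o \<times> bool, 'f) cochain"
  where "ins_op r n i = pullback (dbl D) n (dbl D) (Suc n) (ins D r i)"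

lemma ins_op_cochain:
  assumes "\<And>X. fst (r X) = fst X" "i \<le> n" "\<phi> \<in> CE (Suc n)"
  shows "ins_op r n i \<phi> \<in> CE n"
    and "c \<in> hom_chains (dbl D) n \<Longrightarrow>
      ins_op r n i \<phi> (elementary (dbl D) n m c) = \<phi> (elementary (dbl D) (Suc n) m (ins D r i c))"
  unfolding ins_op_def
  using E.pullback_cochain[OF cyclic_module_dbl multi_ins equivariant_ins] assms by blast+

lemma coface_last_elementary:
  assumes "\<phi> \<in> CE n" "c \<in> hom_chains (dbl D) (Suc n)"
  shows "coface H M (dbl D) n (Suc n) \<phi> (elementary (dbl D) (Suc n) m c) =
    tensor_lift (\<lambda>a x. \<phi> (elementary (dbl D) n x (merge_last (dbl D) (T a) c))) (coact M m)"
  using assms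
  by (simp add: E.coface_last E.cyclic_op_elementary E.coface_cochain E.rotated_def E.coface_elementary
      E.rotate_hom E.merge_0_rotate)

text \<open>With s the alternating sum of the insertions, \<open>homotopy_double_sum\<close> gives
  s(b \<phi>) + b(s \<phi>) = (end in the first copy) - \<phi>. The first term on the left vanishes
  for a cocycle and the first on the right for a kernel element, so \<phi> is \<open>b\<close> of
  the negative of s \<phi>. In degree 0 there is no s \<phi> and the identity reads \<phi> =
  0.\<close>

lemma b_exact:
  assumes \<phi>: "\<phi> \<in> CE n" and ker: "cochain_map D (dbl D) (incl D False) n \<phi> = 0" and b: "E.cc.b n \<phi> = 0"
  shows "if n = 0 then \<phi> = 0 else \<exists>\<psi>\<in>CE (n - 1). cochain_map D (dbl D) (incl D False) (n - 1) \<psi> = 0 \<and>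
    \<phi> = E.cc.b (n - 1) \<psi>"
proof -
  define r :: "'o \<times> bool \<Rightarrow> 'o \<times> bool" where "r X = (fst X, False)" for X
  have r: "fst (r X) = fst X" for X by (simp add: r_def)
  \<comment> \<open>The value for \<open>n = 0\<close> is a dummy: it occurs only under the empty
    sum over \<open>i < n\<close>.\<close>
  define B where "B i j m c = (case n of 0 \<Rightarrow> 0 | Suc n' \<Rightarrow>
    coface H M (dbl D) n' j (ins_op r n' i \<phi>) (elementary (dbl D) n m c))" for i j m c
  have key: "(\<Sum>j\<le>n. \<Sum>i<n. alt (i + j) (B i j m c)) = - \<phi> (elementary (dbl D) n m c)"
    if c: "c \<in> hom_chains (dbl D) n" for m c
  proof -
    define A where "A j i = coface H M (dbl D) n j \<phi> (elementary (dbl D) (Suc n) m (ins D r i c))" for i j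
    have ic: "ins D r i c \<in> hom_chains (dbl D) (Suc n)" if "i \<le> n" for i
      by (rule ins_hom[OF r c that])
    have "(\<Sum>i\<le>n. \<Sum>j\<le>Suc n. alt (i + j) (A j i)) + (\<Sum>j\<le>n. \<Sum>i<n. alt (i + j) (B i j m c)) = A 0 0 - A (Suc n) n"
    proof (rule homotopy_double_sum)
      show "A j (Suc i) = B i j m c" if ij: "j \<le> i" "i < n" for i j
      proof -
        obtain n' where n: "n = Suc n'" using ij by (cases n) auto
        show ?thesis
          using ij \<phi> c ic[of "Suc i"]
          by (simp add: A_def B_def n E.coface_elementary ins_op_cochain r E.merge_hom merge_ins_below)
      qed
      show "A (Suc j) i = B i j m c" if ij: "i < j" "j \<le> n" for i j
      proof -
        obtain n' where n: "n = Suc n'" using ij by (cases n) auto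
        show ?thesis
        \<comment> \<open>For \<open>j = n\<close> the coface \<open>j + 1\<close> of degree
          \<open>n\<close> is the last one, which involves the coaction.\<close>
        proof (cases "j = n")
          case True
          then show ?thesis
            using ij \<phi> c ic[of i]
            by (simp add: A_def B_def n coface_last_elementary ins_op_cochain r E.merge_last_hom merge_last_ins)
        next
          case False
          then show ?thesis
            using ij \<phi> c ic[of i]
            by (simp add: A_def B_def n E.coface_elementary ins_op_cochain r E.merge_hom merge_ins_above)
        qed
      qed
      show "A (Suc i) i = A (Suc i) (Suc i)" if "i < n" for i
        using that \<phi> ic[of i] ic[of "Suc i"]
        by (simp add: A_def E.coface_elementary merge_ins_diag[OF r c])
    qed
    moreover have "(\<Sum>i\<le>n. \<Sum>j\<le>Suc n. alt (i + j) (A j i)) = 0"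
    proof -
      have "(\<Sum>j\<le>Suc n. alt (i + j) (A j i)) = alt i (E.cc.b n \<phi> (elementary (dbl D) (Suc n) m (ins D r i c)))" for i
        by (simp only: E.cc.b_eq A_def alt_sum alt_alt alt_apply sum_apply)
      then show ?thesis by (simp add: b)
    qed
    \<comment> \<open>The projection sends the chain entirely to the first copy, where
      \<open>\<phi>\<close> vanishes.\<close>
    moreover have "A 0 0 = 0"
    proof -
      have "flat n (merge (dbl D) 0 (ins D r 0 c))"
        by (simp add: merge_0_ins_0[OF r c] flat_def r_def)
      then show ?thesis
        using ker incl_kernel_iff[OF \<phi>] E.merge_hom[OF ic[OF le0] le0]
        by (simp add: A_def E.coface_elementary[OF le0 \<phi> ic[OF le0]])
    qed
    \<comment> \<open>The inserted identity receives T(m(-1)) and turns it into its counit, after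
      which the counit axiom of the coaction gives back m.\<close>
    moreover have "A (Suc n) n = \<phi> (elementary (dbl D) n m c)"
    proof -
      have "\<phi> (elementary (dbl D) n x (set_arr c 0 (\<epsilon> (T a) *\<^sub>C arr c 0))) = \<epsilon> a *\<^sub>C \<phi> (elementary (dbl D) n x c)" for a x
        using chain_linear_vect_hom[OF E.multilinear_chain_linear[OF E.cochain_multilinear[OF \<phi>]] c le0 E.chain_subspace[OF c le0]]
          hom_chains_arr[OF c le0]
        by (simp add: vect_hom_subsp counit_T set_arr_arr hom_chains_length[OF c])
      then show ?thesis
        unfolding A_def coface_last_elementary[OF \<phi> ic[OF order_refl]] merge_last_ins_last[OF r c]
        using coact_counit_lift[OF E.multilinear_clinear[OF E.cochain_multilinear[OF \<phi>] c], of m] by simp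
    qed
    ultimately show ?thesis by simp
  qed
  show ?thesis
  proof (cases n)
    case 0
    have "\<phi> = 0"
      by (rule E.cochain_eqI[OF \<phi> cvec.subspace_0[OF E.subspace_cochains]])
        (use key 0 in simp)
    then show ?thesis using 0 by simp
  next
    case (Suc n')
    define \<psi> where "\<psi> = - (\<Sum>i\<le>n'. alt i (ins_op r n' i \<phi>))"
    have \<phi>': "\<phi> \<in> CE (Suc n')" using \<phi> Suc by simp
    have closed: "alt i (ins_op r n' i \<phi>) \<in> CE n'" if "i \<le> n'" for i
      by (intro E.cc.alt_closed ins_op_cochain(1)[OF r that \<phi>'])
    have sum: "(\<Sum>i\<le>n'. alt i (ins_op r n' i \<phi>)) \<in> CE n'"
      using closed by (intro cvec.subspace_sum[OF E.subspace_cochains]) simp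
    then have \<psi>: "\<psi> \<in> CE n'"
      unfolding \<psi>_def by (rule cvec.subspace_neg[OF E.subspace_cochains])
    have "\<phi> = E.cc.b n' \<psi>"
    proof (rule E.cochain_eqI[OF \<phi>'])
      show "E.cc.b n' \<psi> \<in> CE (Suc n')" by (rule vect_hom_closed[OF E.cc.b_hom \<psi>])
      fix m c assume c: "c \<in> hom_chains (dbl D) (Suc n')"
      have "E.cc.b n' (\<Sum>i\<le>n'. alt i (ins_op r n' i \<phi>)) =
          (\<Sum>j\<le>Suc n'. \<Sum>i\<le>n'. alt (i + j) (coface H M (dbl D) n' j (ins_op r n' i \<phi>)))"
        unfolding E.cc.b_eq
      proof (rule sum.cong)
        fix j assume "j \<in> {..Suc n'}"
        then have "coface H M (dbl D) n' j (\<Sum>i\<le>n'. alt i (ins_op r n' i \<phi>)) =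
            (\<Sum>i\<le>n'. alt i (coface H M (dbl D) n' j (ins_op r n' i \<phi>)))"
          by (intro vect_hom_alt_sum[OF E.cc.d_hom E.subspace_cochains] ins_op_cochain(1)[OF r _ \<phi>']) simp_all
        then show "alt j (coface H M (dbl D) n' j (\<Sum>i\<le>n'. alt i (ins_op r n' i \<phi>))) =
            (\<Sum>i\<le>n'. alt (i + j) (coface H M (dbl D) n' j (ins_op r n' i \<phi>)))"
          by (simp add: alt_sum alt_alt add.commute)
      qed simp
      then have "E.cc.b n' (\<Sum>i\<le>n'. alt i (ins_op r n' i \<phi>)) (elementary (dbl D) (Suc n') m c) =
          (\<Sum>j\<le>n. \<Sum>i<n. alt (i + j) (B i j m c))"
        by (simp add: sum_apply alt_apply B_def Suc lessThan_Suc_atMost)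
      then show "\<phi> (elementary (dbl D) (Suc n') m c) = E.cc.b n' \<psi> (elementary (dbl D) (Suc n') m c)"
        using key[of c m] c Suc unfolding \<psi>_def vect_hom_minus[OF E.cc.b_hom E.subspace_cochains sum] by simp
    qed
    moreover have "cochain_map D (dbl D) (incl D False) n' \<psi> = 0"
      unfolding incl_kernel_iff[OF \<psi>]
    proof (intro allI ballI impI)
      fix m c assume c: "c \<in> hom_chains (dbl D) n'" and fl: "flat n' c"
      have "ins_op r n' i \<phi> (elementary (dbl D) n' m c) = 0" if i: "i \<le> n'" for i
      proof -
        have "flat (Suc n') (ins D r i c)"
          by (rule flat_ins[OF c i fl r]) (simp add: r_def)
        then show ?thesis
          using ker[unfolded incl_kernel_iff[OF \<phi>]] ins_hom[OF r c i] Suc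
          by (simp add: ins_op_cochain(2)[OF r i \<phi>' c])
      qed
      then show "\<psi> (elementary (dbl D) n' m c) = 0"
        by (simp add: \<psi>_def sum_apply alt_apply)
    qed
    ultimately show ?thesis using \<psi> Suc by auto
  qed
qed

text \<open>Evaluating b' \<phi> = 0 on a chain with an identity appended, the top term is (-1)^n
  \<phi>. In all other terms the composition commutes with the insertion, so they add up to
  \<open>b'\<close> of the inserted cochain. The minus sign in the conclusion is that of the
  vertical map in the odd columns.\<close>

lemma b'_exact:
  assumes \<phi>: "\<phi> \<in> CE n" and ker: "cochain_map D (dbl D) (incl D False) n \<phi> = 0" and b': "E.cc.b' n \<phi> = 0"
  shows "if n = 0 then \<phi> = 0 else \<exists>\<psi>\<in>CE (n - 1). cochain_map D (dbl D) (incl D False) (n - 1) \<psi> = 0 \<and>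
    \<phi> = - E.cc.b' (n - 1) \<psi>"
proof -
  let ?r = "\<lambda>X :: 'o \<times> bool. X"
  have val: "alt n (\<phi> (elementary (dbl D) n m c)) =
      - (\<Sum>j<n. alt j (\<phi> (elementary (dbl D) n m (merge (dbl D) j (ins D ?r n c)))))"
    if c: "c \<in> hom_chains (dbl D) n" for m c
  proof -
    have "(\<Sum>j\<le>n. alt j (\<phi> (elementary (dbl D) n m (merge (dbl D) j (ins D ?r n c))))) =
        E.cc.b' n \<phi> (elementary (dbl D) (Suc n) m (ins D ?r n c))"
      unfolding E.cc.b'_eq
      using ins_hom[OF refl c order_refl] \<phi> by (simp add: sum_apply alt_apply E.coface_elementary)
    then have "(\<Sum>j\<le>n. alt j (\<phi> (elementary (dbl D) n m (merge (dbl D) j (ins D ?r n c))))) = 0"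
      by (simp add: b')
    then show ?thesis
      by (simp add: lessThan_Suc_atMost[symmetric] merge_ins_last_ident[OF c] eq_neg_iff_add_eq_0 add.commute)
  qed
  show ?thesis
  proof (cases n)
    case 0
    have "\<phi> = 0"
      by (rule E.cochain_eqI[OF \<phi> cvec.subspace_0[OF E.subspace_cochains]]) (use val 0 in simp)
    then show ?thesis using 0 by simp
  next
    case (Suc n')
    have \<phi>': "\<phi> \<in> CE (Suc n')" using \<phi> Suc by simp
    \<comment> \<open>The sign is that of the top term \<open>j = n\<close>, to be cleared from the
      equation \<open>val\<close>.\<close>
    define \<psi> where "\<psi> = alt n (ins_op ?r n' n' \<phi>)"
    have s: "ins_op ?r n' n' \<phi> \<in> CE n'"
      by (rule ins_op_cochain(1)[OF refl order_refl \<phi>'])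
    then have \<psi>: "\<psi> \<in> CE n'" unfolding \<psi>_def by (rule E.cc.alt_closed)
    have "\<phi> = - E.cc.b' n' \<psi>"
    proof (rule E.cochain_eqI[OF \<phi>'])
      have b'\<psi>: "E.cc.b' n' \<psi> \<in> CE (Suc n')" by (rule vect_hom_closed[OF E.cc.b'_hom \<psi>])
      then show "- E.cc.b' n' \<psi> \<in> CE (Suc n')" by (rule cvec.subspace_neg[OF E.subspace_cochains])
      fix m c assume c: "c \<in> hom_chains (dbl D) (Suc n')"
      define u where "u = (\<Sum>j<n. alt j (\<phi> (elementary (dbl D) n m (merge (dbl D) j (ins D ?r n c)))))"
      have "E.cc.b' n' \<psi> = alt n (E.cc.b' n' (ins_op ?r n' n' \<phi>))"
        unfolding \<psi>_def alt_def by (rule vect_hom_scale[OF E.cc.b'_hom s])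
      moreover have "E.cc.b' n' (ins_op ?r n' n' \<phi>) (elementary (dbl D) (Suc n') m c) = u"
        unfolding E.cc.b'_eq u_def Suc lessThan_Suc_atMost
        using c s \<phi>' by (simp add: sum_apply alt_apply E.coface_elementary ins_op_cochain E.merge_hom merge_ins_below)
      moreover have "u = - alt n (\<phi> (elementary (dbl D) n m c))"
        using val[of c m] c by (simp add: u_def Suc[symmetric])
      ultimately have "E.cc.b' n' \<psi> (elementary (dbl D) (Suc n') m c) = - alt n (alt n (\<phi> (elementary (dbl D) n m c)))"
        by (simp add: alt_apply alt_minus)
      then show "\<phi> (elementary (dbl D) (Suc n') m c) = (- E.cc.b' n' \<psi>) (elementary (dbl D) (Suc n') m c)"
        using Suc by (simp add: alt_alt alt_even)
    qed
    moreover have "cochain_map D (dbl D) (incl D False) n' \<psi> = 0"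
      unfolding incl_kernel_iff[OF \<psi>]
    proof (intro allI ballI impI)
      fix m c assume c: "c \<in> hom_chains (dbl D) n'" and fl: "flat n' c"
      have "flat (Suc n') (ins D ?r n' c)"
        by (rule flat_ins[OF c order_refl fl]) simp_all
      then show "\<psi> (elementary (dbl D) n' m c) = 0"
        using ker[unfolded incl_kernel_iff[OF \<phi>]] ins_hom[OF refl c order_refl] Suc
        by (simp add: \<psi>_def alt_apply ins_op_cochain(2)[OF refl order_refl \<phi>' c])
    qed
    ultimately show ?thesis using \<psi> Suc by auto
  qed
qed

lemma incl_kernel_coboundaries:
  assumes "x \<in> tot_cocycles (cyclic_bicomplex H M (dbl D)) n"
    and "tot_map (bicomplex_map D (dbl D) (incl D False)) n x = 0"
  shows "x \<in> tot_coboundaries (cyclic_bicomplex H M (dbl D)) n"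
proof (rule i.bm.kernel_coboundaries[where s = False, OF _ assms])
  fix p q \<phi>
  assume "\<phi> \<in> entry (cyclic_bicomplex H M (dbl D)) p q" "bicomplex_map D (dbl D) (incl D False) p q \<phi> = 0"
    "vert (cyclic_bicomplex H M (dbl D)) p q \<phi> = 0"
  then show "if q = 0 then \<phi> = 0 else \<exists>\<psi>\<in>entry (cyclic_bicomplex H M (dbl D)) p (q - 1).
      bicomplex_map D (dbl D) (incl D False) p (q - 1) \<psi> = 0 \<and> \<phi> = vert (cyclic_bicomplex H M (dbl D)) p (q - 1) \<psi>"
    using b_exact[of \<phi> q] b'_exact[of \<phi> q]
    by (cases "even p") (simp_all add: E.cyclic_bicomplex_eq E.cc.bicomplex_def bicomplex_map_def split: if_splits)
qed

lemma tot_map_comp: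
  assumes x: "x \<in> tot (cyclic_bicomplex H M D) n"
    and u: "H_semifunctor (dbl D) D \<beta>" and eq: "\<gamma> = comp_semifunctor D \<beta> (incl D s)"
  shows "tot_map (bicomplex_map D (dbl D) (incl D s)) n (tot_map (bicomplex_map (dbl D) D \<beta>) n x) =
    tot_map (bicomplex_map D D \<gamma>) n x"
proof
  fix p
  have "x p \<in> C (n - p)" if "p \<le> n"
    using dc.tot_entry[OF x that] by (simp add: cyclic_bicomplex_def)
  then show "tot_map (bicomplex_map D (dbl D) (incl D s)) n (tot_map (bicomplex_map (dbl D) D \<beta>) n x) p =
    tot_map (bicomplex_map D D \<gamma>) n x p"
    using cochain_map_comp[OF cyclic_module cyclic_module_dbl cyclic_module incl_H_semifunctor u]
    by (simp add: tot_map_def bicomplex_map_def eq)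
qed

lemma tot_map_id:
  assumes x: "x \<in> tot (cyclic_bicomplex H M D) n"
  shows "tot_map (bicomplex_map D D (id_semifunctor D)) n x = x"
proof
  fix p
  have "x p \<in> C (n - p)" if "p \<le> n"
    using dc.tot_entry[OF x that] by (simp add: cyclic_bicomplex_def)
  then show "tot_map (bicomplex_map D D (id_semifunctor D)) n x p = x p"
    using dc.tot_beyond[OF x, of p] by (simp add: tot_map_def bicomplex_map_def cochain_map_id)
qed

text \<open>
  The two functors \<open>untwist D \<eta>\<close> and \<open>untwist D (Id D)\<close> agree on the first copy of \<open>D\<close>, whose
  inclusion is injective on cohomology; so they have the same effect also after restriction to
  the second copy.
\<close>

lemma inner_automorphism_coboundary:
  assumes \<eta>: "\<eta> \<in> invariant_units H D" and x: "x \<in> tot_cocycles (cyclic_bicomplex H M D) n"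
  shows "tot_map (bicomplex_map D D (inner_automorphism D \<eta>)) n x - x \<in> tot_coboundaries (cyclic_bicomplex H M D) n"
proof -
  have U: "H_semifunctor (dbl D) D (untwist D \<eta>)" "H_semifunctor (dbl D) D (untwist D (Id D))"
    using untwist_H_semifunctor[OF \<eta>] untwist_H_semifunctor[OF Id_invariant_unit] by simp_all
  interpret u: cyclic_module_morphism H M "dbl D" D "untwist D \<eta>"
    by (intro E.morphismI cyclic_module U)
  interpret p: cyclic_module_morphism H M "dbl D" D "untwist D (Id D)"
    by (intro E.morphismI cyclic_module U)
  have xt: "x \<in> tot (cyclic_bicomplex H M D) n" using x by (simp add: tot_cocycles_def)
  define y z where "y = tot_map (bicomplex_map (dbl D) D (untwist D \<eta>)) n x"
    and "z = tot_map (bicomplex_map (dbl D) D (untwist D (Id D))) n x"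
  have yz: "y \<in> tot_cocycles (cyclic_bicomplex H M (dbl D)) n" "z \<in> tot_cocycles (cyclic_bicomplex H M (dbl D)) n"
    unfolding y_def z_def by (intro u.bm.tot_map_cocycles p.bm.tot_map_cocycles x)+
  then have yzt: "y \<in> tot (cyclic_bicomplex H M (dbl D)) n" "z \<in> tot (cyclic_bicomplex H M (dbl D)) n"
    by (simp_all add: tot_cocycles_def)
  \<comment> \<open>On either copy, \<open>untwist D (Id D)\<close> restricts to the identity
    functor, so \<open>z\<close> restricts to \<open>x\<close> for both values of
    \<open>s\<close>.\<close>
  have diff: "tot_map (bicomplex_map D (dbl D) (incl D s)) n (y - z) =
      tot_map (bicomplex_map D (dbl D) (incl D s)) n y - x" for s
    using vect_hom_diff[OF i.bm.tot_map_hom E.dc.subspace_tot yzt]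
      tot_map_comp[OF xt U(2) id_semifunctor_eq_Id] tot_map_id[OF xt]
    by (simp add: z_def)
  have "tot_map (bicomplex_map D (dbl D) (incl D False)) n (y - z) = 0"
    using diff[of False] tot_map_comp[OF xt U(1) id_semifunctor_eq] tot_map_id[OF xt] by (simp add: y_def)
  then have "y - z \<in> tot_coboundaries (cyclic_bicomplex H M (dbl D)) n"
    by (intro incl_kernel_coboundaries cvec.subspace_diff[OF E.dc.subspace_cocycles] yz)
  \<comment> \<open>A primitive of \<open>y - z\<close> lives on all of \<open>dbl D\<close>, hence
    can be restricted to the second copy, where \<open>y\<close> becomes the transform of
    \<open>x\<close> under the inner automorphism.\<close>
  then have "tot_map (bicomplex_map D (dbl D) (incl D True)) n (y - z) \<in> tot_coboundaries (cyclic_bicomplex H M D) n"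
    using i.bm.tot_map_coboundaries by blast
  then show ?thesis
    using diff[of True] tot_map_comp[OF xt U(1) inner_automorphism_eq] by (simp add: y_def)
qed

section \<open>Functoriality and inner automorphisms on cohomology classes\<close>

lemma HC_map_id:
  assumes "A \<in> carrier (HC H M D n)"
  shows "HC_map H M D D (id_semifunctor D) n A = A"
proof -
  interpret f: cyclic_module_morphism H M D D "id_semifunctor D"
    by (intro morphismI cyclic_module id_H_semifunctor[OF left_H_category_axioms])
  from assms obtain x where x: "x \<in> tot_cocycles (cyclic_bicomplex H M D) n"
    and A: "A = x +o tot_coboundaries (cyclic_bicomplex H M D) n"
    by (auto simp: carrier_HC)
  then show ?thesis
    by (simp add: f.HC_map_coset tot_map_id tot_cocycles_def)
qed

lemma HC_map_inner_automorphism: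
  assumes \<eta>: "\<eta> \<in> invariant_units H D" and "A \<in> carrier (HC H M D n)"
  shows "HC_map H M D D (inner_automorphism D \<eta>) n A = A"
proof -
  interpret f: cyclic_module_morphism H M D D "inner_automorphism D \<eta>"
    using inner_H_automorphism[OF \<eta>] by (intro morphismI cyclic_module) (simp add: H_automorphism_def)
  from assms(2) obtain x where x: "x \<in> tot_cocycles (cyclic_bicomplex H M D) n"
    and A: "A = x +o tot_coboundaries (cyclic_bicomplex H M D) n"
    by (auto simp: carrier_HC)
  then show ?thesis
    using inner_automorphism_coboundary[OF \<eta> x]
    by (simp add: f.HC_map_coset coset_eq_iff dc.subspace_coboundaries)
qed

end

lemma HC_map_comp:
  assumes D: "cyclic_module H M D" and D': "cyclic_module H M D'" and D'': "cyclic_module H M D''"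
    and \<alpha>: "H_semifunctor D D' \<alpha>" and \<beta>: "H_semifunctor D' D'' \<beta>" and "A \<in> carrier (HC H M D'' n)"
  shows "HC_map H M D D'' (comp_semifunctor D \<beta> \<alpha>) n A = HC_map H M D D' \<alpha> n (HC_map H M D' D'' \<beta> n A)"
proof -
  interpret A: cyclic_module H M D by (rule D)
  interpret B: cyclic_module H M D' by (rule D')
  interpret C: cyclic_module H M D'' by (rule D'')
  interpret a: cyclic_module_morphism H M D D' \<alpha> by (intro A.morphismI D' \<alpha>)
  interpret b: cyclic_module_morphism H M D' D'' \<beta> by (intro B.morphismI D'' \<beta>)
  interpret c: cyclic_module_morphism H M D D'' "comp_semifunctor D \<beta> \<alpha>"
    by (intro A.morphismI D'' comp_H_semifunctor[OF A.left_H_category_axioms \<alpha> \<beta>])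
  from assms(6) obtain x where x: "x \<in> tot_cocycles (cyclic_bicomplex H M D'') n"
    and A: "A = x +o tot_coboundaries (cyclic_bicomplex H M D'') n"
    by (auto simp: C.carrier_HC)
  have "x p \<in> cochains H M D'' (n - p)" if "p \<le> n" for p
    using C.dc.tot_entry[of x n p] x that by (simp add: tot_cocycles_def cyclic_bicomplex_def)
  then have "tot_map (bicomplex_map D D'' (comp_semifunctor D \<beta> \<alpha>)) n x =
      tot_map (bicomplex_map D D' \<alpha>) n (tot_map (bicomplex_map D' D'' \<beta>) n x)"
    using cochain_map_comp[OF D D' D'' \<alpha> \<beta>] by (auto simp: tot_map_def bicomplex_map_def)
  then show ?thesis
    using x by (simp add: A a.HC_map_coset b.HC_map_coset c.HC_map_coset b.bm.tot_map_cocycles)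
qed

theorem lemma7p4:
  fixes H :: "('h::complex_algebra) hopf"
    and M :: "('h, 'm::complex_vector) hopf_module"
    and D :: "('o1, 'f1::complex_vector, 'h) hcat"
    and D' :: "('o2, 'f2::complex_vector, 'h) hcat"
    and D'' :: "('o3, 'f3::complex_vector, 'h) hcat"
  assumes "hopf_algebra H"
    and "sayd_module H M"
    and "left_H_category H D"
    and "left_H_category H D'"
    and "left_H_category H D''"
  shows
    "(\<forall>\<alpha>. H_semifunctor D D' \<alpha> \<longrightarrow>
        (\<forall>n. cochain_map D D' \<alpha> n
              \<in> vect_hom (subsp (cochains H M D' n)) (subsp (cochains H M D n)) \<and>
             (\<forall>\<phi>\<in>cochains H M D' n. \<forall>\<psi>\<in>cochains H M D n.
                \<psi> = cochain_map D D' \<alpha> n \<phi> \<longleftrightarrow>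
                (\<forall>m. \<forall>c\<in>hom_chains D n.
                   \<psi> (elementary D n m c) = \<phi> (elementary D' n m (map_chain \<alpha> c))))) \<and>
        double_complex_morphism (cyclic_bicomplex H M D') (cyclic_bicomplex H M D)
          (bicomplex_map D D' \<alpha>) \<and>
        (\<forall>n. HC_map H M D D' \<alpha> n \<in> vect_hom (HC H M D' n) (HC H M D n))) \<and>
     (\<forall>n. module complex_field (HC H M D n)) \<and>
     (\<forall>n. \<forall>A\<in>carrier (HC H M D n). HC_map H M D D (id_semifunctor D) n A = A) \<and>
     (\<forall>\<alpha> \<beta>. H_semifunctor D D' \<alpha> \<longrightarrow> H_semifunctor D' D'' \<beta> \<longrightarrow>
        (\<forall>n. \<forall>A\<in>carrier (HC H M D'' n).
           HC_map H M D D'' (comp_semifunctor D \<beta> \<alpha>) n A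
             = HC_map H M D D' \<alpha> n (HC_map H M D' D'' \<beta> n A))) \<and>
     (\<forall>\<eta>\<in>invariant_units H D.
        H_automorphism D (inner_automorphism D \<eta>) \<and>
        (\<forall>n. \<forall>A\<in>carrier (HC H M D n). HC_map H M D D (inner_automorphism D \<eta>) n A = A))"
proof -
  have D: "cyclic_module H M D" and D': "cyclic_module H M D'" and D'': "cyclic_module H M D''"
    using assms by (simp_all add: cyclic_module_def)
  interpret A: cyclic_module H M D by (rule D)
  interpret B: cyclic_module H M D' by (rule D')
  have induced: "(\<forall>n. cochain_map D D' \<alpha> n
              \<in> vect_hom (subsp (cochains H M D' n)) (subsp (cochains H M D n)) \<and>
             (\<forall>\<phi>\<in>cochains H M D' n. \<forall>\<psi>\<in>cochains H M D n.
                \<psi> = cochain_map D D' \<alpha> n \<phi> \<longleftrightarrow>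
                (\<forall>m. \<forall>c\<in>hom_chains D n.
                   \<psi> (elementary D n m c) = \<phi> (elementary D' n m (map_chain \<alpha> c))))) \<and>
        double_complex_morphism (cyclic_bicomplex H M D') (cyclic_bicomplex H M D)
          (bicomplex_map D D' \<alpha>) \<and>
        (\<forall>n. HC_map H M D D' \<alpha> n \<in> vect_hom (HC H M D' n) (HC H M D n))"
    if \<alpha>: "H_semifunctor D D' \<alpha>" for \<alpha>
  proof -
    interpret a: cyclic_module_morphism H M D D' \<alpha> by (intro A.morphismI D' \<alpha>)
    show ?thesis
    proof (intro conjI allI ballI iffI)
      show "cochain_map D D' \<alpha> n \<in> vect_hom (subsp (cochains H M D' n)) (subsp (cochains H M D n))" for n
        by (rule a.cochain_map_hom)
      show "\<psi> (elementary D n m c) = \<phi> (elementary D' n m (map_chain \<alpha> c))"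
        if "\<phi> \<in> cochains H M D' n" "c \<in> hom_chains D n" "\<psi> = cochain_map D D' \<alpha> n \<phi>" for n \<phi> \<psi> m c
        using that by (simp add: a.cochain_map_elementary)
      \<comment> \<open>Elementary tensors span the nerve, so the prescribed values leave only one
        cochain.\<close>
      show "\<psi> = cochain_map D D' \<alpha> n \<phi>"
        if "\<phi> \<in> cochains H M D' n" "\<psi> \<in> cochains H M D n"
          "\<forall>m. \<forall>c\<in>hom_chains D n. \<psi> (elementary D n m c) = \<phi> (elementary D' n m (map_chain \<alpha> c))" for n \<phi> \<psi>
        by (rule a.cochain_map_eqI[symmetric]) (use that in auto)
      show "double_complex_morphism (cyclic_bicomplex H M D') (cyclic_bicomplex H M D) (bicomplex_map D D' \<alpha>)"
        by (rule a.bm.morphism)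
      show "HC_map H M D D' \<alpha> n \<in> vect_hom (HC H M D' n) (HC H M D n)" for n
        by (rule a.HC_map_hom)
    qed
  qed
  show ?thesis
  proof (intro conjI, goal_cases)
    case 1
    show ?case by (intro allI impI) (rule induced)
  next
    case 2
    show ?case by (intro allI) (rule A.module_HC)
  next
    case 3
    show ?case by (intro allI ballI) (rule A.HC_map_id)
  next
    case 4
    show ?case by (intro allI impI ballI) (rule HC_map_comp[OF D D' D''])
  next
    case 5
    show ?case
      by (intro ballI conjI allI) (rule A.inner_H_automorphism A.HC_map_inner_automorphism; assumption)+
  qed
qed

end
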